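(* Let $M$ be a 7-dimensional smooth manifold equipped with a closed and harmonic $\mathrm{G}_2^*$-structure $\varphi$, and let $g_\varphi$ be the pseudo-Riemannian metric on $M$ determined by $\varphi$. Then the scalar curvature $\mathrm{scal}(g_\varphi)$ of $g_\varphi$ vanishes. Therefore, if $g_\varphi$ is Einstein, then $g_\varphi$ is Ricci-flat.
   Context: $M$ is not assumed compact. A $\mathrm{G}_2^*$-structure on a real 7-dimensional vector space $V$ is a 3-form $\varphi\in\Lambda^3(V^* )$ for which there is a basis $\{v^1,\dots,v^7\}$ of $V^*$ with $\varphi=-v^{127}-v^{347}+v^{567}+v^{135}-v^{146}-v^{236}-v^{245}$, where $v^{ijk}=v^i\wedge v^j\wedge v^k$. It determines (independently of the choice of such a basis) the scalar product $g_\varphi=-(v^1)^2-(v^2)^2-(v^3)^2-(v^4)^2+(v^5)^2+(v^6)^2+(v^7)^2$ of signature $(3,4)$ and the volume form $\mathrm{vol}_\varphi=v^1\wedge\dots\wedge v^7$; invariantly, $g_\varphi(v,w)\,\mathrm{vol}_\varphi=\frac16\,\iota_v\varphi\wedge\iota_w\varphi\wedge\varphi$. A $\mathrm{G}_2^*$-structure on a smooth 7-manifold $M$ is a differential 3-form $\varphi\in\Omega^3(M)$ such that $\varphi_p$ is a $\mathrm{G}_2^*$-structure on $T_pM$ for every $p\in M$. It determines pointwise a pseudo-Riemannian metric $g_\varphi$ of signature $(3,4)$, an orientation with volume form $\mathrm{vol}_\varphi$, and hence a Hodge star operator $\star_\varphi$ ($\alpha\wedge\star_\varphi\beta=g_\varphi(\alpha,\beta)\mathrm{vol}_\varphi$).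 $\varphi$ is closed if $d\varphi=0$. A $k$-form $\alpha$ on $M$ is harmonic if $\Delta_\varphi\alpha=0$, where $\Delta_\varphi\alpha=(d\delta+\delta d)\alpha$ and $\delta\alpha=(-1)^{7(k+1)+1}\star_\varphi d\star_\varphi\alpha$ for a $k$-form $\alpha$; $\varphi$ is called harmonic if it is harmonic as a 3-form with respect to its own Laplacian $\Delta_\varphi$. A pseudo-Riemannian metric $g$ is Einstein if $\mathrm{Ric}(g)=\lambda g$ for some real constant $\lambda$, and Ricci-flat if $\mathrm{Ric}(g)=0$. *)

theory Defs
  imports "HOL-Analysis.Analysis"
begin

section \<open>Smooth manifolds\<close>

text \<open>\<open>C\<^sup>k\<close>-regularity on a set that is meant to be open.\<close>

primrec Ck_on :: "nat \<Rightarrow> 'a::real_normed_vector set \<Rightarrow> ('a \<Rightarrow> 'b::real_normed_vector) \<Rightarrow> bool" where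
  "Ck_on 0 S f \<longleftrightarrow> continuous_on S f"
| "Ck_on (Suc k) S f \<longleftrightarrow>
     (\<forall>x\<in>S. f differentiable (at x)) \<and> (\<forall>v. Ck_on k S (\<lambda>x. frechet_derivative f (at x) v))"

definition smooth_on :: "'a::real_normed_vector set \<Rightarrow> ('a \<Rightarrow> 'b::real_normed_vector) \<Rightarrow> bool" where
  "smooth_on S f \<longleftrightarrow> (\<forall>k. Ck_on k S f)"

text \<open>A chart is a pair \<open>(U, \<psi>)\<close> of a domain and a coordinate map; only the values of \<open>\<psi>\<close> on
  \<open>U\<close> matter.\<close>

type_synonym ('a, 'n) chart = "'a set \<times> ('a \<Rightarrow> real ^ 'n)"

definition chart_image :: "('a, 'n::finite) chart \<Rightarrow> (real ^ 'n) set" where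
  "chart_image c = snd c ` fst c"

definition transition :: "('a, 'n::finite) chart \<Rightarrow> ('a, 'n) chart \<Rightarrow> real ^ 'n \<Rightarrow> real ^ 'n" where
  "transition c c' = snd c' \<circ> inv_into (fst c) (snd c)"

definition overlap_image :: "('a, 'n::finite) chart \<Rightarrow> ('a, 'n) chart \<Rightarrow> (real ^ 'n) set" where
  "overlap_image c c' = snd c ` (fst c \<inter> fst c')"

definition is_chart :: "'a topology \<Rightarrow> ('a, 'n::finite) chart \<Rightarrow> bool" where
  "is_chart X c \<longleftrightarrow>
     openin X (fst c) \<and> open (chart_image c) \<and>
     homeomorphic_map (subtopology X (fst c)) (top_of_set (chart_image c)) (snd c)"

text \<open>The space \<open>X\<close> with a smooth atlas \<open>A\<close>, not required to be maximal. The dimension is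
  \<open>CARD('n)\<close>; neither compactness nor connectedness is imposed.\<close>

definition smooth_manifold :: "'a topology \<Rightarrow> ('a, 'n::finite) chart set \<Rightarrow> bool" where
  "smooth_manifold X A \<longleftrightarrow>
     Hausdorff_space X \<and> second_countable X \<and>
     (\<forall>c\<in>A. is_chart X c) \<and> (\<Union>c\<in>A. fst c) = topspace X \<and>
     (\<forall>c\<in>A. \<forall>c'\<in>A. smooth_on (overlap_image c c') (transition c c'))"


section \<open>Exterior algebra\<close>

text \<open>A \<open>k\<close>-form on a vector space is a function on lists of vectors which vanishes on lists of
  length different from \<open>k\<close> and is multilinear and alternating on those of length \<open>k\<close>.\<close>

type_synonym 'v form = "'v list \<Rightarrow> real"

definition forms :: "nat \<Rightarrow> 'v::real_vector form set" where
  "forms k = {\<alpha>.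
     (\<forall>vs. length vs \<noteq> k \<longrightarrow> \<alpha> vs = 0) \<and>
     (\<forall>vs i. length vs = k \<and> i < k \<longrightarrow> linear (\<lambda>v. \<alpha> (vs[i := v]))) \<and>
     (\<forall>vs i j. length vs = k \<and> i < k \<and> j < k \<and> i \<noteq> j \<and> vs ! i = vs ! j \<longrightarrow> \<alpha> vs = 0)}"

text \<open>Wedge product of a \<open>p\<close>-form with a \<open>q\<close>-form, normalised so that
  \<open>(a \<and> b)(v, w) = a(v) b(w) - a(w) b(v)\<close> for 1-forms \<open>a\<close>, \<open>b\<close>.\<close>

definition wedge :: "nat \<Rightarrow> nat \<Rightarrow> 'v form \<Rightarrow> 'v form \<Rightarrow> 'v form" where
  "wedge p q \<alpha> \<beta> = (\<lambda>vs. if length vs = p + q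
     then (\<Sum>\<pi> | \<pi> permutes {..<p + q}. of_int (sign \<pi>)
             * \<alpha> (map (\<lambda>i. vs ! \<pi> i) [0..<p]) * \<beta> (map (\<lambda>i. vs ! \<pi> i) [p..<p + q]))
          / (fact p * fact q)
     else 0)"

definition one_form :: "('v::real_normed_vector \<Rightarrow>\<^sub>L real) \<Rightarrow> 'v form" where
  "one_form a = (\<lambda>vs. if length vs = 1 then a (hd vs) else 0)"

primrec wedge_list :: "('v::real_normed_vector \<Rightarrow>\<^sub>L real) list \<Rightarrow> 'v form" where
  "wedge_list [] = (\<lambda>vs. if vs = [] then 1 else 0)"
| "wedge_list (a # as) = wedge 1 (length as) (one_form a) (wedge_list as)"

text \<open>Scalar products are functions of two vectors. \<open>gram g\<close> is the matrix \<open>(g\<^sub>i\<^sub>j)\<close> in the standard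
  basis, \<open>cogram g\<close> its inverse \<open>(g\<^sup>i\<^sup>j)\<close>.\<close>

definition gram :: "(real ^ 'n \<Rightarrow> real ^ 'n \<Rightarrow> real) \<Rightarrow> real ^ 'n ^ 'n::finite" where
  "gram g = (\<chi> i j. g (axis i 1) (axis j 1))"

definition cogram :: "(real ^ 'n \<Rightarrow> real ^ 'n \<Rightarrow> real) \<Rightarrow> real ^ 'n ^ 'n::finite" where
  "cogram g = matrix_inv (gram g)"

text \<open>The induced scalar product of \<open>k\<close>-forms,
  \<open>1/k! g\<^sup>i\<^sup>1\<^sup>j\<^sup>1 \<cdots> g\<^sup>i\<^sup>k\<^sup>j\<^sup>k \<alpha>(e\<^sub>i\<^sub>1,\<dots>,e\<^sub>i\<^sub>k) \<beta>(e\<^sub>j\<^sub>1,\<dots>,e\<^sub>j\<^sub>k)\<close>; the factor \<open>1/k!\<close> makes the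
  \<open>k\<close>-fold wedge products of an orthonormal coframe orthonormal.\<close>

definition form_inner ::
  "nat \<Rightarrow> (real ^ 'n \<Rightarrow> real ^ 'n \<Rightarrow> real) \<Rightarrow> (real ^ 'n::finite) form \<Rightarrow> (real ^ 'n) form \<Rightarrow> real" where
  "form_inner k g \<alpha> \<beta> =
     (\<Sum>I | length I = k. \<Sum>J | length J = k. (\<Prod>l<k. cogram g $ (I ! l) $ (J ! l))
        * \<alpha> (map (\<lambda>i. axis i 1) I) * \<beta> (map (\<lambda>j. axis j 1) J)) / fact k"

definition hodge_star ::
  "nat \<Rightarrow> (real ^ 7 \<Rightarrow> real ^ 7 \<Rightarrow> real) \<Rightarrow> (real ^ 7) form \<Rightarrow> (real ^ 7) form \<Rightarrow> (real ^ 7) form" where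
  "hodge_star k g vol \<beta> = (THE \<gamma>. \<gamma> \<in> forms (7 - k) \<and>
     (\<forall>\<alpha>\<in>forms k. wedge k (7 - k) \<alpha> \<gamma> = (\<lambda>vs. form_inner k g \<alpha> \<beta> * vol vs)))"


section \<open>\<open>G\<^sub>2\<^sup>*\<close>-structures on a vector space\<close>

text \<open>The coframe is \<open>v 1, \<dots>, v 7\<close>; the other values of \<open>v\<close> are irrelevant.\<close>

definition g2s_form :: "(nat \<Rightarrow> (real ^ 7) \<Rightarrow>\<^sub>L real) \<Rightarrow> (real ^ 7) form" where
  "g2s_form v = (\<lambda>ws.
     - wedge_list [v 1, v 2, v 7] ws - wedge_list [v 3, v 4, v 7] ws + wedge_list [v 5, v 6, v 7] ws
     + wedge_list [v 1, v 3, v 5] ws - wedge_list [v 1, v 4, v 6] ws - wedge_list [v 2, v 3, v 6] ws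
     - wedge_list [v 2, v 4, v 5] ws)"

definition adapted_coframe :: "(real ^ 7) form \<Rightarrow> (nat \<Rightarrow> (real ^ 7) \<Rightarrow>\<^sub>L real) \<Rightarrow> bool" where
  "adapted_coframe \<phi> v \<longleftrightarrow>
     inj_on v {1..7} \<and> independent (v ` {1..7}) \<and> span (v ` {1..7}) = UNIV \<and> \<phi> = g2s_form v"

definition g2s_structure :: "(real ^ 7) form \<Rightarrow> bool" where
  "g2s_structure \<phi> \<longleftrightarrow> (\<exists>v. adapted_coframe \<phi> v)"

text \<open>Metric and volume form are read off from some adapted coframe; they do not depend on which.\<close>

definition g2s_coframe :: "(real ^ 7) form \<Rightarrow> nat \<Rightarrow> (real ^ 7) \<Rightarrow>\<^sub>L real" where
  "g2s_coframe \<phi> = (SOME v. adapted_coframe \<phi> v)"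

definition g2s_metric :: "(real ^ 7) form \<Rightarrow> real ^ 7 \<Rightarrow> real ^ 7 \<Rightarrow> real" where
  "g2s_metric \<phi> x y = (let v = g2s_coframe \<phi> in
     - (\<Sum>i\<in>{1..4}. v i x * v i y) + (\<Sum>i\<in>{5..7}. v i x * v i y))"

definition g2s_vol :: "(real ^ 7) form \<Rightarrow> (real ^ 7) form" where
  "g2s_vol \<phi> = wedge_list (map (g2s_coframe \<phi>) [1, 2, 3, 4, 5, 6, 7])"

definition g2s_star :: "nat \<Rightarrow> (real ^ 7) form \<Rightarrow> (real ^ 7) form \<Rightarrow> (real ^ 7) form" where
  "g2s_star k \<phi> = hodge_star k (g2s_metric \<phi>) (g2s_vol \<phi>)"


section \<open>Differential forms\<close>

text \<open>Forms on coordinate space are functions of the point. The degree of \<open>\<omega>\<close> enters the exterior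
  derivative only through the length of the argument list:
  \<open>d\<omega>(v\<^sub>0,\<dots>,v\<^sub>k) = \<Sum>\<^sub>i (-1)\<^sup>i \<partial>\<^sub>v\<^sub>i (\<omega>(v\<^sub>0,\<dots>,v\<^sub>i\<^sub>-\<^sub>1,v\<^sub>i\<^sub>+\<^sub>1,\<dots>,v\<^sub>k))\<close>.\<close>

definition ext_deriv :: "('v::real_normed_vector \<Rightarrow> 'v form) \<Rightarrow> 'v \<Rightarrow> 'v form" where
  "ext_deriv \<omega> x = (\<lambda>vs. \<Sum>i<length vs.
     (- 1) ^ i * frechet_derivative (\<lambda>y. \<omega> y (take i vs @ drop (Suc i) vs)) (at x) (vs ! i))"

definition pullback :: "('v::real_normed_vector \<Rightarrow> 'v) \<Rightarrow> ('v \<Rightarrow> 'v form) \<Rightarrow> 'v \<Rightarrow> 'v form" where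
  "pullback \<tau> \<omega> x = (\<lambda>vs. \<omega> (\<tau> x) (map (frechet_derivative \<tau> (at x)) vs))"

text \<open>The codifferential and the Laplacian on \<open>k\<close>-forms with respect to the field \<open>\<phi>\<close> of
  \<open>G\<^sub>2\<^sup>*\<close>-structures. The codifferential vanishes on functions.\<close>

definition codifferential ::
  "nat \<Rightarrow> (real ^ 7 \<Rightarrow> (real ^ 7) form) \<Rightarrow> (real ^ 7 \<Rightarrow> (real ^ 7) form) \<Rightarrow> real ^ 7 \<Rightarrow> (real ^ 7) form" where
  "codifferential k \<phi> \<alpha> x = (\<lambda>vs. if k \<in> {1..7}
     then (- 1) ^ (7 * (k + 1) + 1)
       * g2s_star (8 - k) (\<phi> x) (ext_deriv (\<lambda>y. g2s_star k (\<phi> y) (\<alpha> y)) x) vs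
     else 0)"

definition laplacian ::
  "nat \<Rightarrow> (real ^ 7 \<Rightarrow> (real ^ 7) form) \<Rightarrow> (real ^ 7 \<Rightarrow> (real ^ 7) form) \<Rightarrow> real ^ 7 \<Rightarrow> (real ^ 7) form" where
  "laplacian k \<phi> \<alpha> x = (\<lambda>vs.
     ext_deriv (codifferential k \<phi> \<alpha>) x vs + codifferential (k + 1) \<phi> (ext_deriv \<alpha>) x vs)"

text \<open>Tensor fields on a manifold are given by their coordinate expressions: \<open>\<omega> c\<close> is the expression
  of \<open>\<omega>\<close> in the chart \<open>c\<close>, a field on the image of \<open>c\<close>. The expressions of a differential form are
  smooth and related by pullback along the transition maps. Natural operations such as \<open>d\<close>, the
  Laplacian or the curvature act on each coordinate expression separately.\<close>

definition differential_form ::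
  "('a, 'n::finite) chart set \<Rightarrow> nat \<Rightarrow> (('a, 'n) chart \<Rightarrow> real ^ 'n \<Rightarrow> (real ^ 'n) form) \<Rightarrow> bool" where
  "differential_form A k \<omega> \<longleftrightarrow>
     (\<forall>c\<in>A. (\<forall>x\<in>chart_image c. \<omega> c x \<in> forms k) \<and>
             (\<forall>vs. smooth_on (chart_image c) (\<lambda>x. \<omega> c x vs))) \<and>
     (\<forall>c\<in>A. \<forall>c'\<in>A. \<forall>x\<in>overlap_image c c'. \<omega> c x = pullback (transition c c') (\<omega> c') x)"

definition closed_form ::
  "('a, 'n::finite) chart set \<Rightarrow> (('a, 'n) chart \<Rightarrow> real ^ 'n \<Rightarrow> (real ^ 'n) form) \<Rightarrow> bool" where
  "closed_form A \<omega> \<longleftrightarrow> (\<forall>c\<in>A. \<forall>x\<in>chart_image c. ext_deriv (\<omega> c) x = (\<lambda>_. 0))"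

definition g2s_structure_on ::
  "('a, 7) chart set \<Rightarrow> (('a, 7) chart \<Rightarrow> real ^ 7 \<Rightarrow> (real ^ 7) form) \<Rightarrow> bool" where
  "g2s_structure_on A \<phi> \<longleftrightarrow>
     differential_form A 3 \<phi> \<and> (\<forall>c\<in>A. \<forall>x\<in>chart_image c. g2s_structure (\<phi> c x))"

text \<open>The \<open>k\<close>-form \<open>\<alpha>\<close> is harmonic with respect to the \<open>G\<^sub>2\<^sup>*\<close>-structure \<open>\<phi>\<close>.\<close>

definition harmonic_form ::
  "('a, 7) chart set \<Rightarrow> (('a, 7) chart \<Rightarrow> real ^ 7 \<Rightarrow> (real ^ 7) form)
     \<Rightarrow> nat \<Rightarrow> (('a, 7) chart \<Rightarrow> real ^ 7 \<Rightarrow> (real ^ 7) form) \<Rightarrow> bool" where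
  "harmonic_form A \<phi> k \<alpha> \<longleftrightarrow>
     (\<forall>c\<in>A. \<forall>x\<in>chart_image c. laplacian k (\<phi> c) (\<alpha> c) x = (\<lambda>_. 0))"


section \<open>Curvature\<close>

type_synonym 'n metric_field = "real ^ 'n \<Rightarrow> real ^ 'n \<Rightarrow> real ^ 'n \<Rightarrow> real"

definition partial :: "'n::finite \<Rightarrow> (real ^ 'n \<Rightarrow> real) \<Rightarrow> real ^ 'n \<Rightarrow> real" where
  "partial i f x = frechet_derivative f (at x) (axis i 1)"

text \<open>\<open>christoffel g k i j\<close> is \<open>\<Gamma>\<^sup>k\<^sub>i\<^sub>j\<close> of the Levi-Civita connection of \<open>g\<close>.\<close>

definition christoffel :: "'n::finite metric_field \<Rightarrow> 'n \<Rightarrow> 'n \<Rightarrow> 'n \<Rightarrow> real ^ 'n \<Rightarrow> real" where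
  "christoffel g k i j x = (\<Sum>l\<in>UNIV. cogram (g x) $ k $ l *
     (partial i (\<lambda>y. gram (g y) $ j $ l) x + partial j (\<lambda>y. gram (g y) $ i $ l) x
      - partial l (\<lambda>y. gram (g y) $ i $ j) x)) / 2"

text \<open>\<open>riemann g l k i j\<close> is the \<open>l\<close>-th component of \<open>R(\<partial>\<^sub>i,\<partial>\<^sub>j)\<partial>\<^sub>k\<close>, where
  \<open>R(X,Y) = \<nabla>\<^sub>X\<nabla>\<^sub>Y - \<nabla>\<^sub>Y\<nabla>\<^sub>X - \<nabla>\<^sub>[\<^sub>X\<^sub>,\<^sub>Y\<^sub>]\<close>.\<close>

definition riemann :: "'n::finite metric_field \<Rightarrow> 'n \<Rightarrow> 'n \<Rightarrow> 'n \<Rightarrow> 'n \<Rightarrow> real ^ 'n \<Rightarrow> real" where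
  "riemann g l k i j x =
     partial i (christoffel g l j k) x - partial j (christoffel g l i k) x
     + (\<Sum>m\<in>UNIV. christoffel g l i m x * christoffel g m j k x
                 - christoffel g l j m x * christoffel g m i k x)"

definition ricci :: "'n::finite metric_field \<Rightarrow> 'n \<Rightarrow> 'n \<Rightarrow> real ^ 'n \<Rightarrow> real" where
  "ricci g j k x = (\<Sum>i\<in>UNIV. riemann g i k i j x)"

definition scalar_curvature :: "'n::finite metric_field \<Rightarrow> real ^ 'n \<Rightarrow> real" where
  "scalar_curvature g x = (\<Sum>j\<in>UNIV. \<Sum>k\<in>UNIV. cogram (g x) $ j $ k * ricci g j k x)"

definition scalar_curvature_vanishes ::
  "('a, 'n::finite) chart set \<Rightarrow> (('a, 'n) chart \<Rightarrow> 'n metric_field) \<Rightarrow> bool" where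
  "scalar_curvature_vanishes A g \<longleftrightarrow> (\<forall>c\<in>A. \<forall>x\<in>chart_image c. scalar_curvature (g c) x = 0)"

definition einstein ::
  "('a, 'n::finite) chart set \<Rightarrow> (('a, 'n) chart \<Rightarrow> 'n metric_field) \<Rightarrow> bool" where
  "einstein A g \<longleftrightarrow>
     (\<exists>\<kappa>::real. \<forall>c\<in>A. \<forall>x\<in>chart_image c. \<forall>j k. ricci (g c) j k x = \<kappa> * gram (g c x) $ j $ k)"

definition ricci_flat ::
  "('a, 'n::finite) chart set \<Rightarrow> (('a, 'n) chart \<Rightarrow> 'n metric_field) \<Rightarrow> bool" where
  "ricci_flat A g \<longleftrightarrow> (\<forall>c\<in>A. \<forall>x\<in>chart_image c. \<forall>j k. ricci (g c) j k x = 0)"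

definition g2s_metric_field ::
  "(('a, 7) chart \<Rightarrow> real ^ 7 \<Rightarrow> (real ^ 7) form) \<Rightarrow> ('a, 7) chart \<Rightarrow> 7 metric_field" where
  "g2s_metric_field \<phi> c x = g2s_metric (\<phi> c x)"

end

theory Submission
  imports Defs "HOL-Combinatorics.Multiset_Permutations"
begin

text \<open>Let \<open>\<nabla>\<close> be the Levi-Civita connection of the metric and \<open>t\<^sub>a\<^sub>b = \<nabla>\<^sup>m\<phi>\<^sub>m\<^sub>a\<^sub>b\<close>, so that \<open>t = -\<delta>\<phi>\<close>. If
  \<open>d\<phi> = 0\<close>, differentiating \<open>\<phi>\<^sub>i\<^sub>a\<^sub>b\<phi>\<^sub>j\<^sup>a\<^sup>b = 6g\<^sub>i\<^sub>j\<close> gives \<open>t\<^sub>a\<^sub>b\<phi>\<^sup>i\<^sup>a\<^sup>b = 0\<close>. The divergence of this vector field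
  is \<open>|t|\<^sup>2 = t\<^sub>a\<^sub>bt\<^sup>a\<^sup>b\<close> plus a contraction of \<open>dt\<close> with \<open>\<phi>\<close>. As \<open>\<phi>\<close> is closed and harmonic, \<open>d\<delta>\<phi> = 0\<close>, that is
  \<open>dt = 0\<close>, and hence \<open>|t|\<^sup>2 = 0\<close>; since the metric is indefinite, this does not make \<open>t\<close> vanish. By the first
  Bianchi identity, the Ricci identity for \<open>\<nabla>\<^sub>n\<nabla>\<^sub>m\<phi>\<close>, contracted with \<open>\<phi>\<close>, expresses \<open>4 scal\<close> by a contraction
  of \<open>dt\<close> with \<open>\<phi>\<close> and a quadratic form in \<open>\<nabla>\<phi>\<close>. The former vanishes, and linear algebra in an adapted frame
  shows that for closed \<open>\<phi>\<close> the latter equals \<open>-2|t|\<^sup>2\<close>. So the scalar curvature vanishes, and in the Einstein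
  case \<open>7\<lambda> = scal = 0\<close>.\<close>


section \<open>Calculus of smooth functions\<close>

text \<open>Two settings have to be joined. Derivatives live in chart coordinates, where the metric
  is a matrix of functions; the algebra of \<open>\<phi>\<close>, metric and volume is polynomial
  and is checked in an adapted frame at a single point. The frames come from a pointwise choice and
  are never differentiated. Only relations that hold as equations between coordinate components on
  an open set are: skewness, closedness, V^2 = det g, and the contraction of two copies of
  \<open>\<phi>\<close> to 6 times the identity. The 6 counts the two orders of the remaining
  indices in each of the three monomials of \<open>\<phi>\<close> that contain a given index. The 4
  in front of the scalar curvature is 6 - 1 - 1: in the Ricci identity the slot contracted with the
  metric contributes 6, and the other two contribute -1 each, once the Bianchi identity has removed
  their part along the dual 4-form. Harmonicity is used pointwise: since d\<phi> vanishes on the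
  whole chart, so does \<delta>d\<phi>, and d\<delta>\<phi> = 0 remains; nothing is integrated. To
  turn this into a statement on t, the two Hodge stars, defined by a universal property, are
  computed with the Levi-Civita symbol.\<close>

lemma Ck_on_SucD: "Ck_on (Suc k) S f \<Longrightarrow> Ck_on k S f"
proof (induction k arbitrary: f)
  case 0
  then show ?case
    by (auto intro!: continuous_at_imp_continuous_on differentiable_imp_continuous_within)
next
  case (Suc k)
  then show ?case by (metis Ck_on.simps(2))
qed

text \<open>Openness of \<open>S\<close> lets equality on \<open>S\<close> pass to the Frechet
  derivatives, so that the induction on the order can proceed.\<close>

lemma Ck_on_cong:
  assumes "open S" "\<And>x. x \<in> S \<Longrightarrow> f x = g x" "Ck_on k S f"
  shows "Ck_on k S g"
  using assms(2,3)
proof (induction k arbitrary: f g)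
  case 0
  then show ?case using continuous_on_cong by (metis Ck_on.simps(1))
next
  case (Suc k)
  have d: "f differentiable (at x)" if "x \<in> S" for x using Suc.prems that by auto
  have fd: "frechet_derivative f (at x) = frechet_derivative g (at x)" if "x \<in> S" for x
    by (rule frechet_derivative_transform_within_open[OF d[OF that] assms(1) that])
      (use Suc.prems in auto)
  have "g differentiable (at x)" if "x \<in> S" for x
    using d[OF that] has_derivative_transform_within_open[of f _ x UNIV S g] assms(1) that Suc.prems(1)
    unfolding differentiable_def by blast
  moreover have "Ck_on k S (\<lambda>x. frechet_derivative g (at x) v)" for v
    by (rule Suc.IH[of "\<lambda>x. frechet_derivative f (at x) v"]) (use fd Suc.prems in auto)
  ultimately show ?case by simp
qed

text \<open>\<open>frechet_derivative\<close> is a choice operator. Uniqueness of derivatives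
  identifies it with an explicit \<open>f'\<close>, so that the rules below reduce to the regularity
  of a formula.\<close>

lemma Ck_on_SucI:
  assumes "open S" "\<And>x. x \<in> S \<Longrightarrow> (f has_derivative f' x) (at x)" "\<And>v. Ck_on k S (\<lambda>x. f' x v)"
  shows "Ck_on (Suc k) S f"
proof -
  have fd: "frechet_derivative f (at x) = f' x" if "x \<in> S" for x
    by (rule frechet_derivative_at[OF assms(2)[OF that], symmetric])
  have "Ck_on k S (\<lambda>x. frechet_derivative f (at x) v)" for v
    by (rule Ck_on_cong[OF assms(1) _ assms(3)[of v]]) (simp add: fd)
  then show ?thesis using assms(2) by (auto simp: differentiable_def)
qed

lemma Ck_on_Suc_has_derivative:
  "Ck_on (Suc k) S f \<Longrightarrow> x \<in> S \<Longrightarrow> (f has_derivative frechet_derivative f (at x)) (at x)"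
  using frechet_derivative_works by auto

lemma Ck_on_const: "Ck_on k S (\<lambda>x. c)"
  by (induction k arbitrary: c) auto

lemma Ck_on_add:
  fixes f g :: "'a::real_normed_vector \<Rightarrow> real"
  assumes "open S" shows "Ck_on k S f \<Longrightarrow> Ck_on k S g \<Longrightarrow> Ck_on k S (\<lambda>x. f x + g x)"
proof (induction k arbitrary: f g)
  case 0
  then show ?case by (auto intro: continuous_intros)
next
  case (Suc k)
  show ?case
    by (rule Ck_on_SucI[OF assms has_derivative_add[OF Suc.prems[THEN Ck_on_Suc_has_derivative]]])
      (use Suc in auto)
qed

lemma Ck_on_mult:
  fixes f g :: "'a::real_normed_vector \<Rightarrow> real"
  assumes "open S" shows "Ck_on k S f \<Longrightarrow> Ck_on k S g \<Longrightarrow> Ck_on k S (\<lambda>x. f x * g x)"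
proof (induction k arbitrary: f g)
  case 0
  then show ?case by (auto intro: continuous_intros)
next
  case (Suc k)
  show ?case
    by (rule Ck_on_SucI[OF assms has_derivative_mult[OF Suc.prems[THEN Ck_on_Suc_has_derivative]]])
      (use Suc Ck_on_SucD[OF Suc.prems(1)] Ck_on_SucD[OF Suc.prems(2)] in
        \<open>auto intro!: Ck_on_add[OF assms]\<close>)
qed

lemma Ck_on_inverse:
  fixes f :: "'a::real_normed_vector \<Rightarrow> real"
  assumes "open S" "\<And>x. x \<in> S \<Longrightarrow> f x \<noteq> 0"
  shows "Ck_on k S f \<Longrightarrow> Ck_on k S (\<lambda>x. inverse (f x))"
proof (induction k)
  case 0
  then show ?case using assms(2) by (auto intro!: continuous_intros)
next
  case (Suc k)
  have i: "Ck_on k S (\<lambda>x. inverse (f x))" using Suc Ck_on_SucD by blast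
  \<comment> \<open>The derivative is a product of reciprocals of \<open>f\<close> and a derivative
    of \<open>f\<close>, so the induction hypothesis covers the reciprocals.\<close>
  have d: "((\<lambda>x. inverse (f x)) has_derivative
      (\<lambda>v. (- 1) * (inverse (f x) * frechet_derivative f (at x) v * inverse (f x)))) (at x)"
    if "x \<in> S" for x
    using Deriv.has_derivative_inverse[OF assms(2)[OF that] Ck_on_Suc_has_derivative[OF Suc.prems that]]
    by simp
  show ?case
    by (rule Ck_on_SucI[OF assms(1) d])
      (assumption, intro Ck_on_mult[OF assms(1)] Ck_on_const i, use Suc.prems in auto)
qed

text \<open>The derivative is written as root(f) * (1/f) * f' / n, so that the root reappears with
  one order less to prove. The case n = 9 later recovers the volume density.\<close>

lemma Ck_on_root:
  fixes f :: "'a::real_normed_vector \<Rightarrow> real"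
  assumes "open S" "\<And>x. x \<in> S \<Longrightarrow> f x \<noteq> 0" "odd n"
  shows "Ck_on k S f \<Longrightarrow> Ck_on k S (\<lambda>x. root n (f x))"
proof (induction k)
  case 0
  then show ?case using assms(3) by (auto intro!: continuous_on_real_root)
next
  case (Suc k)
  have i: "Ck_on k S (\<lambda>x. root n (f x))" using Suc Ck_on_SucD by blast
  have d: "((\<lambda>x. root n (f x)) has_derivative
      (\<lambda>v. inverse n * (root n (f x) * inverse (f x)) * frechet_derivative f (at x) v)) (at x)"
    if "x \<in> S" for x
  proof -
    have nz: "f x \<noteq> 0" and n: "n > 0" using assms that by (auto simp: odd_pos)
    have r: "root n (f x) ^ n = f x" using assms(3) by (simp add: odd_real_root_pow)
    have "root n (f x) * root n (f x) ^ (n - Suc 0) = f x"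
      using r n by (metis Suc_pred power_Suc One_nat_def)
    then have e: "inverse (real n * root n (f x) ^ (n - Suc 0))
        = inverse n * (root n (f x) * inverse (f x))"
      using nz n by (simp add: field_simps)
    have "DERIV (root n) (f x) :> inverse n * (root n (f x) * inverse (f x))"
      using DERIV_odd_real_root[OF assms(3) nz] by (simp only: e)
    from DERIV_compose_FDERIV[OF this Ck_on_Suc_has_derivative[OF Suc.prems that]]
    show ?thesis by (simp add: mult_ac)
  qed
  show ?case
    by (rule Ck_on_SucI[OF assms(1) d])
      (assumption, intro Ck_on_mult[OF assms(1)] Ck_on_const Ck_on_inverse[OF assms(1,2)] i
        Ck_on_SucD[OF Suc.prems], use Suc.prems in auto)
qed

lemma smooth_on_const [simp]: "smooth_on S (\<lambda>x. c)"
  by (simp add: smooth_on_def Ck_on_const)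

lemma smooth_on_add:
  fixes f g :: "'a::real_normed_vector \<Rightarrow> real"
  shows "open S \<Longrightarrow> smooth_on S f \<Longrightarrow> smooth_on S g \<Longrightarrow> smooth_on S (\<lambda>x. f x + g x)"
  by (simp add: smooth_on_def Ck_on_add)

lemma smooth_on_mult:
  fixes f g :: "'a::real_normed_vector \<Rightarrow> real"
  shows "open S \<Longrightarrow> smooth_on S f \<Longrightarrow> smooth_on S g \<Longrightarrow> smooth_on S (\<lambda>x. f x * g x)"
  by (simp add: smooth_on_def Ck_on_mult)

lemma smooth_on_minus:
  fixes f :: "'a::real_normed_vector \<Rightarrow> real"
  shows "open S \<Longrightarrow> smooth_on S f \<Longrightarrow> smooth_on S (\<lambda>x. - f x)"
  using smooth_on_mult[of S "\<lambda>_. - 1" f] by simp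

lemma smooth_on_diff:
  fixes f g :: "'a::real_normed_vector \<Rightarrow> real"
  shows "open S \<Longrightarrow> smooth_on S f \<Longrightarrow> smooth_on S g \<Longrightarrow> smooth_on S (\<lambda>x. f x - g x)"
  using smooth_on_add[of S f "\<lambda>x. - g x"] smooth_on_minus[of S g] by simp

lemma smooth_on_inverse:
  fixes f :: "'a::real_normed_vector \<Rightarrow> real"
  shows "open S \<Longrightarrow> smooth_on S f \<Longrightarrow> (\<And>x. x \<in> S \<Longrightarrow> f x \<noteq> 0) \<Longrightarrow> smooth_on S (\<lambda>x. inverse (f x))"
  by (simp add: smooth_on_def Ck_on_inverse)

lemma smooth_on_divide:
  fixes f g :: "'a::real_normed_vector \<Rightarrow> real"
  shows "open S \<Longrightarrow> smooth_on S f \<Longrightarrow> smooth_on S g \<Longrightarrow> (\<And>x. x \<in> S \<Longrightarrow> g x \<noteq> 0)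
    \<Longrightarrow> smooth_on S (\<lambda>x. f x / g x)"
  by (simp add: divide_inverse smooth_on_mult smooth_on_inverse)

lemma smooth_on_root:
  fixes f :: "'a::real_normed_vector \<Rightarrow> real"
  shows "open S \<Longrightarrow> smooth_on S f \<Longrightarrow> (\<And>x. x \<in> S \<Longrightarrow> f x \<noteq> 0) \<Longrightarrow> odd n
    \<Longrightarrow> smooth_on S (\<lambda>x. root n (f x))"
  by (simp add: smooth_on_def Ck_on_root)

lemma smooth_on_sum:
  fixes f :: "'i \<Rightarrow> 'a::real_normed_vector \<Rightarrow> real"
  shows "open S \<Longrightarrow> (\<And>i. i \<in> I \<Longrightarrow> smooth_on S (f i)) \<Longrightarrow> smooth_on S (\<lambda>x. \<Sum>i\<in>I. f i x)"
  by (induction I rule: infinite_finite_induct) (auto intro: smooth_on_add)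

lemma smooth_on_prod:
  fixes f :: "'i \<Rightarrow> 'a::real_normed_vector \<Rightarrow> real"
  shows "open S \<Longrightarrow> (\<And>i. i \<in> I \<Longrightarrow> smooth_on S (f i)) \<Longrightarrow> smooth_on S (\<lambda>x. \<Prod>i\<in>I. f i x)"
  by (induction I rule: infinite_finite_induct) (auto intro: smooth_on_mult)

lemma smooth_on_det:
  fixes M :: "'a::real_normed_vector \<Rightarrow> real ^ 'n ^ 'n"
  assumes "open S" "\<And>i j. smooth_on S (\<lambda>x. M x $ i $ j)"
  shows "smooth_on S (\<lambda>x. det (M x))"
  unfolding det_def using assms by (intro smooth_on_sum smooth_on_mult smooth_on_prod) auto

lemma smooth_on_cong:
  "open S \<Longrightarrow> smooth_on S f \<Longrightarrow> (\<And>x. x \<in> S \<Longrightarrow> f x = g x) \<Longrightarrow> smooth_on S g"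
  unfolding smooth_on_def using Ck_on_cong by blast

lemma smooth_on_differentiable: "smooth_on S f \<Longrightarrow> x \<in> S \<Longrightarrow> f differentiable (at x)"
  unfolding smooth_on_def by (drule spec[of _ "Suc 0"]) simp

lemma smooth_on_continuous: "smooth_on S f \<Longrightarrow> continuous_on S f"
  unfolding smooth_on_def by (drule spec[of _ 0]) simp

lemma smooth_on_frechet: "smooth_on S f \<Longrightarrow> smooth_on S (\<lambda>x. frechet_derivative f (at x) v)"
  unfolding smooth_on_def by (intro allI, drule_tac x = "Suc k" in spec) simp

lemma smooth_on_partial: "smooth_on S f \<Longrightarrow> smooth_on S (partial i f)"
  unfolding partial_def by (rule smooth_on_frechet)

lemmas smooth_intros = smooth_on_const smooth_on_add smooth_on_mult smooth_on_minus smooth_on_diff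
  smooth_on_sum smooth_on_prod smooth_on_partial

section \<open>Partial derivatives and the symmetry of second derivatives\<close>

lemma frechet_derivative_eqI: "(f has_derivative f') (at x) \<Longrightarrow> frechet_derivative f (at x) = f'"
  by (rule frechet_derivative_at[symmetric])

lemma partial_cong:
  assumes "open S" "x \<in> S" "f differentiable (at x)" "\<And>y. y \<in> S \<Longrightarrow> f y = g y"
  shows "partial i f x = partial i g x"
  unfolding partial_def
  by (simp add: frechet_derivative_transform_within_open[OF assms(3,1,2) assms(4)])

lemma partial_const [simp]: "partial i (\<lambda>y. c) x = 0"
  by (simp add: partial_def)

lemma partial_eq_0:
  assumes "open S" "x \<in> S" "\<And>y. y \<in> S \<Longrightarrow> f y = c"
  shows "partial i f x = 0"
proof -
  have "partial i (\<lambda>y. c) x = partial i f x"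
    by (rule partial_cong[OF assms(1,2)]) (use assms(3) in auto)
  then show ?thesis by simp
qed

lemma partial_eqI: "(f has_derivative f') (at x) \<Longrightarrow> partial i f x = f' (axis i 1)"
  unfolding partial_def by (simp only: frechet_derivative_eqI)

lemma partial_diff:
  "f differentiable (at x) \<Longrightarrow> g differentiable (at x)
   \<Longrightarrow> partial i (\<lambda>y. f y - g y) x = partial i f x - partial i g x"
  by (rule partial_eqI[THEN trans, OF has_derivative_diff[OF frechet_derivative_works[THEN iffD1]
      frechet_derivative_works[THEN iffD1]]]) (auto simp: partial_def)

lemma partial_minus:
  "f differentiable (at x) \<Longrightarrow> partial i (\<lambda>y. - f y) x = - partial i f x"
  by (rule partial_eqI[THEN trans, OF has_derivative_minus[OF frechet_derivative_works[THEN iffD1]]])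
    (auto simp: partial_def)

lemma partial_mult:
  "f differentiable (at x) \<Longrightarrow> g differentiable (at x)
   \<Longrightarrow> partial i (\<lambda>y. f y * g y) x = partial i f x * g x + f x * partial i g x"
  by (rule partial_eqI[THEN trans, OF has_derivative_mult[OF frechet_derivative_works[THEN iffD1]
      frechet_derivative_works[THEN iffD1]]]) (auto simp: partial_def)

lemma partial_sum:
  "(\<And>j. j \<in> J \<Longrightarrow> f j differentiable (at x))
   \<Longrightarrow> partial i (\<lambda>y. \<Sum>j\<in>J. f j y) x = (\<Sum>j\<in>J. partial i (f j) x)"
  by (rule partial_eqI[THEN trans, OF has_derivative_sum[OF frechet_derivative_works[THEN iffD1]]])
    (auto simp: partial_def)

text \<open>The second difference of \<open>f\<close> over a small parallelogram with sides
  \<open>h a\<close> and \<open>h b\<close> is h^2 times either mixed derivative at some point of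
  the ball. Continuity of both at \<open>x\<close> then excludes different values.\<close>

lemma frechet_derivative_commute:
  fixes f :: "'a::real_normed_vector \<Rightarrow> real"
  assumes S: "open S" "x \<in> S" and f: "smooth_on S f"
  shows "frechet_derivative (\<lambda>y. frechet_derivative f (at y) a) (at x) b
       = frechet_derivative (\<lambda>y. frechet_derivative f (at y) b) (at x) a"
proof (rule ccontr)
  define A where "A a b y = frechet_derivative (\<lambda>y. frechet_derivative f (at y) a) (at y) b" for a b y
  assume "\<not> ?thesis"
  then have ne: "A a b x \<noteq> A b a x" by (simp add: A_def)
  \<comment> \<open>Half the gap: numbers within \<open>d\<close> of the two values cannot
    coincide.\<close>
  define d where "d = \<bar>A a b x - A b a x\<bar> / 2"
  have d: "d > 0" using ne by (simp add: d_def)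
  have sm: "smooth_on S (A a b)" for a b
    unfolding A_def by (intro smooth_on_frechet f)
  have near: "\<exists>e>0. ball x e \<subseteq> S \<and> (\<forall>y\<in>ball x e. \<bar>A a b y - A a b x\<bar> < d)" for a b
  proof -
    have "isCont (A a b) x"
      using smooth_on_continuous[OF sm] S continuous_on_eq_continuous_at by blast
    then obtain e1 where e1: "e1 > 0" "\<And>y. dist y x < e1 \<Longrightarrow> \<bar>A a b y - A a b x\<bar> < d"
      using d unfolding continuous_at_eps_delta dist_real_def by metis
    obtain e2 where "e2 > 0" "ball x e2 \<subseteq> S" using S openE by blast
    then show ?thesis using e1 by (intro exI[of _ "min e1 e2"]) (auto simp: dist_commute)
  qed
  obtain e1 where e1: "e1 > 0" "ball x e1 \<subseteq> S" "\<And>y. y \<in> ball x e1 \<Longrightarrow> \<bar>A a b y - A a b x\<bar> < d"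
    using near by blast
  obtain e2 where e2: "e2 > 0" "ball x e2 \<subseteq> S" "\<And>y. y \<in> ball x e2 \<Longrightarrow> \<bar>A b a y - A b a x\<bar> < d"
    using near by blast
  define e where "e = min e1 e2"
  have e: "e > 0" "ball x e \<subseteq> S" using e1 e2 by (auto simp: e_def)
  \<comment> \<open>The parallelogram then stays within e/2 of \<open>x\<close>; the summand 1 keeps
    the denominator positive.\<close>
  define h where "h = e / (2 * (norm a + norm b + 1))"
  have h: "h > 0" unfolding h_def using e
    by (intro divide_pos_pos mult_pos_pos) (auto intro: add_nonneg_pos)
  have inb: "x + s *\<^sub>R a + t *\<^sub>R b \<in> ball x e" if "0 \<le> s" "s \<le> h" "0 \<le> t" "t \<le> h" for s t
  proof -
    have "norm (s *\<^sub>R a + t *\<^sub>R b) \<le> s * norm a + t * norm b"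
      using norm_triangle_ineq[of "s *\<^sub>R a" "t *\<^sub>R b"] that by simp
    also have "\<dots> \<le> h * norm a + h * norm b"
      using that by (intro add_mono mult_right_mono) auto
    also have "\<dots> \<le> h * (norm a + norm b + 1)" using h by (simp add: algebra_simps)
    also have "\<dots> = e / 2"
      using norm_ge_zero[of a] norm_ge_zero[of b] unfolding h_def
      by (simp add: divide_simps del: norm_ge_zero)
    also have "\<dots> < e" using e by simp
    finally have "norm (s *\<^sub>R a + t *\<^sub>R b) < e" .
    moreover have "dist x (x + s *\<^sub>R a + t *\<^sub>R b) = norm (s *\<^sub>R a + t *\<^sub>R b)"
      by (metis add.assoc add_diff_cancel_left' dist_commute dist_norm)
    ultimately show ?thesis by simp
  qed
  have fd: "(g has_derivative frechet_derivative g (at y)) (at y)" if "smooth_on S g" "y \<in> S" for g :: "'a \<Rightarrow> real" and y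
    using smooth_on_differentiable[OF that] frechet_derivative_works by blast
  have line: "((\<lambda>s. g (p + s *\<^sub>R c)) has_real_derivative frechet_derivative g (at (p + s *\<^sub>R c)) c) (at s)"
    if "smooth_on S g" "p + s *\<^sub>R c \<in> S" for g :: "'a \<Rightarrow> real" and p c s
  proof -
    have l: "((\<lambda>s. p + s *\<^sub>R c) has_derivative (\<lambda>s. s *\<^sub>R c)) (at s)"
      by (auto intro!: derivative_eq_intros)
    have "((\<lambda>s. g (p + s *\<^sub>R c)) has_derivative (\<lambda>r. frechet_derivative g (at (p + s *\<^sub>R c)) (r *\<^sub>R c))) (at s)"
      using diff_chain_at[OF l fd[OF that]] by (simp add: o_def)
    moreover have "linear (frechet_derivative g (at (p + s *\<^sub>R c)))"
      using smooth_on_differentiable[OF that] linear_frechet_derivative by blast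
    ultimately show ?thesis
      by (simp add: has_field_derivative_def linear_cmul mult.commute[of _ "frechet_derivative g _ _"])
  qed
  have key: "\<exists>p\<in>ball x e. A a b p * h * h =
      f (x + h *\<^sub>R a + h *\<^sub>R b) - f (x + h *\<^sub>R a) - f (x + h *\<^sub>R b) + f x"
    if ab: "\<And>s t. 0 \<le> s \<Longrightarrow> s \<le> h \<Longrightarrow> 0 \<le> t \<Longrightarrow> t \<le> h \<Longrightarrow> x + s *\<^sub>R a + t *\<^sub>R b \<in> ball x e" for a b
  proof -
    \<comment> \<open>The mean value theorem is applied twice: to the difference \<open>u\<close>
      along \<open>a\<close>, then to the derivative in direction \<open>a\<close> along
      \<open>b\<close>.\<close>
    define u where "u s = f ((x + h *\<^sub>R b) + s *\<^sub>R a) - f (x + s *\<^sub>R a)" for s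
    have "(u has_real_derivative frechet_derivative f (at ((x + h *\<^sub>R b) + s *\<^sub>R a)) a
        - frechet_derivative f (at (x + s *\<^sub>R a)) a) (at s)" if "0 \<le> s" "s \<le> h" for s
      unfolding u_def using ab[of s h] ab[of s 0] that h e(2)
      by (intro DERIV_diff line f) (auto simp: algebra_simps)
    from MVT2[OF h this] obtain s where s: "0 < s" "s < h"
      "u h - u 0 = h * (frechet_derivative f (at ((x + h *\<^sub>R b) + s *\<^sub>R a)) a
        - frechet_derivative f (at (x + s *\<^sub>R a)) a)" by auto
    have "((\<lambda>t. frechet_derivative f (at ((x + s *\<^sub>R a) + t *\<^sub>R b)) a) has_real_derivative
       A a b ((x + s *\<^sub>R a) + t *\<^sub>R b)) (at t)" if "0 \<le> t" "t \<le> h" for t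
      unfolding A_def using ab[of s t] that s e(2)
      by (intro line smooth_on_frechet f) auto
    from MVT2[OF h this] obtain t where t: "0 < t" "t < h"
      "frechet_derivative f (at ((x + s *\<^sub>R a) + h *\<^sub>R b)) a - frechet_derivative f (at ((x + s *\<^sub>R a) + 0 *\<^sub>R b)) a
        = h * A a b ((x + s *\<^sub>R a) + t *\<^sub>R b)" by auto
    have "u h - u 0 = h * (h * A a b ((x + s *\<^sub>R a) + t *\<^sub>R b))"
      using s(3) t(3) by (simp add: algebra_simps)
    moreover have "u h - u 0 = f (x + h *\<^sub>R a + h *\<^sub>R b) - f (x + h *\<^sub>R a) - f (x + h *\<^sub>R b) + f x"
      by (simp add: u_def algebra_simps)
    ultimately show ?thesis
      using ab[of s t] s t by (intro bexI[of _ "x + s *\<^sub>R a + t *\<^sub>R b"]) (auto simp: algebra_simps)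
  qed
  obtain p where p: "p \<in> ball x e" "A a b p * h * h =
      f (x + h *\<^sub>R a + h *\<^sub>R b) - f (x + h *\<^sub>R a) - f (x + h *\<^sub>R b) + f x"
    using key[OF inb] by blast
  have inb': "x + s *\<^sub>R b + t *\<^sub>R a \<in> ball x e" if "0 \<le> s" "s \<le> h" "0 \<le> t" "t \<le> h" for s t
    using inb[of t s] that by (simp add: algebra_simps)
  obtain q where q: "q \<in> ball x e" "A b a q * h * h =
      f (x + h *\<^sub>R b + h *\<^sub>R a) - f (x + h *\<^sub>R b) - f (x + h *\<^sub>R a) + f x"
    using key[OF inb'] by blast
  have "x + h *\<^sub>R b + h *\<^sub>R a = x + h *\<^sub>R a + h *\<^sub>R b" by simp
  then have "A a b p * h * h = A b a q * h * h" unfolding p(2) q(2) by (simp only: diff_right_commute)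
  then have "A a b p = A b a q" using h by simp
  moreover have "\<bar>A a b p - A a b x\<bar> < d" "\<bar>A b a q - A b a x\<bar> < d"
    using e1 e2 p q by (auto simp: e_def)
  ultimately show False unfolding d_def by (smt (verit) field_sum_of_halves)
qed

lemma partial_commute:
  "open S \<Longrightarrow> x \<in> S \<Longrightarrow> smooth_on S f \<Longrightarrow> partial i (partial j f) x = partial j (partial i f) x"
  unfolding partial_def by (rule frechet_derivative_commute)

section \<open>Alternating forms\<close>

text \<open>Kept apart from \<open>forms\<close> because tensor products of forms are multilinear
  without being alternating.\<close>

definition multilinear :: "nat \<Rightarrow> ('v::real_vector) form \<Rightarrow> bool" where
  "multilinear k M \<longleftrightarrow> (\<forall>vs i. length vs = k \<and> i < k \<longrightarrow> linear (\<lambda>v. M (vs[i := v])))"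

lemma forms_multilinear: "\<alpha> \<in> forms k \<Longrightarrow> multilinear k \<alpha>"
  by (simp add: forms_def multilinear_def)

lemma forms_length: "\<alpha> \<in> forms k \<Longrightarrow> length vs \<noteq> k \<Longrightarrow> \<alpha> vs = 0"
  by (simp add: forms_def)

lemma forms_linear: "\<alpha> \<in> forms k \<Longrightarrow> length vs = k \<Longrightarrow> i < k \<Longrightarrow> linear (\<lambda>v. \<alpha> (vs[i := v]))"
  by (simp add: forms_def)

lemma forms_repeat:
  "\<alpha> \<in> forms k \<Longrightarrow> i < length vs \<Longrightarrow> j < length vs \<Longrightarrow> i \<noteq> j \<Longrightarrow> vs ! i = vs ! j \<Longrightarrow> \<alpha> vs = 0"
  unfolding forms_def by (cases "length vs = k") blast+

lemma forms_not_distinct: "\<alpha> \<in> forms k \<Longrightarrow> \<not> distinct vs \<Longrightarrow> \<alpha> vs = 0"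
  unfolding distinct_conv_nth using forms_repeat by blast

lemma formsI:
  assumes "\<And>vs. length vs \<noteq> k \<Longrightarrow> \<alpha> vs = 0"
    and "\<And>vs i. length vs = k \<Longrightarrow> i < k \<Longrightarrow> linear (\<lambda>v. \<alpha> (vs[i := v]))"
    and "\<And>vs i j. length vs = k \<Longrightarrow> i < k \<Longrightarrow> j < k \<Longrightarrow> i \<noteq> j \<Longrightarrow> vs ! i = vs ! j \<Longrightarrow> \<alpha> vs = 0"
  shows "\<alpha> \<in> forms k"
  using assms unfolding forms_def by blast

lemma linear_scaled: "linear f \<Longrightarrow> linear (\<lambda>x. c * f x :: real)"
  using linear_compose_scale_right[of f c] by simp

lemma forms_scale: "\<alpha> \<in> forms k \<Longrightarrow> (\<lambda>vs. c * \<alpha> vs) \<in> forms k"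
  unfolding forms_def by (auto intro: linear_scaled)

lemma forms_add: "\<alpha> \<in> forms k \<Longrightarrow> \<beta> \<in> forms k \<Longrightarrow> (\<lambda>vs. \<alpha> vs + \<beta> vs) \<in> forms k"
  unfolding forms_def by (auto intro: linear_compose_add)

lemma forms_0: "(\<lambda>vs. 0) \<in> forms k"
  by (auto intro!: formsI linearI)

lemma forms_sum: "(\<And>i. i \<in> I \<Longrightarrow> \<alpha> i \<in> forms k) \<Longrightarrow> (\<lambda>vs. \<Sum>i\<in>I. \<alpha> i vs) \<in> forms k"
  by (induction I rule: infinite_finite_induct) (auto intro: forms_add forms_0)

lemma forms_swap:
  assumes a: "\<alpha> \<in> forms k" and l: "length vs = k" "i < k" "j < k" "i \<noteq> j"
  shows "\<alpha> (vs[i := vs ! j, j := vs ! i]) = - \<alpha> vs"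
proof -
  define h where "h x y = \<alpha> (vs[i := x, j := y])" for x y
  have 1: "linear (h x)" for x
    unfolding h_def using forms_linear[OF a, of "vs[i := x]" j] l by simp
  have 2: "linear (\<lambda>x. h x y)" for y
    unfolding h_def using forms_linear[OF a, of "vs[j := y]" i] l
    by (simp add: list_update_swap)
  have d: "h x x = 0" for x
    unfolding h_def by (rule forms_repeat[OF a, of i _ j]) (use l in auto)
  \<comment> \<open>Polarisation of \<open>h x x = 0\<close>.\<close>
  have "h (x + y) (x + y) = h x x + h x y + (h y x + h y y)" for x y
    using linear_add[OF 1] linear_add[OF 2] by simp
  then have "h x y = - h y x" for x y using d by (metis add.commute add_0 add_0_right minus_unique minus_minus)
  then have "h (vs ! j) (vs ! i) = - h (vs ! i) (vs ! j)" .
  then show ?thesis by (simp add: h_def)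
qed

lemma forms_permute:
  assumes a: "\<alpha> \<in> forms k" and p: "\<pi> permutes {..<k}" and l: "length vs = k"
  shows "\<alpha> (map (\<lambda>i. vs ! \<pi> i) [0..<k]) = of_int (sign \<pi>) * \<alpha> vs"
  using p finite_lessThan[of k] l
proof (induction \<pi> arbitrary: vs rule: permutes_induct)
  case id
  then show ?case using map_nth[of vs] by (simp add: sign_id)
next
  case (swap i j p)
  let ?vs = "vs[i := vs ! j, j := vs ! i]"
  have "map (\<lambda>l. vs ! (Transposition.transpose i j \<circ> p) l) [0..<k] = map (\<lambda>l. ?vs ! p l) [0..<k]"
    using swap permutes_in_image[OF \<open>p permutes {..<k}\<close>]
    by (auto simp: Transposition.transpose_def nth_list_update)
  then have "\<alpha> (map (\<lambda>l. vs ! (Transposition.transpose i j \<circ> p) l) [0..<k]) = of_int (sign p) * \<alpha> ?vs"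
    using swap.IH[of ?vs] swap.prems by (simp only: length_list_update)
  also have "\<alpha> ?vs = - \<alpha> vs" by (rule forms_swap[OF a]) (use swap in auto)
  also have "sign (Transposition.transpose i j \<circ> p) = - sign p"
    using swap by (subst sign_compose) (auto simp: sign_swap_id permutation_swap_id intro: permutes_imp_permutation[OF _ \<open>p permutes {..<k}\<close>])
  then have "of_int (sign p) * - \<alpha> vs = of_int (sign (Transposition.transpose i j \<circ> p)) * \<alpha> vs"
    by simp
  finally show ?case .
qed

lemma multilinear_eq_on_span:
  assumes M: "multilinear k M" "multilinear k N"
    and eq: "\<And>L. length L = k \<Longrightarrow> set L \<subseteq> B \<Longrightarrow> M L = N L"
    and vs: "length vs = k" "set vs \<subseteq> span B"
  shows "M vs = N vs"
proof -
  \<comment> \<open>Induction on the number \<open>j\<close> of leading entries that may lie in the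
    span; the remaining entries already belong to \<open>B\<close>.\<close>
  have "M vs = N vs" if "j \<le> k" "length vs = k" "set vs \<subseteq> span B" "set (drop j vs) \<subseteq> B" for j vs
    using that
  proof (induction j arbitrary: vs)
    case 0
    then show ?case using eq by simp
  next
    case (Suc j)
    have lin: "linear (\<lambda>v. M (vs[j := v]))" "linear (\<lambda>v. N (vs[j := v]))"
      using M Suc.prems by (auto simp: multilinear_def)
    have "vs ! j \<in> span B" using Suc.prems by auto
    then have "M (vs[j := vs ! j]) = N (vs[j := vs ! j])"
    proof (rule linear_eq_on_span[OF lin, rotated])
      fix b assume b: "b \<in> B"
      show "M (vs[j := b]) = N (vs[j := b])"
      proof (rule Suc.IH)
        show "set (vs[j := b]) \<subseteq> span B"
          using set_update_subset_insert[of vs j b] Suc.prems b span_base[of b B] by blast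
        have "drop j (vs[j := b]) = b # drop (Suc j) vs"
          using Suc.prems by (simp add: Cons_nth_drop_Suc[symmetric] drop_update_cancel)
        then show "set (drop j (vs[j := b])) \<subseteq> B" using b Suc.prems by simp
      qed (use Suc.prems in auto)
    qed
    then show ?case by simp
  qed
  from this[of k] vs show ?thesis by simp
qed

text \<open>There is no factor 1/k!: in this normalisation \<open>wedge p q\<close> is the
  alternation of the tensor product divided by p! q!.\<close>

definition alternation :: "nat \<Rightarrow> 'v form \<Rightarrow> 'v form" where
  "alternation k M = (\<lambda>vs. if length vs = k
     then (\<Sum>\<pi> | \<pi> permutes {..<k}. of_int (sign \<pi>) * M (map (\<lambda>i. vs ! \<pi> i) [0..<k])) else 0)"

lemma map_nth_permuted_update:
  assumes "\<pi> permutes {..<k}" "length vs = k" "i < k"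
  shows "map (\<lambda>l. vs[i := v] ! \<pi> l) [0..<k] = (map (\<lambda>l. vs ! \<pi> l) [0..<k])[inv \<pi> i := v]"
proof (rule nth_equalityI)
  fix l assume "l < length (map (\<lambda>l. vs[i := v] ! \<pi> l) [0..<k])"
  then have l: "l < k" by simp
  have "\<pi> l < k" using permutes_in_image[OF assms(1)] l by simp
  moreover have "\<pi> l = i \<longleftrightarrow> l = inv \<pi> i" using permutes_inverses[OF assms(1)] by metis
  ultimately show "map (\<lambda>l. vs[i := v] ! \<pi> l) [0..<k] ! l = (map (\<lambda>l. vs ! \<pi> l) [0..<k])[inv \<pi> i := v] ! l"
    using l assms by (auto simp: nth_list_update)
qed simp

lemma alternation_in_forms:
  assumes M: "multilinear k M" shows "alternation k M \<in> forms k"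
proof (rule formsI)
  fix vs :: "'a list" and i assume l: "length vs = k" "i < k"
  have "linear (\<lambda>v. M ((map (\<lambda>l. vs ! \<pi> l) [0..<k])[inv \<pi> i := v]))" if "\<pi> permutes {..<k}" for \<pi>
  proof -
    have "inv \<pi> i < k" using permutes_in_image[OF permutes_inv[OF that]] l by simp
    then show ?thesis using M by (simp add: multilinear_def)
  qed
  then have "linear (\<lambda>v. \<Sum>\<pi> | \<pi> permutes {..<k}. of_int (sign \<pi>) * M (map (\<lambda>l. vs[i := v] ! \<pi> l) [0..<k]))"
    using map_nth_permuted_update[OF _ l] by (intro linear_compose_sum ballI linear_scaled) auto
  then show "linear (\<lambda>v. alternation k M (vs[i := v]))"
    unfolding alternation_def using l by simp
next
  fix vs :: "'a list" and i j
  assume l: "length vs = k" "i < k" "j < k" "i \<noteq> j" "vs ! i = vs ! j"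
  let ?t = "Transposition.transpose i j"
  let ?F = "\<lambda>\<pi>. of_int (sign \<pi>) * M (map (\<lambda>i. vs ! \<pi> i) [0..<k])"
  \<comment> \<open>Composing with the transposition of two equal entries flips the sign of every
    summand and changes nothing else, so the sum equals its negative.\<close>
  have "sum ?F {\<pi>. \<pi> permutes {..<k}} = (\<Sum>\<pi> | \<pi> permutes {..<k}. ?F (?t \<circ> \<pi>))"
    by (rule setum_permutations_compose_left) (use l in \<open>auto intro: permutes_swap_id\<close>)
  also have "\<dots> = (\<Sum>\<pi> | \<pi> permutes {..<k}. - ?F \<pi>)"
  proof (rule sum.cong[OF refl])
    fix \<pi> assume "\<pi> \<in> {\<pi>. \<pi> permutes {..<k}}"
    then have p: "\<pi> permutes {..<k}" by simp
    have "sign (?t \<circ> \<pi>) = - sign \<pi>"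
      using l by (subst sign_compose) (auto simp: sign_swap_id permutation_swap_id intro: permutes_imp_permutation[OF _ p])
    moreover have "vs ! (?t \<circ> \<pi>) m = vs ! \<pi> m" for m
      using l by (auto simp: Transposition.transpose_def)
    ultimately show "?F (?t \<circ> \<pi>) = - ?F \<pi>" by simp
  qed
  also have "\<dots> = - sum ?F {\<pi>. \<pi> permutes {..<k}}" by (rule sum_negf)
  finally show "alternation k M vs = 0" unfolding alternation_def using l by simp
qed (simp add: alternation_def)

lemma wedge_eq_alternation:
  "wedge p q \<alpha> \<beta> = (\<lambda>vs. 1 / (fact p * fact q) * alternation (p + q) (\<lambda>us. \<alpha> (take p us) * \<beta> (drop p us)) vs)"
proof
  fix vs :: "'a list"
  have 1: "take p (map f [0..<p + q]) = map f [0..<p]" for f :: "nat \<Rightarrow> 'a"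
    by (simp add: take_map)
  have 2: "drop p (map f [0..<p + q]) = map f [p..<p + q]" for f :: "nat \<Rightarrow> 'a"
    by (simp add: drop_map)
  show "wedge p q \<alpha> \<beta> vs = 1 / (fact p * fact q) * alternation (p + q) (\<lambda>us. \<alpha> (take p us) * \<beta> (drop p us)) vs"
    unfolding wedge_def alternation_def 1 2 by (simp add: mult.assoc)
qed

lemma multilinear_tensor:
  assumes "multilinear p \<alpha>" "multilinear q \<beta>"
  shows "multilinear (p + q) (\<lambda>us. \<alpha> (take p us) * \<beta> (drop p us))"
  unfolding multilinear_def
proof (intro allI impI, elim conjE)
  fix vs :: "'a list" and i assume l: "length vs = p + q" "i < p + q"
  show "linear (\<lambda>v. \<alpha> (take p (vs[i := v])) * \<beta> (drop p (vs[i := v])))"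
  proof (cases "i < p")
    case True
    then have "linear (\<lambda>v. \<beta> (drop p vs) * \<alpha> ((take p vs)[i := v]))"
      using assms l by (intro linear_scaled) (auto simp: multilinear_def)
    then show ?thesis using True by (simp add: take_update_swap mult.commute)
  next
    case False
    then have "linear (\<lambda>v. \<alpha> (take p vs) * \<beta> ((drop p vs)[i - p := v]))"
      using assms l by (intro linear_scaled) (auto simp: multilinear_def)
    then show ?thesis using False by (simp add: drop_update_swap)
  qed
qed

lemma wedge_in_forms:
  assumes "\<alpha> \<in> forms p" "\<beta> \<in> forms q" shows "wedge p q \<alpha> \<beta> \<in> forms (p + q)"
  unfolding wedge_eq_alternation using assms
  by (intro forms_scale alternation_in_forms multilinear_tensor forms_multilinear)

lemma one_form_in_forms: "one_form a \<in> forms 1"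
proof (rule formsI)
  fix vs :: "'a list" and i :: nat assume "length vs = 1" "i < 1"
  then show "linear (\<lambda>v. one_form a (vs[i := v]))"
    by (cases vs) (auto simp: one_form_def intro: bounded_linear.linear blinfun.bounded_linear_right)
qed (auto simp: one_form_def)

lemma wedge_list_in_forms: "wedge_list as \<in> forms (length as)"
proof (induction as)
  case Nil
  show ?case by (rule formsI) auto
next
  case (Cons a as)
  then show ?case using wedge_in_forms[OF one_form_in_forms Cons] by simp
qed

lemma forms_append_left:
  assumes a: "\<alpha> \<in> forms (p + q)" and l: "length us = p"
  shows "(\<lambda>vs. \<alpha> (us @ vs)) \<in> forms q"
proof (rule formsI)
  fix vs :: "'a list" and i assume "length vs = q" "i < q"
  then have "linear (\<lambda>v. \<alpha> ((us @ vs)[p + i := v]))" using l by (intro forms_linear[OF a]) auto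
  then show "linear (\<lambda>v. \<alpha> (us @ vs[i := v]))" using l by (simp add: list_update_append)
next
  fix vs :: "'a list" and i j
  assume "length vs = q" "i < q" "j < q" "i \<noteq> j" "vs ! i = vs ! j"
  then show "\<alpha> (us @ vs) = 0"
    using l by (intro forms_repeat[OF a, of "p + i" _ "p + j"]) (auto simp: nth_append)
qed (use forms_length[OF a] l in auto)

lemma forms_append_right:
  assumes a: "\<alpha> \<in> forms (p + q)" and l: "length us = q"
  shows "(\<lambda>vs. \<alpha> (vs @ us)) \<in> forms p"
proof (rule formsI)
  fix vs :: "'a list" and i assume "length vs = p" "i < p"
  then have "linear (\<lambda>v. \<alpha> ((vs @ us)[i := v]))" using l by (intro forms_linear[OF a]) auto
  then show "linear (\<lambda>v. \<alpha> (vs[i := v] @ us))"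
    using \<open>length vs = p\<close> \<open>i < p\<close> by (simp add: list_update_append)
next
  fix vs :: "'a list" and i j
  assume "length vs = p" "i < p" "j < p" "i \<noteq> j" "vs ! i = vs ! j"
  then show "\<alpha> (vs @ us) = 0"
    by (intro forms_repeat[OF a, of i _ j]) (auto simp: nth_append)
qed (use forms_length[OF a] l in auto)

text \<open>Reordering multiplies both forms by the same sign, which squares to 1. This makes the
  terms of a contraction of two forms equal.\<close>

lemma forms_permute_mset:
  assumes a: "\<alpha> \<in> forms k" and b: "\<beta> \<in> forms k" and m: "mset us = mset vs"
  shows "\<alpha> us * \<beta> us = \<alpha> vs * \<beta> vs"
proof (cases "length vs = k")
  case True
  obtain \<pi> where p: "\<pi> permutes {..<length vs}" "permute_list \<pi> vs = us"
    using mset_eq_permutation[OF m] by blast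
  have us: "us = map (\<lambda>i. vs ! \<pi> i) [0..<k]" using p True by (simp add: permute_list_def)
  have s: "(of_int (sign \<pi>) :: real) * of_int (sign \<pi>) = 1"
    by (metis of_int_1 of_int_mult sign_idempotent)
  have "\<alpha> us * \<beta> us = (of_int (sign \<pi>) * of_int (sign \<pi>)) * (\<alpha> vs * \<beta> vs)"
    unfolding us using forms_permute[OF a _ True, of \<pi>] forms_permute[OF b _ True, of \<pi>] p True by simp
  then show ?thesis using s by simp
next
  case False
  then have "length us \<noteq> k" using m by (metis size_mset)
  then show ?thesis using False forms_length[OF a] by simp
qed

lemma top_forms_eq:
  assumes a: "\<alpha> \<in> forms n" and b: "\<beta> \<in> forms n" and l: "length bs = n"
    and s: "span (set bs) = UNIV" and e: "\<alpha> bs = \<beta> bs"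
  shows "\<alpha> = \<beta>"
proof
  fix vs
  show "\<alpha> vs = \<beta> vs"
  proof (cases "length vs = n")
    case True
    show ?thesis
    proof (rule multilinear_eq_on_span[OF a[THEN forms_multilinear] b[THEN forms_multilinear] _ True])
      fix L assume L: "length L = n" "set L \<subseteq> set bs"
      show "\<alpha> L = \<beta> L"
      proof (cases "distinct L")
        case True
        \<comment> \<open>A list of \<open>n\<close> different vectors from \<open>bs\<close>
          exhausts \<open>bs\<close> and is a reordering of it; lists with a repetition give 0 on
          both sides.\<close>
        have "card (set L) = n" using True L distinct_card by blast
        moreover have "card (set bs) \<le> n" using card_length l by blast
        ultimately have sl: "set L = set bs" using L by (metis List.finite_set card_seteq)
        then have "distinct bs" using \<open>card (set L) = n\<close> l card_distinct by metis
        then have "mset L = mset bs" using True sl set_eq_iff_mset_eq_distinct by blast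
        then obtain \<pi> where p: "\<pi> permutes {..<length bs}" "permute_list \<pi> bs = L"
          using mset_eq_permutation by blast
        then have "L = map (\<lambda>i. bs ! \<pi> i) [0..<n]" using l by (simp add: permute_list_def)
        then show ?thesis using forms_permute[OF a _ l, of \<pi>] forms_permute[OF b _ l, of \<pi>] p l e by simp
      qed (use a b forms_not_distinct in metis)
    qed (use s in auto)
  qed (use a b forms_length in metis)
qed

section \<open>Top-degree forms in coordinates\<close>

abbreviation ebasis :: "'n::finite list \<Rightarrow> (real ^ 'n) list" where
  "ebasis L \<equiv> map (\<lambda>i. axis i 1) L"

text \<open>A general finite index type comes without an order, so an enumeration is chosen. Another
  choice changes \<open>det_form\<close> at most by a sign.\<close>

definition indices :: "'n::finite list" where
  "indices = (SOME xs. distinct xs \<and> set xs = UNIV)"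

lemma indices: "distinct (indices :: 'n::finite list)" "set (indices :: 'n list) = UNIV"
proof -
  have "\<exists>xs :: 'n list. distinct xs \<and> set xs = UNIV"
    using finite_distinct_list[of "UNIV :: 'n set"] by auto
  from someI_ex[OF this] show "distinct (indices :: 'n list)" "set (indices :: 'n list) = UNIV"
    unfolding indices_def by blast+
qed

lemma length_indices [simp]: "length (indices :: 'n::finite list) = CARD('n)"
  using indices distinct_card by metis

definition index_pos :: "'n::finite \<Rightarrow> nat" where
  "index_pos i = (THE k. k < CARD('n) \<and> indices ! k = i)"

lemma index_pos: "index_pos (i :: 'n::finite) < CARD('n)" "indices ! index_pos i = i"
proof -
  have "\<exists>!k. k < CARD('n) \<and> indices ! k = i"
    using indices(1)[where 'n='n] indices(2)[where 'n='n]
    by (metis UNIV_I distinct_Ex1 length_indices)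
  from theI'[OF this] show "index_pos i < CARD('n)" "indices ! index_pos i = i"
    unfolding index_pos_def by blast+
qed

lemma index_pos_nth: "k < CARD('n) \<Longrightarrow> index_pos (indices ! k :: 'n::finite) = k"
  using index_pos indices(1)[where 'n='n] by (metis length_indices nth_eq_iff_index_eq)

text \<open>On lists of standard basis vectors this is the Levi-Civita symbol; by
  \<open>top_form_eq_det_form\<close> every top-degree form is a multiple of it.\<close>

definition det_form :: "(real ^ 'n::finite) form" where
  "det_form vs = (if length vs = CARD('n) then det (\<chi> i::'n. vs ! index_pos i) else 0)"

lemma det_form_in_forms: "(det_form :: (real ^ 'n::finite) form) \<in> forms CARD('n)"
proof (rule formsI)
  fix vs :: "(real ^ 'n) list" and k assume l: "length vs = CARD('n)" "k < CARD('n)"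
  have e: "(\<chi> i::'n. vs[k := v] ! index_pos i) = (\<chi> i. if i = indices ! k then v else vs ! index_pos i)" for v
  proof -
    have "k = index_pos i \<longleftrightarrow> i = indices ! k" for i :: 'n
      using l index_pos(2)[of i] index_pos_nth[of k, where 'n='n] by metis
    then show ?thesis using l index_pos(1)[where 'n='n] by (auto simp: vec_eq_iff nth_list_update index_pos)
  qed
  show "linear (\<lambda>v. det_form (vs[k := v]))"
  proof (rule linearI)
    fix x y :: "real ^ 'n" and r
    show "det_form (vs[k := x + y]) = det_form (vs[k := x]) + det_form (vs[k := y])"
      unfolding det_form_def using l det_row_add[of "indices ! k" "\<lambda>_. x" "\<lambda>_. y" "\<lambda>i. vs ! index_pos i"]
      by (simp add: e)
    show "det_form (vs[k := r *\<^sub>R x]) = r *\<^sub>R det_form (vs[k := x])"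
      unfolding det_form_def using l det_row_mul[of "indices ! k" r "\<lambda>_. x" "\<lambda>i. vs ! index_pos i"]
      by (simp add: e scalar_mult_eq_scaleR cong: if_cong)
  qed
next
  fix vs :: "(real ^ 'n) list" and k m
  assume l: "length vs = CARD('n)" "k < CARD('n)" "m < CARD('n)" "k \<noteq> m" "vs ! k = vs ! m"
  have "(indices ! k :: 'n) \<noteq> indices ! m" using l indices(1)[where 'n='n] by (simp add: nth_eq_iff_index_eq)
  then have "det (\<chi> i::'n. vs ! index_pos i) = 0"
    by (rule det_identical_rows) (use l in \<open>simp add: row_def index_pos_nth vec_eq_iff\<close>)
  then show "det_form vs = 0" by (simp add: det_form_def)
qed (simp add: det_form_def)

lemma det_form_ebasis_indices [simp]: "det_form (ebasis (indices :: 'n::finite list)) = 1"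
proof -
  have "(\<chi> i::'n. ebasis indices ! index_pos i) = mat 1"
    by (simp add: index_pos vec_eq_iff mat_def axis_def)
  then show ?thesis by (simp add: det_form_def)
qed

lemma span_ebasis_indices: "span (set (ebasis (indices :: 'n::finite list))) = UNIV"
proof -
  have "set (ebasis (indices :: 'n::finite list)) = Basis"
    using indices(2)[where 'n='n] by (auto simp: Basis_vec_def)
  then show ?thesis by (metis span_Basis)
qed

lemma top_form_eq_det_form:
  fixes \<alpha> :: "(real ^ 'n::finite) form"
  assumes "\<alpha> \<in> forms CARD('n)" shows "\<alpha> vs = \<alpha> (ebasis indices) * det_form vs"
proof -
  have "\<alpha> = (\<lambda>vs. \<alpha> (ebasis indices) * det_form vs)"
    by (rule top_forms_eq[OF assms forms_scale[OF det_form_in_forms] _ span_ebasis_indices]) auto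
  then show ?thesis by metis
qed

section \<open>Sums over index lists and contractions of the Levi-Civita symbol\<close>

lemma finite_index_lists [simp]: "finite {I :: 'n::finite list. length I = k}"
  using finite_lists_length_eq[of "UNIV :: 'n set" k] by simp

lemma sum_lists_append:
  fixes h :: "'n::finite list \<Rightarrow> 'b::comm_monoid_add"
  shows "(\<Sum>L | length L = p + q. h L) = (\<Sum>I | length I = p. \<Sum>K | length K = q. h (I @ K))"
proof -
  have "(\<Sum>I | length I = p. \<Sum>K | length K = q. h (I @ K))
      = (\<Sum>(I, K)\<in>{I. length I = p} \<times> {K. length K = q}. h (I @ K))"
    by (simp add: sum.cartesian_product)
  also have "\<dots> = (\<Sum>L | length L = p + q. h L)"
    by (rule sum.reindex_bij_witness[where i = "\<lambda>L. (take p L, drop p L)" and j = "\<lambda>(I, K). I @ K"])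
      auto
  finally show ?thesis by simp
qed

lemma sum_lists_Suc:
  fixes h :: "'n::finite list \<Rightarrow> 'b::comm_monoid_add"
  shows "(\<Sum>L | length L = Suc k. h L) = (\<Sum>i\<in>UNIV. \<Sum>K | length K = k. h (i # K))"
proof -
  have "(\<Sum>i\<in>UNIV. \<Sum>K | length K = k. h (i # K)) = (\<Sum>(i, K)\<in>UNIV \<times> {K. length K = k}. h (i # K))"
    by (simp add: sum.cartesian_product)
  also have "\<dots> = (\<Sum>L | length L = Suc k. h L)"
    by (rule sum.reindex_bij_witness[where i = "\<lambda>L. (hd L, tl L)" and j = "\<lambda>(i, K). i # K"])
      (auto simp: length_Suc_conv)
  finally show ?thesis by simp
qed

lemma sum_lists_0: "(\<Sum>L | length L = 0. h L) = h []"
  by simp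

lemma full_length_distinct:
  "length L = CARD('n) \<Longrightarrow> distinct L \<longleftrightarrow> set (L :: 'n::finite list) = UNIV"
  using card_subset_eq[of "UNIV :: 'n set" "set L"] distinct_card[of L] card_distinct[of L] by auto

lemma det_form_permuted:
  fixes \<pi> :: "nat \<Rightarrow> nat"
  assumes "\<pi> permutes {..<CARD('n::finite)}"
  shows "det_form (ebasis (map (\<lambda>i. indices ! \<pi> i :: 'n) [0..<CARD('n)])) = of_int (sign \<pi>)"
proof -
  have "map (\<lambda>i. ebasis indices ! \<pi> i :: real ^ 'n) [0..<CARD('n)] = ebasis (map (\<lambda>i. indices ! \<pi> i :: 'n) [0..<CARD('n)])"
    using permutes_in_image[OF assms] by auto
  then show ?thesis
    using forms_permute[OF det_form_in_forms[where 'n='n] assms, of "ebasis indices"]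
    by (simp del: map_map)
qed

lemma permutes_bij_betw_lists:
  "bij_betw (\<lambda>\<pi>. map (\<lambda>i. indices ! \<pi> i :: 'n) [0..<CARD('n)]) {\<pi>. \<pi> permutes {..<CARD('n::finite)}}
     {L. length L = CARD('n) \<and> distinct L}"
proof -
  let ?f = "\<lambda>\<pi>. map (\<lambda>i. indices ! \<pi> i :: 'n) [0..<CARD('n)]"
  let ?P = "{\<pi>. \<pi> permutes {..<CARD('n)}}" and ?L = "{L :: 'n list. length L = CARD('n) \<and> distinct L}"
  have d: "distinct (indices :: 'n list)" by (rule indices)
  have inj: "inj_on ?f ?P"
  proof (rule inj_onI)
    fix p q assume pq: "p \<in> ?P" "q \<in> ?P" "?f p = ?f q"
    show "p = q"
    proof
      fix i
      show "p i = q i"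
      proof (cases "i < CARD('n)")
        case True
        then have "indices ! p i = (indices ! q i :: 'n)" using pq(3) by simp
        moreover have "p i < CARD('n)" "q i < CARD('n)" using pq True permutes_in_image[of _ "{..<CARD('n)}" i] by auto
        ultimately show ?thesis using d by (simp add: nth_eq_iff_index_eq)
      next
        case False
        then show ?thesis using pq by (simp add: permutes_def)
      qed
    qed
  qed
  have sub: "?f ` ?P \<subseteq> ?L"
  proof
    fix L assume "L \<in> ?f ` ?P"
    then obtain \<pi> where p: "\<pi> permutes {..<CARD('n)}" "L = ?f \<pi>" by blast
    then show "L \<in> ?L"
      using permutes_in_image[OF p(1)] d permutes_inj[OF p(1)]
      by (auto simp: distinct_map inj_on_def nth_eq_iff_index_eq)
  qed
  have "?L = permutations_of_set UNIV"
    by (auto simp: permutations_of_set_def full_length_distinct) (metis full_length_distinct distinct_card)+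
  \<comment> \<open>Surjectivity follows by counting: both sets have \<open>CARD('n)\<close>
    factorial elements.\<close>
  then have "card ?L = card ?P" by (simp add: card_permutations)
  moreover have "finite ?L" by (rule finite_subset[OF _ finite_index_lists[of "CARD('n)"]]) auto
  ultimately have "?f ` ?P = ?L" using sub card_image[OF inj] by (intro card_subset_eq) simp_all
  then show ?thesis using inj by (simp add: bij_betw_def)
qed

text \<open>The sum over permutations becomes a sum over all index lists, where the symbol removes
  the lists with repetitions. Such sums can be split into blocks and contracted slot by
  slot.\<close>

lemma alternation_ebasis:
  fixes M :: "(real ^ 'n::finite) form"
  shows "alternation CARD('n) M (ebasis indices)
    = (\<Sum>L | length L = CARD('n). det_form (ebasis L) * M (ebasis L))"
proof -
  let ?f = "\<lambda>\<pi>. map (\<lambda>i. indices ! \<pi> i :: 'n) [0..<CARD('n)]"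
  have m: "map (\<lambda>i. ebasis indices ! \<pi> i :: real ^ 'n) [0..<CARD('n)] = ebasis (?f \<pi>)"
    if "\<pi> permutes {..<CARD('n)}" for \<pi>
    using permutes_in_image[OF that] by auto
  have "alternation CARD('n) M (ebasis indices)
      = (\<Sum>\<pi> | \<pi> permutes {..<CARD('n)}. det_form (ebasis (?f \<pi>)) * M (ebasis (?f \<pi>)))"
    unfolding alternation_def
    by (simp only: length_map length_indices if_True simp_thms, intro sum.cong refl)
      (simp only: mem_Collect_eq m det_form_permuted[where 'n='n])
  also have "\<dots> = (\<Sum>L | length L = CARD('n) \<and> distinct L. det_form (ebasis L) * M (ebasis L))"
    by (rule sum.reindex_bij_betw[OF permutes_bij_betw_lists, of "\<lambda>L. det_form (ebasis L) * M (ebasis L)"])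
  also have "\<dots> = (\<Sum>L | length L = CARD('n). det_form (ebasis L) * M (ebasis L))"
  proof (rule sum.mono_neutral_left)
    show "\<forall>L\<in>{L :: 'n list. length L = CARD('n)} - {L. length L = CARD('n) \<and> distinct L}.
        det_form (ebasis L) * M (ebasis L) = 0"
      using forms_not_distinct[OF det_form_in_forms[where 'n='n]] by (auto simp: distinct_map)
  qed auto
  finally show ?thesis .
qed

lemma wedge_ebasis:
  fixes \<alpha> \<beta> :: "(real ^ 'n::finite) form"
  assumes "p + q = CARD('n)"
  shows "wedge p q \<alpha> \<beta> (ebasis indices) =
    (\<Sum>I | length I = p. \<Sum>K | length K = q. det_form (ebasis (I @ K)) * (\<alpha> (ebasis I) * \<beta> (ebasis K)))
      / (fact p * fact q)"
proof -
  have "alternation CARD('n) (\<lambda>us. \<alpha> (take p us) * \<beta> (drop p us)) (ebasis indices) =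
    (\<Sum>I | length I = p. \<Sum>K | length K = q. det_form (ebasis (I @ K)) * (\<alpha> (ebasis I) * \<beta> (ebasis K)))"
    unfolding alternation_ebasis unfolding assms[symmetric] sum_lists_append
    by (intro sum.cong refl) (simp del: map_append add: take_map drop_map)
  then show ?thesis unfolding wedge_eq_alternation assms by simp
qed

lemma det_form_sq:
  assumes "length L = CARD('n)" "distinct L"
  shows "det_form (ebasis L) * det_form (ebasis (L :: 'n::finite list)) = 1"
proof -
  have "mset (ebasis L) = mset (ebasis indices)"
    using indices[where 'n='n] assms full_length_distinct[OF assms(1)]
    by (metis mset_map set_eq_iff_mset_eq_distinct)
  from forms_permute_mset[OF det_form_in_forms det_form_in_forms this] show ?thesis by simp
qed

text \<open>The double contraction of the Levi-Civita symbol with a form: the summand is symmetric under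
  reordering \<open>I\<close>, so every nonzero term equals the one with \<open>I = W\<close>.\<close>

lemma det_form_contraction:
  fixes \<alpha> :: "(real ^ 'n::finite) form"
  assumes a: "\<alpha> \<in> forms p" and pq: "p + q = CARD('n)" and W: "length W = p"
  shows "(\<Sum>I | length I = p. \<Sum>K | length K = q.
      det_form (ebasis (I @ K)) * det_form (ebasis (W @ K)) * \<alpha> (ebasis I)) = fact p * fact q * \<alpha> (ebasis W)"
proof (cases "distinct W")
  case False
  then have "\<not> distinct (ebasis (W @ K))" "\<not> distinct (ebasis W)" for K :: "'n list"
    by (auto simp: distinct_map)
  then show ?thesis
    using forms_not_distinct[OF det_form_in_forms[where 'n='n]] forms_not_distinct[OF a]
    by (simp del: map_append)
next
  case True
  let ?D = "\<lambda>L. det_form (ebasis (L :: 'n list))"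
  have Dz: "?D L = 0" if "\<not> distinct L" for L
    using forms_not_distinct[OF det_form_in_forms[where 'n='n]] that by (simp add: distinct_map)
  let ?PK = "permutations_of_set (UNIV - set W)" and ?PI = "permutations_of_set (set W)"
  have cW: "card (set W) = p" using True W distinct_card by blast
  then have cK: "card (UNIV - set W) = q" using pq by (simp add: card_Diff_subset)
  have PK: "K \<in> ?PK" if "length K = q" "distinct (W @ K)" for K
  proof -
    have "length (W @ K) = CARD('n)" using that W pq by simp
    then have "set (W @ K) = UNIV" using that(2) full_length_distinct by blast
    then show ?thesis using that by (auto simp: permutations_of_set_def)
  qed
  have PI: "I \<in> ?PI" if "length I = p" "distinct (I @ K)" "K \<in> ?PK" for I K
  proof -
    have "length (I @ K) = CARD('n)" using that pq cK by (simp add: length_finite_permutations_of_set)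
    then have "set (I @ K) = UNIV" using that(2) full_length_distinct by blast
    then show ?thesis using that by (auto simp: permutations_of_set_def)
  qed
  have term1: "?D (I @ K) * ?D (W @ K) * \<alpha> (ebasis I) = \<alpha> (ebasis W)" if "I \<in> ?PI" "K \<in> ?PK" for I K
  proof -
    have lK: "length K = q" using that cK by (simp add: length_finite_permutations_of_set)
    have "mset I = mset W" using that True by (auto simp: permutations_of_set_def set_eq_iff_mset_eq_distinct)
    then have m: "mset (ebasis I) = mset (ebasis W)" by (metis mset_map)
    have f: "(\<lambda>vs. det_form (vs @ ebasis K)) \<in> forms p"
      by (rule forms_append_right[where q = q]) (use det_form_in_forms[where 'n='n] pq lK in auto)
    have "distinct (W @ K)" using that True by (auto simp: permutations_of_set_def)
    then have "?D (W @ K) * ?D (W @ K) = 1" using W lK pq by (intro det_form_sq) auto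
    moreover have "?D (I @ K) * \<alpha> (ebasis I) = ?D (W @ K) * \<alpha> (ebasis W)"
      using forms_permute_mset[OF f a m] by simp
    moreover have "?D (I @ K) * ?D (W @ K) * \<alpha> (ebasis I) = ?D (W @ K) * (?D (I @ K) * \<alpha> (ebasis I))"
      by (simp only: mult_ac)
    ultimately show ?thesis by (simp only: mult.assoc[symmetric] mult_1_left)
  qed
  have "(\<Sum>I | length I = p. \<Sum>K | length K = q. ?D (I @ K) * ?D (W @ K) * \<alpha> (ebasis I))
      = (\<Sum>K | length K = q. \<Sum>I | length I = p. ?D (I @ K) * ?D (W @ K) * \<alpha> (ebasis I))"
    by (rule sum.swap)
  also have "\<dots> = (\<Sum>K\<in>?PK. \<Sum>I | length I = p. ?D (I @ K) * ?D (W @ K) * \<alpha> (ebasis I))"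
  proof (rule sum.mono_neutral_right)
    show "?PK \<subseteq> {K. length K = q}" using cK by (auto simp: length_finite_permutations_of_set)
    show "\<forall>K\<in>{K. length K = q} - ?PK. (\<Sum>I | length I = p. ?D (I @ K) * ?D (W @ K) * \<alpha> (ebasis I)) = 0"
    proof
      fix K assume "K \<in> {K. length K = q} - ?PK"
      then have "\<not> distinct (W @ K)" using PK by blast
      then show "(\<Sum>I | length I = p. ?D (I @ K) * ?D (W @ K) * \<alpha> (ebasis I)) = 0"
        using Dz[of "W @ K"] by (simp del: map_append)
    qed
  qed simp
  also have "\<dots> = (\<Sum>K\<in>?PK. \<Sum>I\<in>?PI. ?D (I @ K) * ?D (W @ K) * \<alpha> (ebasis I))"
  proof (rule sum.cong[OF refl], rule sum.mono_neutral_right)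
    fix K assume K: "K \<in> ?PK"
    show "?PI \<subseteq> {I. length I = p}" using cW by (auto simp: length_finite_permutations_of_set)
    show "\<forall>I\<in>{I. length I = p} - ?PI. ?D (I @ K) * ?D (W @ K) * \<alpha> (ebasis I) = 0"
    proof
      fix I assume "I \<in> {I. length I = p} - ?PI"
      then have "\<not> distinct (I @ K)" using PI K by blast
      then show "?D (I @ K) * ?D (W @ K) * \<alpha> (ebasis I) = 0"
        using Dz[of "I @ K"] by (simp del: map_append)
    qed
  qed simp
  also have "\<dots> = (\<Sum>K\<in>?PK. \<Sum>I\<in>?PI. \<alpha> (ebasis W))" using term1 by (intro sum.cong refl) blast
  also have "\<dots> = fact p * fact q * \<alpha> (ebasis W)" using cW cK by simp
  finally show ?thesis .
qed

text \<open>The sign of the exchange of the two blocks stays abstract: it enters only through its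
  square.\<close>

lemma det_form_commute:
  assumes pq: "p + q = CARD('n::finite)"
  obtains s :: real where "s * s = 1"
    "\<And>us vs :: (real ^ 'n) list. length us = p \<Longrightarrow> length vs = q \<Longrightarrow> det_form (vs @ us) = s * det_form (us @ vs)"
proof -
  have "mset ([p..<p + q] @ [0..<p]) = mset [0..<p + q]"
    by (metis add.commute mset_append upt_add_eq_append zero_le)
  then obtain \<pi> where p: "\<pi> permutes {..<p + q}" "permute_list \<pi> [0..<p + q] = [p..<p + q] @ [0..<p]"
    using mset_eq_permutation by (metis diff_zero length_upt)
  show ?thesis
  proof (rule that[of "of_int (sign \<pi>)"])
    show "of_int (sign \<pi>) * of_int (sign \<pi>) = (1::real)"
      by (metis of_int_1 of_int_mult sign_idempotent)
    fix us vs :: "(real ^ 'n) list" assume l: "length us = p" "length vs = q"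
    have "vs @ us = map ((!) (us @ vs)) ([p..<p + q] @ [0..<p])"
      using l by (intro nth_equalityI) (auto simp: nth_append)
    also have "\<dots> = permute_list \<pi> (map ((!) (us @ vs)) [0..<p + q])"
      using p by (simp add: permute_list_map)
    also have "map ((!) (us @ vs)) [0..<p + q] = us @ vs" using l map_nth[of "us @ vs"] by simp
    finally have "vs @ us = map (\<lambda>i. (us @ vs) ! \<pi> i) [0..<CARD('n)]" using l pq by (simp add: permute_list_def)
    then show "det_form (vs @ us) = of_int (sign \<pi>) * det_form (us @ vs)"
      using forms_permute[OF det_form_in_forms[where 'n='n], of \<pi> "us @ vs"] p l pq by simp
  qed
qed

text \<open>Exchanging the blocks in both symbols reduces this to
  \<open>det_form_contraction\<close>. It recovers a form from its wedge products and thus yields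
  the uniqueness of the Hodge star.\<close>

lemma det_form_contraction_left:
  fixes \<gamma> :: "(real ^ 'n::finite) form"
  assumes g: "\<gamma> \<in> forms q" and pq: "p + q = CARD('n)" and W: "length W = q"
  shows "(\<Sum>I | length I = p. \<Sum>K | length K = q.
      det_form (ebasis (I @ K)) * (det_form (ebasis (I @ W)) * \<gamma> (ebasis K))) = fact p * fact q * \<gamma> (ebasis W)"
proof -
  obtain s :: real where s: "s * s = 1"
    "\<And>us vs :: (real ^ 'n) list. length us = q \<Longrightarrow> length vs = p \<Longrightarrow> det_form (vs @ us) = s * det_form (us @ vs)"
    using det_form_commute[of q p, where 'n='n] pq by (metis add.commute)
  have "(\<Sum>I | length I = p. \<Sum>K | length K = q.
      det_form (ebasis (I @ K)) * (det_form (ebasis (I @ W)) * \<gamma> (ebasis K)))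
    = (\<Sum>I | length I = p. \<Sum>K | length K = q.
      (s * s) * (det_form (ebasis (K @ I)) * det_form (ebasis (W @ I)) * \<gamma> (ebasis K)))"
    using s(2) W by (intro sum.cong refl) simp
  also have "\<dots> = (\<Sum>K | length K = q. \<Sum>I | length I = p.
      (det_form (ebasis (K @ I)) * det_form (ebasis (W @ I)) * \<gamma> (ebasis K)))"
    unfolding s(1) mult_1 by (rule sum.swap)
  also have "\<dots> = fact q * fact p * \<gamma> (ebasis W)"
    by (rule det_form_contraction[OF g _ W]) (use pq in simp)
  finally show ?thesis by (simp add: mult.commute)
qed

section \<open>The Hodge star as an explicit contraction\<close>

lemma forms_eq_on_ebasis:
  fixes \<alpha> \<beta> :: "(real ^ 'n::finite) form"
  assumes a: "\<alpha> \<in> forms k" and b: "\<beta> \<in> forms k"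
    and e: "\<And>K. length K = k \<Longrightarrow> \<alpha> (ebasis K) = \<beta> (ebasis K)"
  shows "\<alpha> = \<beta>"
proof
  fix vs
  show "\<alpha> vs = \<beta> vs"
  proof (cases "length vs = k")
    case True
    show ?thesis
    proof (rule multilinear_eq_on_span[OF a[THEN forms_multilinear] b[THEN forms_multilinear] _ True])
      fix L assume L: "length L = k" "set L \<subseteq> set (ebasis (indices :: 'n list))"
      then have "set L \<subseteq> range (\<lambda>i. axis i 1)" by auto
      then obtain K where "L = ebasis K" by (metis ex_map_conv image_iff subset_iff)
      then show "\<alpha> L = \<beta> L" using e L by simp
    qed (use span_ebasis_indices in auto)
  qed (use a b forms_length in metis)
qed

text \<open>The star contracts the volume form with \<open>\<beta>\<close>. Wedging with
  \<open>\<alpha>\<close> produces two Levi-Civita symbols, whose contraction returns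
  \<open>\<alpha>\<close> with the factor k! (7-k)! that the wedge product divides out.\<close>

lemma hodge_star_eq:
  fixes \<beta> :: "(real ^ 7) form"
  assumes k: "k \<le> 7" and vol: "vol \<in> forms 7"
  shows "hodge_star k g vol \<beta> = (\<lambda>us. form_inner k g (\<lambda>ws. vol (ws @ us)) \<beta>)"
    and "hodge_star k g vol \<beta> \<in> forms (7 - k)"
proof -
  have pq: "k + (7 - k) = CARD(7)" using k by simp
  define \<gamma> where "\<gamma> = (\<lambda>us. form_inner k g (\<lambda>ws. vol (ws @ us)) \<beta>)"
  have vf: "(\<lambda>us. vol (ebasis I @ us)) \<in> forms (7 - k)" if "length I = k" for I
    by (rule forms_append_left) (use vol k that in auto)
  have gf: "\<gamma> \<in> forms (7 - k)"
  proof -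
    have "\<gamma> = (\<lambda>us. \<Sum>I | length I = k. \<Sum>J | length J = k.
        ((\<Prod>l<k. cogram g $ (I ! l) $ (J ! l)) * \<beta> (ebasis J) / fact k) * vol (ebasis I @ us))"
      by (simp add: \<gamma>_def form_inner_def sum_divide_distrib mult_ac)
    also have "\<dots> \<in> forms (7 - k)" using vf by (intro forms_sum forms_scale) auto
    finally show ?thesis .
  qed
  have vD: "vol vs = vol (ebasis indices) * det_form vs" for vs
    by (rule top_form_eq_det_form) (use vol in simp)
  have gw: "wedge k (7 - k) \<alpha> \<gamma> = (\<lambda>vs. form_inner k g \<alpha> \<beta> * vol vs)" if a: "\<alpha> \<in> forms k" for \<alpha>
  proof (rule top_forms_eq[of _ 7, where bs = "ebasis indices"])
    show "wedge k (7 - k) \<alpha> \<gamma> \<in> forms 7" using wedge_in_forms[OF a gf] k by simp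
    define c where "c I J = (\<Prod>l<k. cogram g $ (I ! l) $ (J ! l)) * \<beta> (ebasis J) / fact k" for I J
    have fi: "form_inner k g \<xi> \<beta> = (\<Sum>I | length I = k. \<Sum>J | length J = k. c I J * \<xi> (ebasis I))" for \<xi>
      by (simp add: form_inner_def c_def sum_divide_distrib mult_ac)
    let ?D = "\<lambda>L. det_form (ebasis (L :: 7 list))"
    let ?V = "vol (ebasis indices)"
    have "(\<Sum>W | length W = k. \<Sum>K | length K = 7 - k. ?D (W @ K) * (\<alpha> (ebasis W) * \<gamma> (ebasis K)))
      = (\<Sum>W | length W = k. \<Sum>K | length K = 7 - k. \<Sum>I | length I = k. \<Sum>J | length J = k.
          c I J * ?V * (?D (W @ K) * ?D (I @ K) * \<alpha> (ebasis W)))"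
      unfolding \<gamma>_def fi sum_distrib_left by (intro sum.cong refl, subst vD) (simp add: mult_ac)
    also have "\<dots> = (\<Sum>W | length W = k. \<Sum>I | length I = k. \<Sum>K | length K = 7 - k. \<Sum>J | length J = k.
          c I J * ?V * (?D (W @ K) * ?D (I @ K) * \<alpha> (ebasis W)))"
      by (intro sum.cong refl sum.swap)
    also have "\<dots> = (\<Sum>I | length I = k. \<Sum>W | length W = k. \<Sum>K | length K = 7 - k. \<Sum>J | length J = k.
          c I J * ?V * (?D (W @ K) * ?D (I @ K) * \<alpha> (ebasis W)))"
      by (rule sum.swap)
    also have "\<dots> = (\<Sum>I | length I = k. (\<Sum>J | length J = k. c I J * ?V) *
        (\<Sum>W | length W = k. \<Sum>K | length K = 7 - k. ?D (W @ K) * ?D (I @ K) * \<alpha> (ebasis W)))"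
      by (simp only: sum_distrib_left sum_distrib_right)
    also have "\<dots> = (\<Sum>I | length I = k. (\<Sum>J | length J = k. c I J * ?V) *
        (fact k * fact (7 - k) * \<alpha> (ebasis I)))"
      using det_form_contraction[OF a pq] by (intro sum.cong refl) simp
    also have "\<dots> = fact k * fact (7 - k) * (form_inner k g \<alpha> \<beta> * ?V)"
      by (simp add: fi sum_distrib_left sum_distrib_right mult_ac)
    finally show "wedge k (7 - k) \<alpha> \<gamma> (ebasis indices) = form_inner k g \<alpha> \<beta> * vol (ebasis indices)"
      by (simp add: wedge_ebasis[OF pq])
    show "(\<lambda>vs. form_inner k g \<alpha> \<beta> * vol vs) \<in> forms 7" by (rule forms_scale[OF vol])
  qed (auto simp: span_ebasis_indices simp del: set_map)
  have "hodge_star k g vol \<beta> = \<gamma>"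
    unfolding hodge_star_def
  proof (rule the_equality)
    show "\<gamma> \<in> forms (7 - k) \<and> (\<forall>\<alpha>\<in>forms k. wedge k (7 - k) \<alpha> \<gamma> = (\<lambda>vs. form_inner k g \<alpha> \<beta> * vol vs))"
      using gf gw by blast
    fix \<gamma>' assume g': "\<gamma>' \<in> forms (7 - k) \<and> (\<forall>\<alpha>\<in>forms k. wedge k (7 - k) \<alpha> \<gamma>' = (\<lambda>vs. form_inner k g \<alpha> \<beta> * vol vs))"
    show "\<gamma>' = \<gamma>"
    proof (rule forms_eq_on_ebasis)
      fix K :: "7 list" assume K: "length K = 7 - k"
      \<comment> \<open>The wedge product with this test form isolates the component of
        \<open>\<gamma>\<close> at \<open>K\<close>.\<close>
      have a: "(\<lambda>ws. det_form (ws @ ebasis K)) \<in> forms k"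
        by (rule forms_append_right[where q = "7 - k"]) (use K k det_form_in_forms[where 'n=7] in auto)
      have "wedge k (7 - k) (\<lambda>ws. det_form (ws @ ebasis K)) \<gamma>' (ebasis indices)
          = wedge k (7 - k) (\<lambda>ws. det_form (ws @ ebasis K)) \<gamma> (ebasis indices)"
        using g' gw a by metis
      then show "\<gamma>' (ebasis K) = \<gamma> (ebasis K)"
        using det_form_contraction_left[OF _ pq K, of \<gamma>'] det_form_contraction_left[OF gf pq K] g'
        by (simp add: wedge_ebasis[OF pq])
    qed (use g' gf in auto)
  qed
  then show "hodge_star k g vol \<beta> = (\<lambda>us. form_inner k g (\<lambda>ws. vol (ws @ us)) \<beta>)"
    "hodge_star k g vol \<beta> \<in> forms (7 - k)"
    using gf by (auto simp: \<gamma>_def)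
qed

section \<open>Adapted frames\<close>

text \<open>The version for permutations that fix an initial segment, as they remain when a wedge
  product is expanded along its first factor.\<close>

lemma forms_permute_interval:
  assumes a: "\<alpha> \<in> forms k" and p: "\<pi> permutes {m..<m + k}"
  shows "\<alpha> (map (\<lambda>i. x (\<pi> i)) [m..<m + k]) = of_int (sign \<pi>) * \<alpha> (map x [m..<m + k])"
  using p finite_atLeastLessThan[of m "m + k"]
proof (induction \<pi> arbitrary: x rule: permutes_induct)
  case id
  then show ?case by (simp add: sign_id)
next
  case (swap i j p)
  let ?t = "Transposition.transpose i j" and ?X = "map x [m..<m + k]"
  have "map (\<lambda>i. (x \<circ> ?t) i) [m..<m + k] = ?X[i - m := ?X ! (j - m), j - m := ?X ! (i - m)]"
    using swap by (intro nth_equalityI) (auto simp: nth_list_update Transposition.transpose_def)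
  then have "\<alpha> (map (\<lambda>i. (x \<circ> ?t) i) [m..<m + k]) = - \<alpha> ?X"
    using swap by (simp only:) (rule forms_swap[OF a], auto)
  moreover have "sign (?t \<circ> p) = - sign p"
    using swap by (subst sign_compose)
      (auto simp: sign_swap_id permutation_swap_id intro: permutes_imp_permutation[OF _ \<open>p permutes _\<close>])
  ultimately show ?case using swap.IH[of "x \<circ> ?t"] by (simp add: o_def)
qed

text \<open>Since \<open>a\<close> vanishes on the later vectors, only permutations fixing 0
  survive. Their q! terms are equal and cancel the factorial in \<open>wedge\<close>.\<close>

lemma wedge_one_form_dual:
  assumes b: "\<beta> \<in> forms q" and l: "length vs = Suc q"
    and d: "blinfun_apply a (vs ! 0) = 1" "\<And>i. 0 < i \<Longrightarrow> i < Suc q \<Longrightarrow> blinfun_apply a (vs ! i) = 0"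
  shows "wedge 1 q (one_form a) \<beta> vs = \<beta> (tl vs)"
proof -
  let ?G = "\<lambda>\<pi>. of_int (sign \<pi>) * one_form a (map (\<lambda>i. vs ! \<pi> i) [0..<1]) * \<beta> (map (\<lambda>i. vs ! \<pi> i) [1..<1 + q])"
  have "(\<Sum>\<pi> | \<pi> permutes {..<1 + q}. ?G \<pi>) = (\<Sum>\<pi> | \<pi> permutes {1..<1 + q}. ?G \<pi>)"
  proof (rule sum.mono_neutral_right)
    show "{\<pi>. \<pi> permutes {1..<1 + q}} \<subseteq> {\<pi>. \<pi> permutes {..<1 + q}}"
      by (auto intro: permutes_subset)
    show "\<forall>\<pi>\<in>{\<pi>. \<pi> permutes {..<1 + q}} - {\<pi>. \<pi> permutes {1..<1 + q}}. ?G \<pi> = 0"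
    proof
      fix \<pi> assume p: "\<pi> \<in> {\<pi>. \<pi> permutes {..<1 + q}} - {\<pi>. \<pi> permutes {1..<1 + q}}"
      then have p1: "\<pi> permutes {..<1 + q}" by simp
      have "\<pi> 0 \<noteq> 0"
      proof
        assume "\<pi> 0 = 0"
        then have "\<pi> permutes ({..<1 + q} - {0})"
          using p1 by (auto intro: permutes_superset)
        moreover have "{..<1 + q} - {0} = {1..<1 + q}" by auto
        ultimately show False using p by simp
      qed
      moreover have "\<pi> 0 < Suc q" using permutes_in_image[OF p1, of 0] by simp
      ultimately show "?G \<pi> = 0" using d(2)[of "\<pi> 0"] by (simp add: one_form_def)
    qed
  qed (simp add: finite_permutations)
  also have "\<dots> = (\<Sum>\<pi> | \<pi> permutes {1..<1 + q}. \<beta> (tl vs))"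
  proof (rule sum.cong[OF refl])
    fix \<pi> assume "\<pi> \<in> {\<pi>. \<pi> permutes {1..<1 + q}}"
    then have p: "\<pi> permutes {1..<1 + q}" by simp
    have "\<pi> 0 = 0" using p by (simp add: permutes_def)
    moreover have "map (\<lambda>i. vs ! i) [1..<1 + q] = tl vs"
      using l by (intro nth_equalityI) (auto simp: nth_tl simp del: upt_Suc)
    moreover have "(of_int (sign \<pi>) :: real) * of_int (sign \<pi>) = 1"
      by (metis of_int_1 of_int_mult sign_idempotent)
    ultimately show "?G \<pi> = \<beta> (tl vs)"
      using forms_permute_interval[OF b p, of "(!) vs"] d(1)
      by (simp add: one_form_def mult.assoc[symmetric])
  qed
  also have "\<dots> = fact q * \<beta> (tl vs)" by (simp add: card_permutations)
  finally show ?thesis using l by (simp add: wedge_def)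
qed

lemma wedge_list_dual:
  assumes "length as = length vs"
    and "\<And>i j. i < length vs \<Longrightarrow> j < length vs \<Longrightarrow> blinfun_apply (as ! i) (vs ! j) = (if i = j then 1 else 0)"
  shows "wedge_list as vs = 1"
  using assms
proof (induction as arbitrary: vs)
  case (Cons a as)
  obtain u us where vs: "vs = u # us" using Cons.prems by (cases vs) auto
  have "wedge 1 (length as) (one_form a) (wedge_list as) vs = wedge_list as (tl vs)"
  proof (rule wedge_one_form_dual[OF wedge_list_in_forms])
    show "blinfun_apply a (vs ! 0) = 1" using Cons.prems(2)[of 0 0] vs by simp
    show "blinfun_apply a (vs ! i) = 0" if "0 < i" "i < Suc (length as)" for i
      using Cons.prems(2)[of 0 i] Cons.prems(1) that vs by simp
  qed (use Cons.prems in simp)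
  also have "wedge_list as us = 1"
  proof (rule Cons.IH)
    show "blinfun_apply (as ! i) (us ! j) = (if i = j then 1 else 0)" if "i < length us" "j < length us" for i j
      using Cons.prems(2)[of "Suc i" "Suc j"] that vs by simp
  qed (use Cons.prems vs in simp)
  then have "wedge_list as (tl vs) = 1" using vs by simp
  finally show ?case by simp
qed simp

lemma wedge_list_1: "wedge_list [a] [x] = blinfun_apply a x"
  by (simp add: wedge_def one_form_def lessThan_Suc permutes_sing sign_id)

lemma wedge_list_2:
  "wedge_list [a, b] [x, y] = blinfun_apply a x * blinfun_apply b y - blinfun_apply a y * blinfun_apply b x"
proof -
  have s: "{..<Suc 0 + Suc 0} = {0, Suc 0}" by auto
  have f: "finite {Suc 0}" "0 \<notin> {Suc 0}" by auto
  have "wedge_list [a, b] [x, y] = wedge (Suc 0) (Suc 0) (one_form a) (wedge_list [b]) [x, y]" by simp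
  also have "\<dots> = blinfun_apply a x * blinfun_apply b y - blinfun_apply a y * blinfun_apply b x"
    unfolding wedge_def s
    by (simp add: one_form_def sum_over_permutations_insert[OF f] permutes_sing
        sign_swap_id permutation_swap_id sign_compose sign_id wedge_list_1 del: wedge_list.simps)
  finally show ?thesis .
qed

lemma wedge_list_3:
  "wedge_list [a, b, c] [x, y, z] =
     blinfun_apply a x * (blinfun_apply b y * blinfun_apply c z - blinfun_apply b z * blinfun_apply c y)
   - blinfun_apply a y * (blinfun_apply b x * blinfun_apply c z - blinfun_apply b z * blinfun_apply c x)
   + blinfun_apply a z * (blinfun_apply b x * blinfun_apply c y - blinfun_apply b y * blinfun_apply c x)"
proof -
  have s: "{..<Suc 0 + Suc (Suc 0)} = {0, Suc 0, Suc (Suc 0)}" by auto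
  have f1: "finite {Suc 0, Suc (Suc 0)}" "0 \<notin> {Suc 0, Suc (Suc 0)}"
    and f2: "finite {Suc (Suc 0)}" "Suc 0 \<notin> {Suc (Suc 0)}" by auto
  have "wedge_list [a, b, c] [x, y, z]
      = wedge (Suc 0) (Suc (Suc 0)) (one_form a) (wedge_list [b, c]) [x, y, z]" by simp
  also have "\<dots> =
     blinfun_apply a x * (blinfun_apply b y * blinfun_apply c z - blinfun_apply b z * blinfun_apply c y)
   - blinfun_apply a y * (blinfun_apply b x * blinfun_apply c z - blinfun_apply b z * blinfun_apply c x)
   + blinfun_apply a z * (blinfun_apply b x * blinfun_apply c y - blinfun_apply b y * blinfun_apply c x)"
    unfolding wedge_def s
    by (simp add: one_form_def sum_over_permutations_insert[OF f1] sum_over_permutations_insert[OF f2] permutes_sing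
        sign_swap_id permutation_swap_id sign_compose permutation_compose sign_id wedge_list_2
        Transposition.transpose_def del: wedge_list.simps) (simp add: field_simps)
  finally show ?thesis .
qed

lemma sum_1_7: "(\<Sum>k\<in>{1..7::nat}. f k) = f 1 + f 2 + f 3 + f 4 + f 5 + f 6 + f (7::nat)"
  by (simp add: eval_nat_numeral add.assoc)

text \<open>The diagonal of the metric in an adapted frame. Its entries are their own reciprocals,
  so they also give the inverse metric.\<close>

definition sgn7 :: "nat \<Rightarrow> real" where "sgn7 i = (if i \<le> 4 then - 1 else 1)"

text \<open>\<open>v_coframe\<close> makes \<open>v\<close> the coframe from which
  \<open>g2s_metric\<close> and \<open>g2s_vol\<close> are read off, so both have their standard
  expressions in the frame \<open>E\<close>.\<close>

locale adapted_frame =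
  fixes \<phi> :: "(real ^ 7) form" and v :: "nat \<Rightarrow> (real ^ 7) \<Rightarrow>\<^sub>L real" and E :: "nat \<Rightarrow> real ^ 7"
  assumes phi: "\<phi> = g2s_form v"
    and dual: "\<And>i j. i \<in> {1..7} \<Longrightarrow> j \<in> {1..7} \<Longrightarrow> blinfun_apply (v i) (E j) = (if i = j then 1 else 0)"
    and expand: "\<And>x. x = (\<Sum>i\<in>{1..7}. blinfun_apply (v i) x *\<^sub>R E i)"
    and v_coframe: "v = g2s_coframe \<phi>"

lemma g2s_structure_adapted_frame:
  assumes "g2s_structure \<phi>" obtains E where "adapted_frame \<phi> (g2s_coframe \<phi>) E"
proof -
  define v where "v = g2s_coframe \<phi>"
  have ad: "adapted_coframe \<phi> v"
    using assms someI_ex[of "adapted_coframe \<phi>"] unfolding g2s_structure_def g2s_coframe_def v_def by blast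
  obtain idx :: "7 \<Rightarrow> nat" where idx: "bij_betw idx UNIV {1..7}"
    using finite_same_card_bij[of "UNIV :: 7 set" "{1..7::nat}"] by auto
  \<comment> \<open>Coordinates with respect to the coframe: injective because the coframe spans the
    dual space, with an inverse that carries the standard basis to the dual frame.\<close>
  define F :: "real ^ 7 \<Rightarrow> real ^ 7" where "F x = (\<chi> i. blinfun_apply (v (idx i)) x)" for x
  have lin: "linear F"
    by (rule linearI) (auto simp: F_def vec_eq_iff blinfun.add_right blinfun.scaleR_right)
  have "x = 0" if "F x = 0" for x
  proof -
    have "blinfun_apply (v k) x = 0" if "k \<in> {1..7}" for k
    proof -
      have "k \<in> idx ` UNIV" using idx that by (simp add: bij_betw_def)
      then obtain i where "idx i = k" by blast
      then show ?thesis using \<open>F x = 0\<close> by (auto simp: F_def vec_eq_iff)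
    qed
    \<comment> \<open>The functionals vanishing at \<open>x\<close> form a subspace containing the
      coframe, hence all functionals, among them the inner product with \<open>x\<close>
      itself.\<close>
    moreover have "subspace {f :: (real ^ 7) \<Rightarrow>\<^sub>L real. blinfun_apply f x = 0}"
      by (auto simp: subspace_def blinfun.add_left blinfun.scaleR_left)
    ultimately have "span (v ` {1..7}) \<subseteq> {f. blinfun_apply f x = 0}"
      by (intro span_minimal) auto
    then have "blinfun_apply f x = 0" for f :: "(real ^ 7) \<Rightarrow>\<^sub>L real"
      using ad by (auto simp: adapted_coframe_def)
    from this[of "blinfun_inner_right x"] show "x = 0" by simp
  qed
  then have inj: "inj F" using lin linear_injective_0 by blast
  then have surj: "surj F" using lin linear_injective_imp_surjective by blast
  define E where "E k = inv F (axis (inv_into UNIV idx k) 1)" for k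
  have FE: "F (E k) = axis (inv_into UNIV idx k) 1" for k
    unfolding E_def using surj by (simp add: surj_f_inv_f)
  have idx_inv: "idx (inv_into UNIV idx k) = k" if "k \<in> {1..7}" for k
    using f_inv_into_f[of k idx UNIV] idx that by (simp add: bij_betw_def)
  have dual: "blinfun_apply (v i) (E j) = (if i = j then 1 else 0)" if "i \<in> {1..7}" "j \<in> {1..7}" for i j
  proof -
    have "blinfun_apply (v i) (E j) = F (E j) $ inv_into UNIV idx i" using idx_inv that by (simp add: F_def)
    moreover have "inv_into UNIV idx i = inv_into UNIV idx j \<longleftrightarrow> i = j"
      using arg_cong[of "inv_into UNIV idx i" "inv_into UNIV idx j" idx] unfolding idx_inv[OF that(1)] idx_inv[OF that(2)] by blast
    ultimately show ?thesis by (simp add: FE axis_def)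
  qed
  have "x = (\<Sum>i\<in>{1..7}. blinfun_apply (v i) x *\<^sub>R E i)" for x
  proof (rule injD[OF inj])
    have "blinfun_apply (v k) (\<Sum>i\<in>{1..7}. blinfun_apply (v i) x *\<^sub>R E i) = blinfun_apply (v k) x"
      if "k \<in> {1..7}" for k
      using that by (simp add: blinfun.sum_right blinfun.scaleR_right dual if_distrib cong: if_cong)
    moreover have "idx i \<in> {1..7}" for i using idx by (auto simp: bij_betw_def)
    ultimately show "F x = F (\<Sum>i\<in>{1..7}. blinfun_apply (v i) x *\<^sub>R E i)"
      unfolding F_def by (simp only: vec_eq_iff vec_lambda_beta simp_thms)
  qed
  then have "adapted_frame \<phi> v E"
    using ad dual by unfold_locales (auto simp: adapted_coframe_def v_def)
  then show ?thesis using that v_def by blast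
qed

section \<open>Metric, inverse metric and volume form in an adapted frame\<close>

context adapted_frame
begin

abbreviation "g \<equiv> g2s_metric \<phi>"
abbreviation "vol \<equiv> g2s_vol \<phi>"

lemma metric_eq: "g x y = (\<Sum>i\<in>{1..7}. sgn7 i * (blinfun_apply (v i) x * blinfun_apply (v i) y))"
proof -
  have "{1..7} = {1..4} \<union> {5..7::nat}" by auto
  then have "(\<Sum>i\<in>{1..7}. sgn7 i * (blinfun_apply (v i) x * blinfun_apply (v i) y)) =
    (\<Sum>i\<in>{1..4}. sgn7 i * (blinfun_apply (v i) x * blinfun_apply (v i) y))
    + (\<Sum>i\<in>{5..7}. sgn7 i * (blinfun_apply (v i) x * blinfun_apply (v i) y))"
    by (simp add: sum.union_disjoint)
  then show ?thesis
    by (simp add: g2s_metric_def Let_def v_coframe[symmetric] sgn7_def sum_negf)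
qed

lemma vol_frame: "vol (map E [1,2,3,4,5,6,7]) = 1"
proof -
  have "wedge_list (map v [1,2,3,4,5,6,7]) (map E [1,2,3,4,5,6,7]) = 1"
  proof (rule wedge_list_dual)
    have e: "[1,2,3,4,5,6,7] = map (\<lambda>i. i + 1) [0..<7::nat]" by (simp add: upt_rec)
    fix i j assume "i < length (map E [1,2,3,4,5,6,7])" "j < length (map E [1,2,3,4,5,6,7])"
    then show "blinfun_apply (map v [1,2,3,4,5,6,7] ! i) (map E [1,2,3,4,5,6,7] ! j) = (if i = j then 1 else 0)"
      unfolding e using dual[of "i + 1" "j + 1"] by simp
  qed simp
  then show ?thesis unfolding g2s_vol_def v_coframe .
qed

lemma vol_in_forms: "vol \<in> forms 7"
proof -
  have l: "length (map v [1,2,3,4,5,6,7]) = 7" by simp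
  show ?thesis
    using wedge_list_in_forms[of "map v [1,2,3,4,5,6,7]"] unfolding l unfolding g2s_vol_def v_coframe .
qed

lemma vol_ebasis: "vol (ebasis indices) * det_form (map E [1,2,3,4,5,6,7]) = 1"
proof -
  have "vol \<in> forms CARD(7)" using vol_in_forms by simp
  from top_form_eq_det_form[OF this, of "map E [1,2,3,4,5,6,7]"] show ?thesis
    by (simp only: vol_frame)
qed

lemma expand_component: "(\<Sum>a\<in>{1..7}. blinfun_apply (v a) x * E a $ k) = x $ k"
proof -
  have "x $ k = (\<Sum>i\<in>{1..7}. blinfun_apply (v i) x *\<^sub>R E i) $ k" using expand[of x] by simp
  then show ?thesis by (simp add: sum_component)
qed

lemma v_coordinates: "(\<Sum>j\<in>UNIV. blinfun_apply (v a) (axis j 1) * x $ j) = blinfun_apply (v a) x"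
proof -
  have "x = (\<Sum>j\<in>UNIV. x $ j *\<^sub>R axis j 1)"
    using basis_expansion[of x] by (simp add: scalar_mult_eq_scaleR)
  then have "blinfun_apply (v a) x = (\<Sum>j\<in>UNIV. blinfun_apply (v a) (x $ j *\<^sub>R axis j 1))"
    by (metis blinfun.sum_right)
  then show ?thesis by (simp add: blinfun.scaleR_right mult.commute)
qed

lemma cogram_eq: "cogram g $ i $ j = (\<Sum>a\<in>{1..7}. sgn7 a * (E a $ i * E a $ j))"
proof -
  \<comment> \<open>The candidate for the inverse matrix: the metric is diagonal in the frame, with
    entries equal to their reciprocals.\<close>
  define C :: "real ^ 7 ^ 7" where "C = (\<chi> i j. \<Sum>a\<in>{1..7}. sgn7 a * (E a $ i * E a $ j))"
  have s2: "sgn7 a * sgn7 a = 1" for a by (simp add: sgn7_def)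
  have "(gram g ** C) $ i $ k = (mat 1 :: real ^ 7 ^ 7) $ i $ k" for i k
  proof -
    have "(gram g ** C) $ i $ k = (\<Sum>j\<in>UNIV. \<Sum>a\<in>{1..7}. \<Sum>b\<in>{1..7}.
        sgn7 a * blinfun_apply (v a) (axis i 1) * sgn7 b * E b $ k * (blinfun_apply (v a) (axis j 1) * E b $ j))"
      unfolding matrix_matrix_mult_def gram_def C_def metric_eq vec_lambda_beta sum_product
      by (intro sum.cong refl) (simp only: mult_ac)
    also have "\<dots> = (\<Sum>a\<in>{1..7}. \<Sum>j\<in>UNIV. \<Sum>b\<in>{1..7}.
        sgn7 a * blinfun_apply (v a) (axis i 1) * sgn7 b * E b $ k * (blinfun_apply (v a) (axis j 1) * E b $ j))"
      by (rule sum.swap)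
    also have "\<dots> = (\<Sum>a\<in>{1..7}. \<Sum>b\<in>{1..7}. \<Sum>j\<in>UNIV.
        sgn7 a * blinfun_apply (v a) (axis i 1) * sgn7 b * E b $ k * (blinfun_apply (v a) (axis j 1) * E b $ j))"
      by (intro sum.cong refl sum.swap)
    also have "\<dots> = (\<Sum>a\<in>{1..7}. \<Sum>b\<in>{1..7}.
        sgn7 a * blinfun_apply (v a) (axis i 1) * sgn7 b * E b $ k * (if a = b then 1 else 0))"
      by (simp only: sum_distrib_left[symmetric] v_coordinates) (intro sum.cong refl, simp add: dual)
    also have "\<dots> = (\<Sum>a\<in>{1..7}. (sgn7 a * sgn7 a) * (blinfun_apply (v a) (axis i 1) * E a $ k))"
      by (intro sum.cong refl) (simp add: if_distrib mult_ac cong: if_cong)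
    also have "\<dots> = axis i 1 $ k" unfolding s2 mult_1 by (rule expand_component)
    finally show ?thesis by (simp add: mat_def axis_def)
  qed
  then have 1: "gram g ** C = mat 1" by (simp add: vec_eq_iff)
  then have 2: "C ** gram g = mat 1" using matrix_left_right_inverse by blast
  have "invertible (gram g)" using 1 2 unfolding invertible_def by blast
  then have "cogram g ** gram g = mat 1"
    unfolding cogram_def matrix_inv_def invertible_def by (rule someI2_ex) blast
  then have "cogram g ** (gram g ** C) = C" by (simp add: matrix_mul_assoc)
  then have "cogram g = C" by (simp add: 1)
  then show ?thesis by (simp add: C_def)
qed

text \<open>The bridge between the two settings: contractions with the inverse metric in coordinates
  become signed sums over the frame.\<close>

lemma bilinear_contraction:
  assumes "\<And>x. linear (\<lambda>y. \<beta> x y)" "\<And>y. linear (\<lambda>x. \<beta> x y)"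
  shows "(\<Sum>i\<in>UNIV. \<Sum>j\<in>UNIV. cogram g $ i $ j * \<beta> (axis i 1) (axis j 1)) = (\<Sum>a\<in>{1..7}. sgn7 a * \<beta> (E a) (E a) :: real)"
proof -
  have "(\<Sum>i\<in>UNIV. \<Sum>j\<in>UNIV. cogram g $ i $ j * \<beta> (axis i 1) (axis j 1)) =
      (\<Sum>i\<in>UNIV. \<Sum>j\<in>UNIV. \<Sum>a\<in>{1..7}. sgn7 a * (E a $ i * (E a $ j * \<beta> (axis i 1) (axis j 1))))"
    unfolding cogram_eq sum_distrib_right by (simp only: mult.assoc)
  also have "\<dots> = (\<Sum>a\<in>{1..7}. \<Sum>i\<in>UNIV. \<Sum>j\<in>UNIV. sgn7 a * (E a $ i * (E a $ j * \<beta> (axis i 1) (axis j 1))))"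
    by (subst sum.swap[where B = "{1..7}"], subst sum.swap[where A = UNIV and B = "{1..7}"]) (rule refl)
  also have "\<dots> = (\<Sum>a\<in>{1..7}. sgn7 a * \<beta> (E a) (E a))"
  proof (rule sum.cong[OF refl])
    fix a
    have l1: "(\<Sum>j\<in>UNIV. x $ j * f (axis j 1)) = f x" if "linear f" for x and f :: "real ^ 7 \<Rightarrow> real"
    proof -
      have "f x = f (\<Sum>j\<in>UNIV. x $ j *\<^sub>R axis j 1)"
        using basis_expansion[of x] by (simp add: scalar_mult_eq_scaleR)
      then show ?thesis using that by (simp add: linear_sum linear_cmul)
    qed
    show "(\<Sum>i\<in>UNIV. \<Sum>j\<in>UNIV. sgn7 a * (E a $ i * (E a $ j * \<beta> (axis i 1) (axis j 1)))) = sgn7 a * \<beta> (E a) (E a)"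
      by (simp only: sum_distrib_left[symmetric] l1[OF assms(1)] l1[OF assms(2)])
  qed
  finally show ?thesis .
qed

text \<open>In the frame the Gram matrix is diagonal with four entries -1, so its determinant is 1.
  The determinant of the change of basis is the reciprocal of the volume coefficient.\<close>

lemma det_gram: "det (gram g) = (vol (ebasis indices))\<^sup>2"
proof -
  define M :: "real ^ 7 ^ 7" where "M = (\<chi> i. E (Suc (index_pos i)))"
  have m: "map E [1,2,3,4,5,6,7] ! k = E (Suc k)" if "k < 7" for k
  proof -
    have e: "[1,2,3,4,5,6,7] = map Suc [0..<7]" by (simp add: upt_rec)
    show ?thesis unfolding e using that by simp
  qed
  have dM: "det_form (map E [1,2,3,4,5,6,7]) = det M"
    using m index_pos(1)[where 'n=7] by (simp add: det_form_def M_def)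
  have pos: "Suc (index_pos (i::7)) \<in> {1..7}" for i using index_pos(1)[of i] by simp
  have posinj: "index_pos i = index_pos j \<longleftrightarrow> i = j" for i j :: 7 by (metis index_pos(2))
  have bilin: "(\<Sum>a\<in>UNIV. \<Sum>b\<in>UNIV. x $ a * y $ b * g (axis a 1) (axis b 1)) = g x y" for x y
  proof -
    have "(\<Sum>a\<in>UNIV. \<Sum>b\<in>UNIV. x $ a * y $ b * g (axis a 1) (axis b 1)) =
      (\<Sum>a\<in>UNIV. \<Sum>b\<in>UNIV. \<Sum>i\<in>{1..7}. sgn7 i * ((blinfun_apply (v i) (axis a 1) * x $ a) * (blinfun_apply (v i) (axis b 1) * y $ b)))"
      by (simp add: metric_eq sum_distrib_left mult_ac)
    also have "\<dots> = (\<Sum>i\<in>{1..7}. \<Sum>a\<in>UNIV. \<Sum>b\<in>UNIV. sgn7 i * ((blinfun_apply (v i) (axis a 1) * x $ a) * (blinfun_apply (v i) (axis b 1) * y $ b)))"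
      by (subst sum.swap[where B = "{1..7}"], subst sum.swap[where A = UNIV and B = "{1..7}"]) (rule refl)
    also have "\<dots> = (\<Sum>i\<in>{1..7}. sgn7 i * ((\<Sum>a\<in>UNIV. blinfun_apply (v i) (axis a 1) * x $ a) * (\<Sum>b\<in>UNIV. blinfun_apply (v i) (axis b 1) * y $ b)))"
      by (intro sum.cong refl) (subst sum_product, simp only: sum_distrib_left)
    finally show ?thesis unfolding v_coordinates metric_eq .
  qed
  have "(M ** gram g ** transpose M) $ i $ j = g (E (Suc (index_pos i))) (E (Suc (index_pos j)))" for i j
  proof -
    have "(M ** gram g ** transpose M) $ i $ j =
      (\<Sum>b\<in>UNIV. \<Sum>a\<in>UNIV. E (Suc (index_pos i)) $ a * E (Suc (index_pos j)) $ b * g (axis a 1) (axis b 1))"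
      unfolding matrix_matrix_mult_def transpose_def M_def gram_def vec_lambda_beta sum_distrib_right
      by (intro sum.cong refl) (simp only: mult_ac)
    also have "\<dots> = g (E (Suc (index_pos i))) (E (Suc (index_pos j)))"
      by (subst sum.swap) (rule bilin)
    finally show ?thesis .
  qed
  moreover have "g (E (Suc (index_pos i))) (E (Suc (index_pos j))) = (if i = j then sgn7 (Suc (index_pos i)) else 0)" for i j :: 7
  proof -
    have "g (E (Suc (index_pos i))) (E (Suc (index_pos j))) =
      (\<Sum>k\<in>{1..7}. if k = Suc (index_pos i) then (if i = j then sgn7 k else 0) else 0)"
      unfolding metric_eq using pos[of i] pos[of j] posinj[of i j]
      by (intro sum.cong refl) (simp add: dual del: atLeastAtMost_iff One_nat_def)
    then show ?thesis using pos by simp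
  qed
  ultimately have "det (M ** gram g ** transpose M) = (\<Prod>i\<in>UNIV. sgn7 (Suc (index_pos (i::7))))"
    by (subst det_diagonal) auto
  also have "\<dots> = (\<Prod>k\<in>{..<7}. sgn7 (Suc k))"
  proof (rule prod.reindex_bij_betw)
    have "index_pos ` (UNIV :: 7 set) = {..<7}"
      by (intro card_subset_eq) (use index_pos(1)[where 'n=7] posinj in \<open>auto simp: card_image inj_on_def\<close>)
    then show "bij_betw index_pos (UNIV :: 7 set) {..<7}"
      using posinj by (auto simp: bij_betw_def inj_on_def)
  qed
  also have "\<dots> = 1" by (simp add: eval_nat_numeral sgn7_def lessThan_Suc)
  finally have "det M * det (gram g) * det M = 1" by (simp add: det_mul det_transpose)
  moreover have "vol (ebasis indices) * det M = 1" using vol_ebasis unfolding dM .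
  ultimately show ?thesis
    by algebra
qed

end

lemma sum_less_pairs:
  fixes h :: "nat \<Rightarrow> nat \<Rightarrow> real"
  shows "(\<Sum>a\<in>{1..7}. \<Sum>b\<in>{a<..7}. h a b) = h 1 2 + h 1 3 + h 1 4 + h 1 5 + h 1 6 + h 1 7 + h 2 3 + h 2 4 + h 2 5 + h 2 6 + h 2 7 + h 3 4 +
    h 3 5 + h 3 6 + h 3 7 + h 4 5 + h 4 6 + h 4 7 + h 5 6 + h 5 7 + h 6 7"
proof -
  have "{1<..7::nat} = {2,3,4,5,6,7}" "{2<..7::nat} = {3,4,5,6,7}" "{3<..7::nat} = {4,5,6,7}" "{4<..7::nat} = {5,6,7}"
    "{5<..7::nat} = {6,7}" "{6<..7::nat} = {7}" "{7<..7::nat} = {}" by auto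
  then show ?thesis unfolding sum_1_7 by (simp del: One_nat_def)
qed

text \<open>Reduces symmetric double sums to the 21 pairs a < b before they are expanded into
  components.\<close>

lemma pair_sum:
  fixes h :: "nat \<Rightarrow> nat \<Rightarrow> real"
  assumes "\<And>a b. h b a = h a b" "\<And>a. h a a = 0"
  shows "(\<Sum>a\<in>{1..7}. \<Sum>b\<in>{1..7}. h a b) = 2 * (\<Sum>a\<in>{1..7}. \<Sum>b\<in>{a<..7}. h a b)"
proof -
  have s: "b < a \<Longrightarrow> h a b = h b a" for a b by (rule assms)
  show ?thesis
    unfolding sum_less_pairs sum_1_7 assms(2)
    by (simp add: s[of 1] s[of 2] s[of 3] s[of 4] s[of 5] s[of 6] del: One_nat_def)
qed

section \<open>Contraction identities of the 3-form\<close>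

context adapted_frame
begin

declare dual [simp]

lemma phi_eval: "\<phi> [x, y, z] =
    - wedge_list [v 1, v 2, v 7] [x, y, z] - wedge_list [v 3, v 4, v 7] [x, y, z] + wedge_list [v 5, v 6, v 7] [x, y, z]
    + wedge_list [v 1, v 3, v 5] [x, y, z] - wedge_list [v 1, v 4, v 6] [x, y, z] - wedge_list [v 2, v 3, v 6] [x, y, z]
    - wedge_list [v 2, v 4, v 5] [x, y, z]"
  by (simp only: phi g2s_form_def)

lemma phi_swap: "\<phi> [y, x, z] = - \<phi> [x, y, z]" "\<phi> [x, z, y] = - \<phi> [x, y, z]"
  unfolding phi_eval wedge_list_3 by (simp_all add: algebra_simps)

lemma phi_repeat: "\<phi> [x, x, y] = 0" "\<phi> [x, y, y] = 0"
  using phi_swap(1)[of x x y] phi_swap(2)[of x y y] by simp_all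

text \<open>In the frame, each index lies in three of the seven monomials of \<open>\<phi>\<close>,
  each counted with two orders of the other indices: this is the 6. No pair of indices lies in two
  monomials, whence the off-diagonal zeros.\<close>

lemma phi_contract2:
  "(\<Sum>k\<in>{1..7}. \<Sum>l\<in>{1..7}. sgn7 k * sgn7 l * (\<phi> [x, E k, E l] * \<phi> [y, E k, E l])) = 6 * g x y"
proof -
  have "(\<Sum>k\<in>{1..7}. \<Sum>l\<in>{1..7}. sgn7 k * sgn7 l * (\<phi> [x, E k, E l] * \<phi> [y, E k, E l]))
    = 2 * (\<Sum>k\<in>{1..7}. \<Sum>l\<in>{k<..7}. sgn7 k * sgn7 l * (\<phi> [x, E k, E l] * \<phi> [y, E k, E l]))"
  proof (rule pair_sum)
    show "sgn7 b * sgn7 a * (\<phi> [x, E b, E a] * \<phi> [y, E b, E a]) = sgn7 a * sgn7 b * (\<phi> [x, E a, E b] * \<phi> [y, E a, E b])" for a b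
      unfolding phi_swap(2)[of x "E a" "E b"] phi_swap(2)[of y "E a" "E b"] by simp
  qed (simp add: phi_repeat)
  also have "\<dots> = 6 * g x y"
    unfolding sum_less_pairs metric_eq sum_1_7 phi_eval wedge_list_3 by (simp add: sgn7_def del: One_nat_def)
  finally show ?thesis .
qed

text \<open>Up to sign the Hodge dual of \<open>\<phi>\<close>, written as what remains of the
  contraction of two copies of \<open>\<phi>\<close> over one index after subtracting its metric
  part.\<close>

definition phi4 :: "real ^ 7 \<Rightarrow> real ^ 7 \<Rightarrow> real ^ 7 \<Rightarrow> real ^ 7 \<Rightarrow> real" where
  "phi4 a b c d = (\<Sum>k\<in>{1..7}. sgn7 k * (\<phi> [a, b, E k] * \<phi> [c, d, E k])) - g a c * g b d + g a d * g b c"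

text \<open>With the evident skewness in the first two slots, this makes \<open>phi4\<close>
  alternating in the first three, as the Bianchi argument requires. It is a polynomial identity in
  the components of the four vectors.\<close>

lemma phi4_swap: "phi4 a c b d = - phi4 a b c d"
proof -
  have "phi4 a c b d + phi4 a b c d = 0"
    unfolding phi4_def metric_eq sum_1_7 phi_eval wedge_list_3
    by (simp add: sgn7_def del: One_nat_def) algebra
  then show ?thesis by simp
qed

end

section \<open>Pointwise algebra of the covariant derivative of a closed structure\<close>

context adapted_frame
begin

lemmas phi_formula = phi_eval[unfolded wedge_list_3]

lemma phi_frame:
  "\<phi> [E 1, E 2, E 3] = 0"
  "\<phi> [E 1, E 2, E 4] = 0"
  "\<phi> [E 1, E 2, E 5] = 0"
  "\<phi> [E 1, E 2, E 6] = 0"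
  "\<phi> [E 1, E 2, E 7] = -1"
  "\<phi> [E 1, E 3, E 4] = 0"
  "\<phi> [E 1, E 3, E 5] = 1"
  "\<phi> [E 1, E 3, E 6] = 0"
  "\<phi> [E 1, E 3, E 7] = 0"
  "\<phi> [E 1, E 4, E 5] = 0"
  "\<phi> [E 1, E 4, E 6] = -1"
  "\<phi> [E 1, E 4, E 7] = 0"
  "\<phi> [E 1, E 5, E 6] = 0"
  "\<phi> [E 1, E 5, E 7] = 0"
  "\<phi> [E 1, E 6, E 7] = 0"
  "\<phi> [E 2, E 3, E 4] = 0"
  "\<phi> [E 2, E 3, E 5] = 0"
  "\<phi> [E 2, E 3, E 6] = -1"
  "\<phi> [E 2, E 3, E 7] = 0"
  "\<phi> [E 2, E 4, E 5] = -1"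
  "\<phi> [E 2, E 4, E 6] = 0"
  "\<phi> [E 2, E 4, E 7] = 0"
  "\<phi> [E 2, E 5, E 6] = 0"
  "\<phi> [E 2, E 5, E 7] = 0"
  "\<phi> [E 2, E 6, E 7] = 0"
  "\<phi> [E 3, E 4, E 5] = 0"
  "\<phi> [E 3, E 4, E 6] = 0"
  "\<phi> [E 3, E 4, E 7] = -1"
  "\<phi> [E 3, E 5, E 6] = 0"
  "\<phi> [E 3, E 5, E 7] = 0"
  "\<phi> [E 3, E 6, E 7] = 0"
  "\<phi> [E 4, E 5, E 6] = 0"
  "\<phi> [E 4, E 5, E 7] = 0"
  "\<phi> [E 4, E 6, E 7] = 0"
  "\<phi> [E 5, E 6, E 7] = 1"
  by (simp_all add: phi_formula del: One_nat_def)

lemma phi_frame_sort: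
  "j < i \<Longrightarrow> \<phi> [E i, E j, E k] = - \<phi> [E j, E i, E k]" "k < j \<Longrightarrow> \<phi> [E i, E j, E k] = - \<phi> [E i, E k, E j]"
  by (rule phi_swap)+

text \<open>\<open>P\<close> stands for \<open>\<nabla>\<phi>\<close>. The derivative of the metric identity confines the 3-form \<open>P m\<close> to the
  7-dimensional space of contractions of \<open>*\<phi>\<close> with a vector \<open>T m\<close>, and closedness confines \<open>T\<close> to the
  14-dimensional space of 2-forms \<open>t\<close> with \<open>t\<^sub>a\<^sub>b\<phi>\<^sup>i\<^sup>a\<^sup>b = 0\<close>.\<close>

lemma closed_torsion:
  fixes P :: "nat \<Rightarrow> nat \<Rightarrow> nat \<Rightarrow> nat \<Rightarrow> real"
  assumes anti: "\<And>m a b c. P m b a c = - P m a b c" "\<And>m a b c. P m a c b = - P m a b c"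
    and metric: "\<And>m i j. (\<Sum>a\<in>{1..7}. \<Sum>b\<in>{1..7}. sgn7 a * sgn7 b *
        (P m i a b * \<phi> [E j, E a, E b] + \<phi> [E i, E a, E b] * P m j a b)) = 0"
    and closed: "\<And>m a b c. P m a b c - P a m b c + P b m a c - P c m a b = 0"
  shows "(\<Sum>n\<in>{1..7}. \<Sum>m\<in>{1..7}. sgn7 n * sgn7 m *
      (\<Sum>a\<in>{1..7}. \<Sum>b\<in>{1..7}. sgn7 a * sgn7 b * (P n m a b * P m n a b)))
    = 2 * (\<Sum>a\<in>{1..7}. \<Sum>b\<in>{1..7}. sgn7 a * sgn7 b *
        ((\<Sum>m\<in>{1..7}. sgn7 m * P m m a b) * (\<Sum>m\<in>{1..7}. sgn7 m * P m m a b)))"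
proof -
  have rep: "P m a a c = 0" "P m a c c = 0" for m a c
    using anti(1)[of m a a c] anti(2)[of m a c c] by simp_all
  have sort: "b < a \<Longrightarrow> P m a b c = - P m b a c" "c < b \<Longrightarrow> P m a b c = - P m a c b" for m a b c
    by (rule anti)+
  note phi_frame [simp] phi_frame_sort [simp] phi_repeat [simp] sgn7_def [simp] rep [simp] sort [simp] One_nat_def [simp del]
  have "(\<Sum>a\<in>{1..7}. \<Sum>b\<in>{1..7}. sgn7 a * sgn7 b *
        (P m i a b * \<phi> [E j, E a, E b] + \<phi> [E i, E a, E b] * P m j a b))
      = 2 * (\<Sum>a\<in>{1..7}. \<Sum>b\<in>{a<..7}. sgn7 a * sgn7 b *
        (P m i a b * \<phi> [E j, E a, E b] + \<phi> [E i, E a, E b] * P m j a b))" for m i j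
  proof (rule pair_sum)
    show "sgn7 b * sgn7 a * (P m i b a * \<phi> [E j, E b, E a] + \<phi> [E i, E b, E a] * P m j b a)
      = sgn7 a * sgn7 b * (P m i a b * \<phi> [E j, E a, E b] + \<phi> [E i, E a, E b] * P m j a b)" for a b
      unfolding anti(2)[of m i b a] anti(2)[of m j b a] phi_swap(2)[of _ "E b" "E a"] by (simp del: sgn7_def)
  qed simp
  note metric' = metric[unfolded this sum_less_pairs]
  note m = metric'[of _ 1 1] metric'[of _ 1 2] metric'[of _ 1 3] metric'[of _ 1 4] metric'[of _ 1 5]
    metric'[of _ 1 6] metric'[of _ 1 7] metric'[of _ 2 2] metric'[of _ 2 3] metric'[of _ 2 4]
    metric'[of _ 2 5] metric'[of _ 2 6] metric'[of _ 2 7] metric'[of _ 3 3] metric'[of _ 3 4]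
    metric'[of _ 3 5] metric'[of _ 3 6] metric'[of _ 3 7] metric'[of _ 4 4] metric'[of _ 4 5]
    metric'[of _ 4 6] metric'[of _ 4 7] metric'[of _ 5 5] metric'[of _ 5 6] metric'[of _ 5 7]
    metric'[of _ 6 6] metric'[of _ 6 7] metric'[of _ 7 7]
  note m = m[simplified]
  \<comment> \<open>Each value is a component of \<open>P m\<close> that singles out one coordinate
    of the vector whose contraction with \<open>*\<phi>\<close> is \<open>P m\<close>. The metric
    conditions express all 35 components through these seven.\<close>
  define T where "T m q = (if q = 1 then P m 2 5 6 else if q = 2 then P m 1 3 4 else if q = 3 then P m 1 6 7
    else if q = 4 then P m 1 2 3 else if q = 5 then P m 1 4 7 else if q = 6 then P m 1 2 5 else P m 2 4 6)" for m and q :: nat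
  have T: "T m 1 = P m 2 5 6" "T m 2 = P m 1 3 4" "T m 3 = P m 1 6 7" "T m 4 = P m 1 2 3" "T m 5 = P m 1 4 7"
    "T m 6 = P m 1 2 5" "T m 7 = P m 2 4 6" for m by (simp_all add: T_def)
  have r [simp]:
    "P m 1 2 3 = T m 4" "P m 1 2 4 = - T m 3" "P m 1 2 5 = T m 6" "P m 1 2 6 = - T m 5" "P m 1 2 7 = 0"
    "P m 1 3 4 = T m 2" "P m 1 3 5 = 0" "P m 1 3 6 = - T m 7" "P m 1 3 7 = T m 6" "P m 1 4 5 = - T m 7"
    "P m 1 4 6 = 0" "P m 1 4 7 = T m 5" "P m 1 5 6 = - T m 2" "P m 1 5 7 = T m 4" "P m 1 6 7 = T m 3"
    "P m 2 3 4 = - T m 1" "P m 2 3 5 = - T m 7" "P m 2 3 6 = 0" "P m 2 3 7 = T m 5" "P m 2 4 5 = 0"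
    "P m 2 4 6 = T m 7" "P m 2 4 7 = - T m 6" "P m 2 5 6 = T m 1" "P m 2 5 7 = T m 3" "P m 2 6 7 = - T m 4"
    "P m 3 4 5 = T m 6" "P m 3 4 6 = - T m 5" "P m 3 4 7 = 0" "P m 3 5 6 = - T m 4" "P m 3 5 7 = - T m 2"
    "P m 3 6 7 = - T m 1" "P m 4 5 6 = T m 3" "P m 4 5 7 = - T m 1" "P m 4 6 7 = T m 2" "P m 5 6 7 = 0" for m
    by (insert m[of m] T[of m], linarith+)
  note c = closed[of 1 2 3 4] closed[of 1 2 3 5] closed[of 1 2 3 6] closed[of 1 2 3 7] closed[of 1 2 4 5]
    closed[of 1 2 4 6] closed[of 1 2 4 7] closed[of 1 2 5 6] closed[of 1 2 5 7] closed[of 1 2 6 7]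
    closed[of 1 3 4 5] closed[of 1 3 4 6] closed[of 1 3 4 7] closed[of 1 3 5 6] closed[of 1 3 5 7]
    closed[of 1 3 6 7] closed[of 1 4 5 6] closed[of 1 4 5 7] closed[of 1 4 6 7] closed[of 1 5 6 7]
    closed[of 2 3 4 5] closed[of 2 3 4 6] closed[of 2 3 4 7] closed[of 2 3 5 6] closed[of 2 3 5 7]
    closed[of 2 3 6 7] closed[of 2 4 5 6] closed[of 2 4 5 7] closed[of 2 4 6 7] closed[of 2 5 6 7]
    closed[of 3 4 5 6] closed[of 3 4 5 7] closed[of 3 4 6 7] closed[of 3 5 6 7] closed[of 4 5 6 7]
  note c = c[simplified]
  \<comment> \<open>Exactly 14 entries stay free: \<open>T 1 2\<close> to \<open>T 1 7\<close>,
    \<open>T 2 3\<close> to \<open>T 2 7\<close>, and \<open>T 3 4\<close> to \<open>T 3 6\<close>.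
    Both sides of the claim become quadratic polynomials in them.\<close>
  have t [simp]:
    "T 1 1 = 0" "T 2 1 = - T 1 2" "T 2 2 = 0" "T 3 1 = - T 1 3" "T 3 2 = - T 2 3" "T 3 3 = 0"
    "T 3 7 = - T 1 6 - T 2 5" "T 4 1 = - T 1 4" "T 4 2 = - T 2 4" "T 4 3 = - T 3 4" "T 4 4 = 0"
    "T 4 5 = - T 3 6 + T 1 7" "T 4 6 = T 3 5 - T 2 7" "T 4 7 = - T 1 5 + T 2 6" "T 5 1 = - T 1 5"
    "T 5 2 = - T 2 5" "T 5 3 = - T 3 5" "T 5 4 = - T 1 7 + T 3 6" "T 5 5 = 0" "T 5 6 = T 1 2 + T 3 4"
    "T 5 7 = - T 1 4 - T 2 3" "T 6 1 = - T 1 6" "T 6 2 = - T 2 6" "T 6 3 = - T 3 6" "T 6 4 = T 2 7 - T 3 5"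
    "T 6 5 = - T 3 4 - T 1 2" "T 6 6 = 0" "T 6 7 = T 2 4 - T 1 3" "T 7 1 = - T 1 7" "T 7 2 = - T 2 7"
    "T 7 3 = T 1 6 + T 2 5" "T 7 4 = T 1 5 - T 2 6" "T 7 5 = T 1 4 + T 2 3" "T 7 6 = T 1 3 - T 2 4"
    "T 7 7 = 0"
    by (insert c, linarith+)
  define q where "q n m = (\<Sum>a\<in>{1..7}. \<Sum>b\<in>{1..7}. sgn7 a * sgn7 b * (P n m a b * P m n a b))" for n m
  have half: "q n m = 2 * (\<Sum>a\<in>{1..7}. \<Sum>b\<in>{a<..7}. sgn7 a * sgn7 b * (P n m a b * P m n a b))" for n m
    unfolding q_def
  proof (rule pair_sum)
    show "sgn7 b * sgn7 a * (P n m b a * P m n b a) = sgn7 a * sgn7 b * (P n m a b * P m n a b)" for a b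
      unfolding anti(2)[of n m b a] anti(2)[of m n b a] by (simp del: sgn7_def)
  qed simp
  have qs: "b < a \<Longrightarrow> q a b = q b a" for a b
    unfolding q_def by (simp only: mult.commute mult.left_commute)
  define tr where "tr a b = (\<Sum>m\<in>{1..7}. sgn7 m * P m m a b)" for a b
  have ts: "tr b a = - tr a b" for a b
    unfolding tr_def by (simp add: anti(2)[of _ _ b a] sum_negf del: sgn7_def)
  have trr: "tr a a = 0" for a using ts[of a a] by simp
  have half': "(\<Sum>a\<in>{1..7}. \<Sum>b\<in>{1..7}. sgn7 a * sgn7 b * (tr a b * tr a b))
    = 2 * (\<Sum>a\<in>{1..7}. \<Sum>b\<in>{a<..7}. sgn7 a * sgn7 b * (tr a b * tr a b))"
  proof (rule pair_sum)
    show "sgn7 b * sgn7 a * (tr b a * tr b a) = sgn7 a * sgn7 b * (tr a b * tr a b)" for a b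
      unfolding ts[of b a] by (simp del: sgn7_def)
  qed (simp add: trr)
  note q = half[of 1 1] half[of 1 2] half[of 1 3] half[of 1 4] half[of 1 5] half[of 1 6] half[of 1 7] half[of 2 2]
    half[of 2 3] half[of 2 4] half[of 2 5] half[of 2 6] half[of 2 7] half[of 3 3] half[of 3 4] half[of 3 5]
    half[of 3 6] half[of 3 7] half[of 4 4] half[of 4 5] half[of 4 6] half[of 4 7] half[of 5 5] half[of 5 6]
    half[of 5 7] half[of 6 6] half[of 6 7] half[of 7 7]
  note q = q[unfolded sum_less_pairs, simplified algebra_simps, simplified]
  note tr = tr_def[of 1 2] tr_def[of 1 3] tr_def[of 1 4] tr_def[of 1 5] tr_def[of 1 6] tr_def[of 1 7] tr_def[of 2 3]
    tr_def[of 2 4] tr_def[of 2 5] tr_def[of 2 6] tr_def[of 2 7] tr_def[of 3 4] tr_def[of 3 5] tr_def[of 3 6]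
    tr_def[of 3 7] tr_def[of 4 5] tr_def[of 4 6] tr_def[of 4 7] tr_def[of 5 6] tr_def[of 5 7] tr_def[of 6 7]
  note tr = tr[unfolded sum_1_7, simplified]
  have "(\<Sum>n\<in>{1..7}. \<Sum>m\<in>{1..7}. sgn7 n * sgn7 m * q n m)
    = 2 * (\<Sum>a\<in>{1..7}. \<Sum>b\<in>{1..7}. sgn7 a * sgn7 b * (tr a b * tr a b))"
    unfolding half' unfolding sum_less_pairs unfolding sum_1_7 tr by (simp add: qs[of 1] qs[of 2] qs[of 3] qs[of 4] qs[of 5] qs[of 6] q algebra_simps)
  then show ?thesis unfolding q_def tr_def .
qed

end

section \<open>Bryant's formula for the metric\<close>

lemma alternation_frame:
  fixes M :: "(real ^ 7) form" and E :: "nat \<Rightarrow> real ^ 7"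
  shows "alternation 7 M (map E [1,2,3,4,5,6,7]) =
    (\<Sum>a\<in>{1..7}. \<Sum>b\<in>{1..7}. \<Sum>c\<in>{1..7}. \<Sum>d\<in>{1..7}. \<Sum>e\<in>{1..7}. \<Sum>f\<in>{1..7}. \<Sum>h\<in>{1..7}.
      det_form (map (\<lambda>k. axis (indices ! (k - 1)) 1 :: real ^ 7) [a, b, c, d, e, f, h]) * M [E a, E b, E c, E d, E e, E f, E h])"
proof -
  \<comment> \<open>Alternation merely permutes the entries of a list, so any map with the right
    values on the standard basis transports it; linearity plays no part.\<close>
  define l where "l x = E (Suc (index_pos (THE i::7. x = axis i (1::real))))" for x
  have l: "l (axis i 1) = E (Suc (index_pos i))" for i
    by (simp add: l_def axis_eq_axis)
  have list: "map E [1,2,3,4,5,6,7] = map l (ebasis indices)"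
  proof (rule nth_equalityI)
    fix k assume "k < length (map E [1,2,3,4,5,6,7])"
    then have k: "k < 7" by simp
    have e: "[1,2,3,4,5,6,7] = map Suc [0..<7]" by (simp add: upt_rec)
    show "map E [1,2,3,4,5,6,7] ! k = map l (ebasis indices) ! k"
      unfolding e using k index_pos_nth[of k, where 'n=7] by (simp add: l)
  qed simp
  have "alternation 7 M (map l (ebasis indices)) = alternation CARD(7) (\<lambda>us. M (map l us)) (ebasis indices)"
  proof -
    have "map (\<lambda>i. map l (ebasis indices) ! \<pi> i) [0..<7] = map l (map (\<lambda>i. ebasis indices ! \<pi> i) [0..<7])"
      if "\<pi> permutes {..<7}" for \<pi>
      using permutes_in_image[OF that] by auto
    then show ?thesis
      unfolding alternation_def by (simp del: map_map upt_rec_numeral)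
  qed
  also have "\<dots> = (\<Sum>L | length L = CARD(7). det_form (ebasis L) * M (map l (ebasis L)))"
    by (rule alternation_ebasis)
  also have "\<dots> = (\<Sum>L | length L = Suc (Suc (Suc (Suc (Suc (Suc (Suc 0)))))).
      det_form (map (\<lambda>k. axis (indices ! (k - 1)) 1 :: real ^ 7) (map (\<lambda>i. Suc (index_pos i)) (L :: 7 list))) * M (map E (map (\<lambda>i. Suc (index_pos i)) L)))"
    by (simp add: l index_pos(2) o_def eval_nat_numeral)
  also have "\<dots> = (\<Sum>a\<in>{1..7}. \<Sum>b\<in>{1..7}. \<Sum>c\<in>{1..7}. \<Sum>d\<in>{1..7}. \<Sum>e\<in>{1..7}. \<Sum>f\<in>{1..7}. \<Sum>h\<in>{1..7}.
      det_form (map (\<lambda>k. axis (indices ! (k - 1)) 1 :: real ^ 7) [a, b, c, d, e, f, h]) * M [E a, E b, E c, E d, E e, E f, E h])"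
  proof -
    have bij: "bij_betw (\<lambda>i::7. Suc (index_pos i)) UNIV {1..7}"
    proof -
      have inj: "inj (\<lambda>i::7. Suc (index_pos i))" by (rule injI) (metis index_pos(2) nat.inject)
      have "(\<lambda>i::7. Suc (index_pos i)) ` UNIV = {1..7}"
      proof (rule card_subset_eq)
        show "range (\<lambda>i::7. Suc (index_pos i)) \<subseteq> {1..7}" using index_pos(1)[where 'n=7] by (auto simp: Suc_le_eq)
      qed (simp_all add: card_image[OF inj])
      then show ?thesis using inj by (simp add: bij_betw_def)
    qed
    note re = sum.reindex_bij_betw[OF bij]
    show ?thesis
      unfolding sum_lists_Suc sum_lists_0 re[symmetric] by simp
  qed
  finally show ?thesis unfolding list .
qed

text \<open>The tensor product whose alternation underlies iota_x \<open>\<phi>\<close> wedge iota_y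
  \<open>\<phi>\<close> wedge \<open>\<phi>\<close> = 6 g(x,y) vol. The wedge products would divide
  by 2! 2! 3! = 24; without this the constant becomes 6 * 24 = 144.\<close>

definition bryant_tensor :: "(real ^ 7) form \<Rightarrow> real ^ 7 \<Rightarrow> real ^ 7 \<Rightarrow> (real ^ 7) form" where
  "bryant_tensor \<phi> x y us = \<phi> (x # take 2 us) * (\<phi> (y # take 2 (drop 2 us)) * \<phi> (drop 2 (drop 2 us)))"

definition bryant_form :: "(real ^ 7) form \<Rightarrow> real ^ 7 \<Rightarrow> real ^ 7 \<Rightarrow> real" where
  "bryant_form \<phi> x y = alternation 7 (bryant_tensor \<phi> x y) (ebasis indices)"

lemma multilinear_bryant_tensor:
  assumes "\<phi> \<in> forms 3" shows "multilinear 7 (bryant_tensor \<phi> x y)"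
proof -
  have 1: "(\<lambda>us. \<phi> ([z] @ us)) \<in> forms 2" for z
    by (rule forms_append_left[where p = 1]) (use assms in \<open>simp_all add: numeral_3_eq_3\<close>)
  have "multilinear (2 + (2 + 3)) (\<lambda>us. \<phi> ([x] @ take 2 us) * ((\<lambda>ws. \<phi> ([y] @ take 2 ws) * \<phi> (drop 2 ws)) (drop 2 us)))"
    by (intro multilinear_tensor forms_multilinear 1 assms)
  then show ?thesis by (simp add: bryant_tensor_def[abs_def])
qed

lemma bryant_form_eq:
  "bryant_form \<phi> x y = (\<Sum>L | length L = 7. det_form (ebasis (L :: 7 list)) *
     (\<phi> (x # ebasis (take 2 L)) * (\<phi> (y # ebasis (take 2 (drop 2 L))) * \<phi> (ebasis (drop 2 (drop 2 L))))))"
  using alternation_ebasis[of "bryant_tensor \<phi> x y"]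
  by (simp add: bryant_form_def bryant_tensor_def take_map drop_map)

context adapted_frame
begin

text \<open>\<open>D\<close> is an abstract Levi-Civita symbol. Skewness under neighbouring
  exchanges lets rewriting sort its indices, and the normalisation evaluates the sorted
  ones.\<close>

lemma alternating_contraction:
  fixes D :: "nat \<Rightarrow> nat \<Rightarrow> nat \<Rightarrow> nat \<Rightarrow> nat \<Rightarrow> nat \<Rightarrow> nat \<Rightarrow> real"
  assumes anti: "\<And>a b c d e f h. D b a c d e f h = - D a b c d e f h" "\<And>a b c d e f h. D a c b d e f h = - D a b c d e f h"
      "\<And>a b c d e f h. D a b d c e f h = - D a b c d e f h" "\<And>a b c d e f h. D a b c e d f h = - D a b c d e f h"
      "\<And>a b c d e f h. D a b c d f e h = - D a b c d e f h" "\<And>a b c d e f h. D a b c d e h f = - D a b c d e f h"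
    and one: "D 1 2 3 4 5 6 7 = 1"
  shows "(\<Sum>a\<in>{1..7}. \<Sum>b\<in>{1..7}. \<Sum>c\<in>{1..7}. \<Sum>d\<in>{1..7}. \<Sum>e\<in>{1..7}. \<Sum>f\<in>{1..7}. \<Sum>h\<in>{1..7}.
      D a b c d e f h * (\<phi> [x, E a, E b] * (\<phi> [y, E c, E d] * \<phi> [E e, E f, E h]))) = 144 * g x y"
proof -
  have rep: "D a a c d e f h = 0" "D a b b d e f h = 0" "D a b c c e f h = 0" "D a b c d d f h = 0" "D a b c d e e h = 0"
     "D a b c d e f f = 0" for a b c d e f h
    using anti(1)[of a a c d e f h] anti(2)[of a b b d e f h] anti(3)[of a b c c e f h] anti(4)[of a b c d d f h]
      anti(5)[of a b c d e e h] anti(6)[of a b c d e f f] by simp_all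
  have sort: "b < a \<Longrightarrow> D a b c d e f h = - D b a c d e f h" "c < b \<Longrightarrow> D a b c d e f h = - D a c b d e f h"
      "d < c \<Longrightarrow> D a b c d e f h = - D a b d c e f h" "e < d \<Longrightarrow> D a b c d e f h = - D a b c e d f h"
      "f < e \<Longrightarrow> D a b c d e f h = - D a b c d f e h" "h < f \<Longrightarrow> D a b c d e f h = - D a b c d e h f" for a b c d e f h
    by (rule anti)+
  \<comment> \<open>Each monomial of \<open>\<phi>\<close> occurs in 3! = 6 orders of the last three
    indices.\<close>
  have triple: "(\<Sum>i\<in>{1..7}. \<Sum>j\<in>{1..7}. \<Sum>k\<in>{1..7}. D a b c e i j k * \<phi> [E i, E j, E k]) = 6 * (- D a b c e 1 2 7 - D a b c e 3 4 7 + D a b c e 5 6 7 + D a b c e 1 3 5 - D a b c e 1 4 6 - D a b c e 2 3 6 - D a b c e 2 4 5)" for a b c e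
    unfolding sum_1_7 by (simp add: phi_frame phi_frame_sort phi_repeat sort(5,6) del: One_nat_def)
  define F where "F a b c e = (- D a b c e 1 2 7 - D a b c e 3 4 7 + D a b c e 5 6 7 + D a b c e 1 3 5 - D a b c e 1 4 6 - D a b c e 2 3 6 - D a b c e 2 4 5)" for a b c e
  have F: "F b a c e = - F a b c e" "F a b e c = - F a b c e" for a b c e
    unfolding F_def anti(1)[of b a] anti(3)[of a b e c] by simp_all
  have Frep: "F a a c e = 0" "F a b c c = 0" for a b c e using F(1)[of a a c e] F(2)[of a b c c] by simp_all
  have Fv: "F a b c e = - D a b c e 1 2 7 - D a b c e 3 4 7 + D a b c e 5 6 7 + D a b c e 1 3 5 - D a b c e 1 4 6 - D a b c e 2 3 6 - D a b c e 2 4 5" for a b c e by (simp add: F_def)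
  have inner: "(\<Sum>c\<in>{1..7}. \<Sum>e\<in>{1..7}. \<phi> [y, E c, E e] * F a b c e)
    = 2 * (\<Sum>c\<in>{1..7}. \<Sum>e\<in>{c<..7}. \<phi> [y, E c, E e] * F a b c e)" for a b
  proof (rule pair_sum)
    show "\<phi> [y, E e, E c] * F a b e c = \<phi> [y, E c, E e] * F a b c e" for c e
      unfolding phi_swap(2)[of y "E e" "E c"] F(2)[of a b e c] by simp
  qed (simp add: phi_repeat)
  define H where "H a b = (\<Sum>c\<in>{1..7}. \<Sum>e\<in>{1..7}. \<phi> [y, E c, E e] * F a b c e)" for a b
  have outer: "(\<Sum>a\<in>{1..7}. \<Sum>b\<in>{1..7}. \<phi> [x, E a, E b] * H a b)
    = 2 * (\<Sum>a\<in>{1..7}. \<Sum>b\<in>{a<..7}. \<phi> [x, E a, E b] * H a b)"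
  proof (rule pair_sum)
    have H: "H b a = - H a b" for a b unfolding H_def F(1)[of b a] by (simp add: sum_negf)
    show "\<phi> [x, E b, E a] * H b a = \<phi> [x, E a, E b] * H a b" for a b
      unfolding phi_swap(2)[of x "E b" "E a"] H[of b a] by simp
  qed (simp add: phi_repeat)
  note One_nat_def [simp del]
  note h = H_def[of 1 2] H_def[of 1 3] H_def[of 1 4] H_def[of 1 5] H_def[of 1 6] H_def[of 1 7] H_def[of 2 3]
    H_def[of 2 4] H_def[of 2 5] H_def[of 2 6] H_def[of 2 7] H_def[of 3 4] H_def[of 3 5] H_def[of 3 6]
    H_def[of 3 7] H_def[of 4 5] H_def[of 4 6] H_def[of 4 7] H_def[of 5 6] H_def[of 5 7] H_def[of 6 7]
  note h = h[unfolded inner, unfolded sum_less_pairs Fv, simplified sort rep one, simplified]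
  have "(\<Sum>a\<in>{1..7}. \<Sum>b\<in>{1..7}. \<phi> [x, E a, E b] * H a b) = 24 * g x y"
    unfolding outer unfolding sum_less_pairs h metric_eq unfolding sum_1_7
    by (simp add: phi_formula sgn7_def algebra_simps del: One_nat_def)
  moreover have "(\<Sum>a\<in>{1..7}. \<Sum>b\<in>{1..7}. \<Sum>c\<in>{1..7}. \<Sum>d\<in>{1..7}. \<Sum>e\<in>{1..7}. \<Sum>f\<in>{1..7}. \<Sum>h\<in>{1..7}.
      D a b c d e f h * (\<phi> [x, E a, E b] * (\<phi> [y, E c, E d] * \<phi> [E e, E f, E h])))
    = (\<Sum>a\<in>{1..7}. \<Sum>b\<in>{1..7}. \<phi> [x, E a, E b] * (\<Sum>c\<in>{1..7}. \<Sum>d\<in>{1..7}. \<phi> [y, E c, E d] *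
        (\<Sum>e\<in>{1..7}. \<Sum>f\<in>{1..7}. \<Sum>h\<in>{1..7}. D a b c d e f h * \<phi> [E e, E f, E h])))"
    by (simp only: sum_distrib_left mult.left_commute mult.assoc)
  moreover have "\<dots> = 6 * (\<Sum>a\<in>{1..7}. \<Sum>b\<in>{1..7}. \<phi> [x, E a, E b] * H a b)"
    unfolding triple H_def F_def[symmetric] by (simp only: sum_distrib_left mult.left_commute mult.assoc)
  ultimately show ?thesis by simp
qed

text \<open>The alternation is evaluated on the frame, where the volume form is 1.
  One-dimensionality of the 7-forms carries the result to the standard basis.\<close>

lemma bryant_form_metric:
  assumes "\<phi> \<in> forms 3"
  shows "bryant_form \<phi> x y = 144 * vol (ebasis indices) * g x y"
proof -
  let ?A = "alternation 7 (bryant_tensor \<phi> x y)"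
  have A: "?A \<in> forms CARD(7)"
    using alternation_in_forms[OF multilinear_bryant_tensor[OF assms]] by simp
  define e :: "nat \<Rightarrow> real ^ 7" where "e k = axis (indices ! (k - 1)) 1" for k
  define D where "D a b c d f h i = det_form (map e [a, b, c, d, f, h, i])" for a b c d f h i
  have sw: "det_form (L[i := L ! j, j := L ! i]) = - det_form L" if "length L = 7" "i < 7" "j < 7" "i \<noteq> j" for L :: "(real ^ 7) list" and i j
    by (rule forms_swap[OF det_form_in_forms]) (use that in auto)
  have el: "map e [1,2,3,4,5,6,7] = ebasis indices"
  proof (rule nth_equalityI)
    fix k assume "k < length (map e [1,2,3,4,5,6,7])"
    then have k: "k < 7" by simp
    have l: "[1,2,3,4,5,6,7] = map Suc [0..<7]" by (simp add: upt_rec)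
    show "map e [1,2,3,4,5,6,7] ! k = ebasis indices ! k"
      unfolding l using k by (simp add: e_def)
  qed simp
  have "?A (map E [1,2,3,4,5,6,7]) = (\<Sum>a\<in>{1..7}. \<Sum>b\<in>{1..7}. \<Sum>c\<in>{1..7}. \<Sum>d\<in>{1..7}. \<Sum>f\<in>{1..7}. \<Sum>h\<in>{1..7}. \<Sum>i\<in>{1..7}.
      D a b c d f h i * (\<phi> [x, E a, E b] * (\<phi> [y, E c, E d] * \<phi> [E f, E h, E i])))"
    unfolding alternation_frame D_def e_def[symmetric] bryant_tensor_def
    by (simp add: numeral_2_eq_2 e_def del: One_nat_def)
  also have "\<dots> = 144 * g x y"
  proof (rule alternating_contraction)
    show "D 1 2 3 4 5 6 7 = 1" unfolding D_def el by simp
    fix a b c d f h i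
    let ?L = "map e [a, b, c, d, f, h, i]"
    show "D b a c d f h i = - D a b c d f h i" using sw[of ?L 0 1] by (simp add: D_def)
    show "D a c b d f h i = - D a b c d f h i" using sw[of ?L 1 2] by (simp add: D_def eval_nat_numeral)
    show "D a b d c f h i = - D a b c d f h i" using sw[of ?L 2 3] by (simp add: D_def eval_nat_numeral)
    show "D a b c f d h i = - D a b c d f h i" using sw[of ?L 3 4] by (simp add: D_def eval_nat_numeral)
    show "D a b c d h f i = - D a b c d f h i" using sw[of ?L 4 5] by (simp add: D_def eval_nat_numeral)
    show "D a b c d f i h = - D a b c d f h i" using sw[of ?L 5 6] by (simp add: D_def eval_nat_numeral)
  qed
  finally have "?A (map E [1,2,3,4,5,6,7]) = 144 * g x y" .
  moreover have "?A (map E [1,2,3,4,5,6,7]) = bryant_form \<phi> x y * det_form (map E [1,2,3,4,5,6,7])"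
    unfolding bryant_form_def by (rule top_form_eq_det_form[OF A])
  ultimately have "vol (ebasis indices) * (bryant_form \<phi> x y * det_form (map E [1,2,3,4,5,6,7])) = vol (ebasis indices) * (144 * g x y)"
    by simp
  then show ?thesis using vol_ebasis by (simp only: mult.left_commute mult.assoc)
qed

end

section \<open>The Levi-Civita connection in coordinates\<close>

lemma partial_prod:
  assumes "finite J" "\<And>j. j \<in> J \<Longrightarrow> f j differentiable (at x)"
  shows "partial i (\<lambda>y. \<Prod>j\<in>J. f j y) x = (\<Sum>j\<in>J. partial i (f j) x * (\<Prod>k\<in>J - {j}. f k x))"
  by (rule partial_eqI[THEN trans, OF has_derivative_prod[OF frechet_derivative_works[THEN iffD1, OF assms(2)]]])
    (simp_all add: partial_def)

lemma sum_delta_mult [simp]: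
  "(\<Sum>k\<in>UNIV. (if k = i then 1 else 0) * f k) = (f i :: real)"
  "(\<Sum>k\<in>UNIV. (if i = k then 1 else 0) * f k) = (f (i::'n::finite) :: real)"
  "(\<Sum>k\<in>UNIV. f k * (if k = i then 1 else 0)) = (f i :: real)"
  "(\<Sum>k\<in>UNIV. f k * (if i = k then 1 else 0)) = (f i :: real)"
  by (simp_all add: if_distrib[of "\<lambda>x. x * _"] if_distrib[of "\<lambda>x. _ * x"] cong: if_cong)

text \<open>Symmetry is asked for at all points, so that \<open>lo i j\<close> and
  \<open>lo j i\<close> are equal as functions and may be exchanged under
  \<open>partial\<close>.\<close>

locale metric_chart =
  fixes U :: "(real ^ 'n::finite) set" and g :: "'n metric_field"
  assumes open_U: "open U"
    and smooth_gram: "\<And>i j. smooth_on U (\<lambda>x. gram (g x) $ i $ j)"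
    and gram_sym: "\<And>x i j. gram (g x) $ i $ j = gram (g x) $ j $ i"
    and det_gram_nz: "\<And>x. x \<in> U \<Longrightarrow> det (gram (g x)) \<noteq> 0"
begin

definition lo :: "'n \<Rightarrow> 'n \<Rightarrow> real ^ 'n \<Rightarrow> real" where "lo i j x = gram (g x) $ i $ j"
definition up :: "'n \<Rightarrow> 'n \<Rightarrow> real ^ 'n \<Rightarrow> real" where "up i j x = cogram (g x) $ i $ j"
abbreviation "\<Gamma> \<equiv> christoffel g"

lemma lo_sym: "lo i j = lo j i"
  by (rule ext) (simp add: lo_def gram_sym[of _ i j])

lemma smooth_lo: "smooth_on U (lo i j)"
  unfolding lo_def[abs_def] by (rule smooth_gram)

lemma lo_up_matrix: "x \<in> U \<Longrightarrow> gram (g x) ** cogram (g x) = mat 1" "x \<in> U \<Longrightarrow> cogram (g x) ** gram (g x) = mat 1"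
proof -
  assume "x \<in> U"
  then have "invertible (gram (g x))" using det_gram_nz invertible_det_nz by blast
  then have "gram (g x) ** cogram (g x) = mat 1 \<and> cogram (g x) ** gram (g x) = mat 1"
    unfolding cogram_def matrix_inv_def invertible_def by (rule someI_ex)
  then show "gram (g x) ** cogram (g x) = mat 1" "cogram (g x) ** gram (g x) = mat 1" by auto
qed

lemma lo_up: "x \<in> U \<Longrightarrow> (\<Sum>k\<in>UNIV. lo i k x * up k j x) = (if i = j then 1 else 0)"
  using arg_cong[OF lo_up_matrix(1)[of x], of "\<lambda>A. A $ i $ j"]
  by (simp add: matrix_matrix_mult_def lo_def up_def mat_def)

lemma up_lo: "x \<in> U \<Longrightarrow> (\<Sum>k\<in>UNIV. up i k x * lo k j x) = (if i = j then 1 else 0)"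
  using arg_cong[OF lo_up_matrix(2)[of x], of "\<lambda>A. A $ i $ j"]
  by (simp add: matrix_matrix_mult_def lo_def up_def mat_def)

lemma up_sym: assumes "x \<in> U" shows "up i j x = up j i x"
proof -
  have "gram (g x) = transpose (gram (g x))" using gram_sym[of x] by (simp add: vec_eq_iff transpose_def)
  then have "transpose (cogram (g x)) ** gram (g x) = mat 1"
    using lo_up_matrix(1)[OF assms] by (metis matrix_transpose_mul transpose_mat)
  then have "transpose (cogram (g x)) = cogram (g x)"
    using lo_up_matrix(1)[OF assms] by (metis matrix_mul_assoc matrix_mul_lid matrix_mul_rid)
  from arg_cong[OF this, of "\<lambda>A. A $ j $ i"] show ?thesis by (simp add: up_def transpose_def)
qed

text \<open>By Cramer's rule an entry of the inverse matrix is a quotient of determinants with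
  smooth entries.\<close>

lemma smooth_up: "smooth_on U (up i j)"
proof (rule smooth_on_cong[OF open_U])
  show "smooth_on U (\<lambda>x. det (\<chi> a b. if b = i then axis j 1 $ a else gram (g x) $ a $ b) / det (gram (g x)))"
  proof (rule smooth_on_divide[OF open_U])
    have "smooth_on U (\<lambda>x. (\<chi> a b. if b = i then axis j 1 $ a else gram (g x) $ a $ b) $ a $ b)" for a b
      by (cases "b = i") (simp_all add: smooth_gram)
    then show "smooth_on U (\<lambda>x. det (\<chi> a b. if b = i then axis j 1 $ a else gram (g x) $ a $ b))"
      by (rule smooth_on_det[OF open_U])
    show "smooth_on U (\<lambda>x. det (gram (g x)))" by (rule smooth_on_det[OF open_U smooth_gram])
  qed (rule det_gram_nz)
  fix x assume x: "x \<in> U"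
  define c where "c = (\<chi> k. up k j x)"
  have "gram (g x) *v c = axis j 1"
    using lo_up[OF x, of _ j] by (simp add: matrix_vector_mult_def c_def lo_def vec_eq_iff axis_def)
  then have "c = (\<chi> k. det (\<chi> a b. if b = k then axis j 1 $ a else gram (g x) $ a $ b) / det (gram (g x)))"
    using cramer[OF det_gram_nz[OF x]] by blast
  then have "c $ i = det (\<chi> a b. if b = i then axis j 1 $ a else gram (g x) $ a $ b) / det (gram (g x))"
    by (metis (no_types, lifting) vec_lambda_beta)
  then show "det (\<chi> a b. if b = i then axis j 1 $ a else gram (g x) $ a $ b) / det (gram (g x)) = up i j x"
    by (simp add: c_def)
qed

lemma christoffel_alt: "\<Gamma> k i j x = (\<Sum>l\<in>UNIV. up k l x * ((partial i (lo j l) x + partial j (lo i l) x - partial l (lo i j) x) / 2))"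
  by (simp add: christoffel_def up_def lo_def[abs_def] sum_divide_distrib)

lemma christoffel_sym: "\<Gamma> k i j = \<Gamma> k j i"
  by (rule ext) (simp add: christoffel_alt lo_sym[of i j] add.commute)

lemma smooth_christoffel: "smooth_on U (\<Gamma> k i j)"
proof -
  have "smooth_on U (\<lambda>x. \<Sum>l\<in>UNIV. up k l x * ((1/2) * (partial i (lo j l) x + partial j (lo i l) x - partial l (lo i j) x)))"
    by (intro smooth_intros smooth_lo smooth_up open_U)
  then show ?thesis by (simp add: christoffel_alt[abs_def])
qed

lemma diffble:
  assumes "x \<in> U"
  shows "lo i j differentiable (at x)" "up i j differentiable (at x)" "\<Gamma> k i j differentiable (at x)"
  using smooth_on_differentiable[OF _ assms] smooth_lo smooth_up smooth_christoffel by blast+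

lemma christoffel_lower:
  assumes x: "x \<in> U"
  shows "(\<Sum>k\<in>UNIV. \<Gamma> k i j x * lo k m x) = (partial i (lo j m) x + partial j (lo i m) x - partial m (lo i j) x) / 2"
proof -
  have "(\<Sum>k\<in>UNIV. \<Gamma> k i j x * lo k m x) =
     (\<Sum>k\<in>UNIV. \<Sum>l\<in>UNIV. (lo m k x * up k l x) * ((partial i (lo j l) x + partial j (lo i l) x - partial l (lo i j) x) / 2))"
    unfolding christoffel_alt sum_distrib_right by (intro sum.cong refl) (simp add: lo_sym[of _ m])
  also have "\<dots> = (\<Sum>l\<in>UNIV. (\<Sum>k\<in>UNIV. lo m k x * up k l x) * ((partial i (lo j l) x + partial j (lo i l) x - partial l (lo i j) x) / 2))"
    by (subst sum.swap) (simp only: sum_distrib_right)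
  finally show ?thesis unfolding lo_up[OF x] by (simp only: sum_delta_mult)
qed

text \<open>Metric compatibility: in the sum of the two lowered symbols all but one derivative of
  the metric cancel.\<close>

lemma partial_lo:
  assumes x: "x \<in> U"
  shows "partial m (lo i j) x = (\<Sum>k\<in>UNIV. \<Gamma> k m i x * lo k j x) + (\<Sum>k\<in>UNIV. \<Gamma> k m j x * lo k i x)"
  unfolding christoffel_lower[OF x] using lo_sym[of i j] lo_sym[of m i] lo_sym[of m j] by (simp add: field_simps)

lemma partial_up:
  assumes x: "x \<in> U"
  shows "partial m (up i l) x = - (\<Sum>k\<in>UNIV. \<Gamma> i m k x * up k l x) - (\<Sum>k\<in>UNIV. \<Gamma> l m k x * up i k x)"
proof -
  \<comment> \<open>The derivative of the matrix identity inverse(g) g = 1; contracting once more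
    with the inverse isolates the derivative of the inverse metric.\<close>
  have z: "(\<Sum>k\<in>UNIV. partial m (up i k) x * lo k j x) = - (\<Sum>k\<in>UNIV. up i k x * partial m (lo k j) x)" for j
  proof -
    have "partial m (\<lambda>y. \<Sum>k\<in>UNIV. up i k y * lo k j y) x = 0"
      by (rule partial_eq_0[OF open_U x up_lo])
    moreover have "partial m (\<lambda>y. \<Sum>k\<in>UNIV. up i k y * lo k j y) x
      = (\<Sum>k\<in>UNIV. partial m (up i k) x * lo k j x + up i k x * partial m (lo k j) x)"
      using diffble[OF x] by (subst partial_sum) (auto simp: partial_mult)
    ultimately show ?thesis by (simp add: sum.distrib)
  qed
  have "partial m (up i l) x = (\<Sum>k\<in>UNIV. partial m (up i k) x * (\<Sum>j\<in>UNIV. lo k j x * up j l x))"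
    unfolding lo_up[OF x] by simp
  also have "\<dots> = (\<Sum>j\<in>UNIV. (\<Sum>k\<in>UNIV. partial m (up i k) x * lo k j x) * up j l x)"
    unfolding sum_distrib_left sum_distrib_right by (subst sum.swap) (simp only: mult.assoc)
  also have "\<dots> = - (\<Sum>j\<in>UNIV. (\<Sum>k\<in>UNIV. up i k x * partial m (lo k j) x) * up j l x)"
    unfolding z by (simp add: sum_negf)
  also have "(\<Sum>j\<in>UNIV. (\<Sum>k\<in>UNIV. up i k x * partial m (lo k j) x) * up j l x)
     = (\<Sum>j\<in>UNIV. \<Sum>k\<in>UNIV. \<Sum>a\<in>UNIV. up i k x * \<Gamma> a m k x * (lo a j x * up j l x))
     + (\<Sum>j\<in>UNIV. \<Sum>k\<in>UNIV. \<Sum>a\<in>UNIV. (up i k x * lo k a x) * \<Gamma> a m j x * up j l x)"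
    unfolding partial_lo[OF x] distrib_left distrib_right sum.distrib sum_distrib_left sum_distrib_right
    by (simp add: mult_ac lo_sym)
  also have "(\<Sum>j\<in>UNIV. \<Sum>k\<in>UNIV. \<Sum>a\<in>UNIV. up i k x * \<Gamma> a m k x * (lo a j x * up j l x))
     = (\<Sum>k\<in>UNIV. \<Sum>a\<in>UNIV. up i k x * \<Gamma> a m k x * (\<Sum>j\<in>UNIV. lo a j x * up j l x))"
    unfolding sum_distrib_left by (subst sum.swap, rule sum.cong[OF refl], rule sum.swap)
  also have "\<dots> = (\<Sum>k\<in>UNIV. \<Gamma> l m k x * up i k x)"
    unfolding lo_up[OF x] by (simp add: mult.commute)
  also have "(\<Sum>j\<in>UNIV. \<Sum>k\<in>UNIV. \<Sum>a\<in>UNIV. (up i k x * lo k a x) * \<Gamma> a m j x * up j l x)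
    = (\<Sum>j\<in>UNIV. \<Sum>a\<in>UNIV. (\<Sum>k\<in>UNIV. up i k x * lo k a x) * (\<Gamma> a m j x * up j l x))"
    unfolding sum_distrib_right by (rule sum.cong[OF refl], subst sum.swap) (simp only: mult.assoc)
  also have "\<dots> = (\<Sum>k\<in>UNIV. \<Gamma> i m k x * up k l x)"
    unfolding up_lo[OF x] by simp
  finally show ?thesis by simp
qed

text \<open>Jacobi's formula: the product rule differentiates one row of the determinant at a
  time.\<close>

lemma partial_det_gram:
  assumes x: "x \<in> U"
  shows "partial m (\<lambda>y. det (gram (g y))) x = det (gram (g x)) * (\<Sum>i\<in>UNIV. \<Sum>j\<in>UNIV. up j i x * partial m (lo i j) x)"
proof -
  let ?S = "{p. p permutes (UNIV :: 'n set)}"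
  have d: "lo i j differentiable (at x)" for i j using diffble[OF x] by blast
  have dp: "(\<lambda>y. \<Prod>i\<in>UNIV. lo i (p i) y) differentiable (at x)" for p :: "'n \<Rightarrow> 'n"
    by (rule smooth_on_differentiable[OF _ x]) (intro smooth_intros smooth_lo open_U)
  have "partial m (\<lambda>y. det (gram (g y))) x = partial m (\<lambda>y. \<Sum>p\<in>?S. of_int (sign p) * (\<Prod>i\<in>UNIV. lo i (p i) y)) x"
    by (simp add: det_def lo_def)
  also have "\<dots> = (\<Sum>p\<in>?S. of_int (sign p) * (\<Sum>i\<in>UNIV. partial m (lo i (p i)) x * (\<Prod>k\<in>UNIV - {i}. lo k (p k) x)))"
    by (subst partial_sum) (auto simp: partial_mult dp partial_prod d)
  also have "\<dots> = (\<Sum>i\<in>UNIV. \<Sum>p\<in>?S. of_int (sign p) * (partial m (lo i (p i)) x * (\<Prod>k\<in>UNIV - {i}. lo k (p k) x)))"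
    unfolding sum_distrib_left by (rule sum.swap)
  also have "\<dots> = (\<Sum>i\<in>UNIV. det (\<chi> r. if r = i then (\<chi> j. partial m (lo i j) x) else row r (gram (g x))))"
  proof (rule sum.cong[OF refl])
    fix i :: 'n
    have "(\<Prod>k\<in>UNIV. (\<chi> r. if r = i then (\<chi> j. partial m (lo i j) x) else row r (gram (g x))) $ k $ p k)
        = partial m (lo i (p i)) x * (\<Prod>k\<in>UNIV - {i}. lo k (p k) x)" for p
      by (subst prod.remove[of _ i]) (auto simp: row_def lo_def intro!: prod.cong)
    then show "(\<Sum>p\<in>?S. of_int (sign p) * (partial m (lo i (p i)) x * (\<Prod>k\<in>UNIV - {i}. lo k (p k) x)))
      = det (\<chi> r. if r = i then (\<chi> j. partial m (lo i j) x) else row r (gram (g x)))"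
      unfolding det_def by simp
  qed
  also have "\<dots> = (\<Sum>i\<in>UNIV. (\<Sum>j\<in>UNIV. up j i x * partial m (lo i j) x) * det (gram (g x)))"
  proof (rule sum.cong[OF refl])
    fix i :: 'n
    \<comment> \<open>Coefficients of the differentiated row in terms of the rows of the Gram
      matrix. Replacing row \<open>i\<close> by this combination multiplies the determinant by the
      coefficient of row \<open>i\<close>.\<close>
    define c where "c = (\<chi> k. \<Sum>j\<in>UNIV. up j k x * partial m (lo i j) x)"
    have "(\<Sum>k\<in>UNIV. c $ k *s row k (gram (g x))) $ b = partial m (lo i b) x" for b
    proof -
      have "(\<Sum>k\<in>UNIV. c $ k *s row k (gram (g x))) $ b = (\<Sum>k\<in>UNIV. \<Sum>j\<in>UNIV. (up j k x * lo k b x) * partial m (lo i j) x)"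
        by (simp add: c_def row_def lo_def sum_distrib_left sum_distrib_right mult_ac)
      also have "\<dots> = (\<Sum>j\<in>UNIV. (\<Sum>k\<in>UNIV. up j k x * lo k b x) * partial m (lo i j) x)"
        unfolding sum_distrib_right by (rule sum.swap)
      finally show ?thesis unfolding up_lo[OF x] by simp
    qed
    then have r: "(\<Sum>k\<in>UNIV. c $ k *s row k (gram (g x))) = (\<chi> j. partial m (lo i j) x)" by (simp add: vec_eq_iff)
    then show "det (\<chi> r. if r = i then (\<chi> j. partial m (lo i j) x) else row r (gram (g x)))
      = (\<Sum>j\<in>UNIV. up j i x * partial m (lo i j) x) * det (gram (g x))"
      using cramer_lemma_transpose[of i c "gram (g x)"] unfolding r by (simp add: c_def)
  qed
  finally show ?thesis unfolding sum_distrib_right[symmetric] by (simp only: mult.commute)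
qed

text \<open>By symmetry the first and third terms of the symbol cancel in the trace; the rest is
  half the logarithmic derivative of the determinant.\<close>

lemma christoffel_trace:
  assumes x: "x \<in> U"
  shows "(\<Sum>k\<in>UNIV. \<Gamma> k k m x) = (\<Sum>i\<in>UNIV. \<Sum>j\<in>UNIV. up j i x * partial m (lo i j) x) / 2"
proof -
  have "(\<Sum>k\<in>UNIV. \<Gamma> k k m x) = (\<Sum>k\<in>UNIV. \<Sum>l\<in>UNIV. up k l x * (partial k (lo m l) x / 2))
     + (\<Sum>k\<in>UNIV. \<Sum>l\<in>UNIV. up k l x * (partial m (lo k l) x / 2)) - (\<Sum>k\<in>UNIV. \<Sum>l\<in>UNIV. up k l x * (partial l (lo k m) x / 2))"
    unfolding christoffel_alt
    by (simp add: add_divide_distrib diff_divide_distrib right_diff_distrib distrib_left sum.distrib sum_subtractf)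
  also have "(\<Sum>k\<in>UNIV. \<Sum>l\<in>UNIV. up k l x * (partial l (lo k m) x / 2)) = (\<Sum>k\<in>UNIV. \<Sum>l\<in>UNIV. up k l x * (partial k (lo m l) x / 2))"
    by (subst sum.swap) (simp add: up_sym[OF x] lo_sym)
  finally show ?thesis
    by (simp add: sum_divide_distrib up_sym[OF x])
qed

section \<open>Curvature and second covariant derivatives\<close>

lemma first_bianchi: "riemann g p a n m x + riemann g p n m a x + riemann g p m a n x = 0"
  \<comment> \<open>Once the lower indices of the Christoffel symbols are ordered, the terms of the
    cyclic sum cancel in pairs.\<close>
  unfolding riemann_def christoffel_sym[of _ m a] christoffel_sym[of _ n m] christoffel_sym[of _ n a]
  by (simp add: sum_subtractf sum.distrib algebra_simps)

lemma riemann_skew: "riemann g p a n m x = - riemann g p a m n x"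
  unfolding riemann_def by (simp add: sum_subtractf)

text \<open>\<open>m\<close> is the direction of differentiation. \<open>cov4\<close> treats it as a
  further tensor slot, so \<open>cov4 (cov3 f) n m\<close> is the second covariant derivative with
  outer direction \<open>n\<close>.\<close>

definition cov3 :: "('n \<Rightarrow> 'n \<Rightarrow> 'n \<Rightarrow> real ^ 'n \<Rightarrow> real) \<Rightarrow> 'n \<Rightarrow> 'n \<Rightarrow> 'n \<Rightarrow> 'n \<Rightarrow> real ^ 'n \<Rightarrow> real" where
  "cov3 f m a b c x = partial m (f a b c) x - (\<Sum>k\<in>UNIV. \<Gamma> k m a x * f k b c x)
     - (\<Sum>k\<in>UNIV. \<Gamma> k m b x * f a k c x) - (\<Sum>k\<in>UNIV. \<Gamma> k m c x * f a b k x)"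

definition cov4 :: "('n \<Rightarrow> 'n \<Rightarrow> 'n \<Rightarrow> 'n \<Rightarrow> real ^ 'n \<Rightarrow> real) \<Rightarrow> 'n \<Rightarrow> 'n \<Rightarrow> 'n \<Rightarrow> 'n \<Rightarrow> 'n \<Rightarrow> real ^ 'n \<Rightarrow> real" where
  "cov4 P n m a b c x = partial n (P m a b c) x - (\<Sum>k\<in>UNIV. \<Gamma> k n m x * P k a b c x) - (\<Sum>k\<in>UNIV. \<Gamma> k n a x * P m k b c x)
     - (\<Sum>k\<in>UNIV. \<Gamma> k n b x * P m a k c x) - (\<Sum>k\<in>UNIV. \<Gamma> k n c x * P m a b k x)"

lemma smooth_cov3: "(\<And>a b c. smooth_on U (f a b c)) \<Longrightarrow> smooth_on U (cov3 f m a b c)"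
  unfolding cov3_def[abs_def] by (intro smooth_intros smooth_christoffel open_U)

lemma partial_christoffel_sum:
  assumes "x \<in> U" "\<And>k. h k differentiable (at x)"
  shows "partial n (\<lambda>y. \<Sum>k\<in>UNIV. \<Gamma> k m a y * h k y) x
     = (\<Sum>k\<in>UNIV. partial n (\<Gamma> k m a) x * h k x) + (\<Sum>k\<in>UNIV. \<Gamma> k m a x * partial n (h k) x)"
  using assms diffble(3)[OF assms(1)] by (subst partial_sum) (auto simp: partial_mult sum.distrib)

text \<open>The mixed terms, in which the two connection matrices act on different slots, are symmetric in
  the two directions of differentiation and drop out of the commutator.\<close>

lemma ricci_identity:
  assumes x: "x \<in> U" and f: "\<And>a b c. smooth_on U (f a b c)"
  shows "cov4 (cov3 f) n m a b c x - cov4 (cov3 f) m n a b c x =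
    - (\<Sum>p\<in>UNIV. riemann g p a n m x * f p b c x) - (\<Sum>p\<in>UNIV. riemann g p b n m x * f a p c x)
    - (\<Sum>p\<in>UNIV. riemann g p c n m x * f a b p x)"
proof -
  have df: "f a b c differentiable (at x)" for a b c by (rule smooth_on_differentiable[OF f x])
  have dp: "partial m (f a b c) differentiable (at x)" for m a b c
    by (rule smooth_on_differentiable[OF smooth_on_partial[OF f] x])
  have ds: "(\<lambda>y. \<Sum>k\<in>UNIV. \<Gamma> k m a y * h k y) differentiable (at x)" if "\<And>k. smooth_on U (h k)" for m a h
    by (rule smooth_on_differentiable[OF _ x]) (intro smooth_intros smooth_christoffel that open_U)
  define Q where "Q n a u = (\<Sum>k\<in>UNIV. \<Gamma> k n a x * u k)" for n a u
  define X where "X n m a u = (\<Sum>k\<in>UNIV. partial n (\<Gamma> k m a) x * u k)" for n m a u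
  define P where "P m a b c = partial m (f a b c) x - Q m a (\<lambda>k. f k b c x) - Q m b (\<lambda>k. f a k c x) - Q m c (\<lambda>k. f a b k x)" for m a b c
  have Pc: "cov3 f m a b c x = P m a b c" for m a b c by (simp add: cov3_def P_def Q_def)
  have dP: "partial n (cov3 f m a b c) x = partial n (partial m (f a b c)) x
     - (X n m a (\<lambda>k. f k b c x) + Q m a (\<lambda>k. partial n (f k b c) x))
     - (X n m b (\<lambda>k. f a k c x) + Q m b (\<lambda>k. partial n (f a k c) x))
     - (X n m c (\<lambda>k. f a b k x) + Q m c (\<lambda>k. partial n (f a b k) x))" for n m a b c
  proof -
    have "partial n (cov3 f m a b c) x = partial n (partial m (f a b c)) x
      - partial n (\<lambda>y. \<Sum>k\<in>UNIV. \<Gamma> k m a y * f k b c y) x - partial n (\<lambda>y. \<Sum>k\<in>UNIV. \<Gamma> k m b y * f a k c y) x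
      - partial n (\<lambda>y. \<Sum>k\<in>UNIV. \<Gamma> k m c y * f a b k y) x"
      unfolding cov3_def[abs_def] by (simp add: partial_diff differentiable_diff dp ds f)
    then show ?thesis by (simp add: partial_christoffel_sum[OF x df] X_def Q_def)
  qed
  have Qdiff: "Q n a (\<lambda>k. u k - v k) = Q n a u - Q n a v" for n a u v
    by (simp add: Q_def right_diff_distrib sum_subtractf)
  have Qswap: "Q n b (\<lambda>k. Q m a (\<lambda>l. h l k)) = Q m a (\<lambda>l. Q n b (\<lambda>k. h l k))" for n b m a h
    unfolding Q_def sum_distrib_left by (subst sum.swap) (simp add: mult.left_commute)
  have R: "(\<Sum>p\<in>UNIV. riemann g p a n m x * u p) = X n m a u - X m n a u
      + Q m a (\<lambda>k. Q n k u) - Q n a (\<lambda>k. Q m k u)" for a n m u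
  proof -
    have z: "Q m a (\<lambda>k. Q n k u) = (\<Sum>p\<in>UNIV. (\<Sum>k\<in>UNIV. \<Gamma> p n k x * \<Gamma> k m a x) * u p)" for n m
      unfolding Q_def sum_distrib_left sum_distrib_right by (subst sum.swap) (simp add: mult_ac)
    show ?thesis unfolding z X_def riemann_def
      by (simp add: algebra_simps sum.distrib sum_subtractf)
  qed
  have sym: "partial n (partial m (f a b c)) x = partial m (partial n (f a b c)) x"
    by (rule partial_commute[OF open_U x f])
  have H: "cov4 (cov3 f) n m a b c x = partial n (cov3 f m a b c) x - (\<Sum>k\<in>UNIV. \<Gamma> k n m x * P k a b c)
     - Q n a (\<lambda>k. P m k b c) - Q n b (\<lambda>k. P m a k c) - Q n c (\<lambda>k. P m a b k)" for n m
    by (simp add: cov4_def Pc Q_def)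
  have G: "(\<Sum>k\<in>UNIV. \<Gamma> k n m x * P k a b c) = (\<Sum>k\<in>UNIV. \<Gamma> k m n x * P k a b c)"
    by (simp add: christoffel_sym[of _ n m])
  show ?thesis
    unfolding H dP R G sym unfolding P_def Qdiff
    using Qswap[of n b m a "\<lambda>l k. f l k c x"] Qswap[of m b n a "\<lambda>l k. f l k c x"]
      Qswap[of n c m a "\<lambda>l k. f l b k x"] Qswap[of m c n a "\<lambda>l k. f l b k x"]
      Qswap[of n c m b "\<lambda>l k. f a l k x"] Qswap[of m c n b "\<lambda>l k. f a l k x"]
    by linarith
qed

end

section \<open>Raising indices and connection terms\<close>

lemma sum3_rot:
  fixes h :: "'n::finite \<Rightarrow> 'n \<Rightarrow> 'n \<Rightarrow> real"
  shows "(\<Sum>m\<in>UNIV. \<Sum>a\<in>UNIV. \<Sum>b\<in>UNIV. h m a b) = (\<Sum>a\<in>UNIV. \<Sum>b\<in>UNIV. \<Sum>m\<in>UNIV. h m a b)"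
  by (subst sum.swap, rule sum.cong[OF refl], rule sum.swap)

lemma sum4_out:
  fixes h :: "'n::finite \<Rightarrow> 'n \<Rightarrow> 'n \<Rightarrow> 'n \<Rightarrow> real"
  shows "(\<Sum>m\<in>UNIV. \<Sum>a\<in>UNIV. \<Sum>b\<in>UNIV. \<Sum>k\<in>UNIV. h m a b k) = (\<Sum>k\<in>UNIV. \<Sum>m\<in>UNIV. \<Sum>a\<in>UNIV. \<Sum>b\<in>UNIV. h m a b k)"
proof -
  have "(\<Sum>m\<in>UNIV. \<Sum>a\<in>UNIV. \<Sum>b\<in>UNIV. \<Sum>k\<in>UNIV. h m a b k) = (\<Sum>m\<in>UNIV. \<Sum>k\<in>UNIV. \<Sum>a\<in>UNIV. \<Sum>b\<in>UNIV. h m a b k)"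
    by (intro sum.cong refl sum3_rot[symmetric])
  also have "\<dots> = (\<Sum>k\<in>UNIV. \<Sum>m\<in>UNIV. \<Sum>a\<in>UNIV. \<Sum>b\<in>UNIV. h m a b k)" by (rule sum.swap)
  finally show ?thesis .
qed

context metric_chart
begin

definition raise :: "'n \<Rightarrow> ('n \<Rightarrow> real) \<Rightarrow> real ^ 'n \<Rightarrow> real" where
  "raise a u x = (\<Sum>i\<in>UNIV. up a i x * u i)"

text \<open>The connection term of one slot: covariant differentiation subtracts
  \<open>con_lo\<close> for a lower index and adds \<open>con_up\<close> for an upper one.\<close>

definition con_lo :: "'n \<Rightarrow> 'n \<Rightarrow> ('n \<Rightarrow> real) \<Rightarrow> real ^ 'n \<Rightarrow> real" where
  "con_lo m a u x = (\<Sum>k\<in>UNIV. \<Gamma> k m a x * u k)"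

definition con_up :: "'n \<Rightarrow> 'n \<Rightarrow> ('n \<Rightarrow> real) \<Rightarrow> real ^ 'n \<Rightarrow> real" where
  "con_up m a u x = (\<Sum>k\<in>UNIV. \<Gamma> a m k x * u k)"

definition raise3 :: "('n \<Rightarrow> 'n \<Rightarrow> 'n \<Rightarrow> real ^ 'n \<Rightarrow> real) \<Rightarrow> 'n \<Rightarrow> 'n \<Rightarrow> 'n \<Rightarrow> real ^ 'n \<Rightarrow> real" where
  "raise3 f a b c x = raise a (\<lambda>i. raise b (\<lambda>j. raise c (\<lambda>k. f i j k x) x) x) x"

lemma raise_diff: "raise a (\<lambda>i. u i - v i) x = raise a u x - raise a v x"
  by (simp add: raise_def right_diff_distrib sum_subtractf)

lemma raise_add: "raise a (\<lambda>i. u i + v i) x = raise a u x + raise a v x"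
  by (simp add: raise_def distrib_left sum.distrib)

lemma raise_minus: "raise a (\<lambda>i. - u i) x = - raise a u x"
  by (simp add: raise_def sum_negf)

lemma raise_raise: "raise a (\<lambda>i. raise b (\<lambda>j. h i j) x) x = raise b (\<lambda>j. raise a (\<lambda>i. h i j) x) x"
  unfolding raise_def sum_distrib_left by (subst sum.swap) (simp add: mult.left_commute)

lemma raise_rot: "raise a (\<lambda>i. raise b (\<lambda>j. raise c (\<lambda>k. h i j k) x) x) x
    = raise c (\<lambda>k. raise a (\<lambda>i. raise b (\<lambda>j. h i j k) x) x) x"
  by (subst raise_raise[where a = b and b = c], subst raise_raise[where a = a and b = c], rule refl)

lemma raise_rev: "raise a (\<lambda>i. raise b (\<lambda>j. raise c (\<lambda>k. h i j k) x) x) x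
    = raise c (\<lambda>k. raise b (\<lambda>j. raise a (\<lambda>i. h i j k) x) x) x"
  by (subst raise_rot, subst raise_raise[where a = a], rule refl)

lemma raise_con_lo: "raise a (\<lambda>i. con_lo m b (\<lambda>j. h i j) x) x = con_lo m b (\<lambda>j. raise a (\<lambda>i. h i j) x) x"
  unfolding raise_def con_lo_def sum_distrib_left by (subst sum.swap) (simp add: mult.left_commute)

lemma raise_con_up: "raise a (\<lambda>i. con_up m b (\<lambda>j. h i j) x) x = con_up m b (\<lambda>j. raise a (\<lambda>i. h i j) x) x"
  unfolding raise_def con_up_def sum_distrib_left by (subst sum.swap) (simp add: mult.left_commute)

lemma raise_sum: "raise a (\<lambda>i. \<Sum>k\<in>K. h k i) x = (\<Sum>k\<in>K. raise a (h k) x)"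
  unfolding raise_def sum_distrib_left by (rule sum.swap)

lemma raise_adjoint:
  assumes "x \<in> U" shows "(\<Sum>a\<in>UNIV. w a * raise a u x) = (\<Sum>a\<in>UNIV. raise a w x * u a)"
  unfolding raise_def sum_distrib_left sum_distrib_right
  by (subst sum.swap) (simp add: up_sym[OF assms] mult_ac)

lemma contract_con: "(\<Sum>a\<in>UNIV. con_lo m a u x * w a) = (\<Sum>a\<in>UNIV. u a * con_up m a w x)"
  unfolding con_lo_def con_up_def sum_distrib_left sum_distrib_right
  by (subst sum.swap) (simp add: mult_ac)

lemma cov3_eq: "cov3 f m a b c x = partial m (f a b c) x - con_lo m a (\<lambda>k. f k b c x) x
     - con_lo m b (\<lambda>k. f a k c x) x - con_lo m c (\<lambda>k. f a b k x) x"
  by (simp add: cov3_def con_lo_def)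

lemma cov4_eq: "cov4 P n m a b c x = partial n (P m a b c) x - con_lo n m (\<lambda>k. P k a b c x) x - con_lo n a (\<lambda>k. P m k b c x) x
     - con_lo n b (\<lambda>k. P m a k c x) x - con_lo n c (\<lambda>k. P m a b k x) x"
  by (simp add: cov4_def con_lo_def)

lemma smooth_raise: "(\<And>i. smooth_on U (u i)) \<Longrightarrow> smooth_on U (\<lambda>y. raise a (\<lambda>i. u i y) y)"
  unfolding raise_def by (intro smooth_intros smooth_up open_U)

lemma smooth_raise3: "(\<And>a b c. smooth_on U (f a b c)) \<Longrightarrow> smooth_on U (raise3 f a b c)"
  unfolding raise3_def[abs_def] by (intro smooth_raise)

text \<open>Raising commutes with covariant differentiation, because \<open>partial_up\<close> says
  that the inverse metric is parallel.\<close>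

lemma partial_raise:
  assumes x: "x \<in> U" and u: "\<And>i. smooth_on U (u i)"
  shows "partial m (\<lambda>y. raise a (\<lambda>i. u i y) y) x
    = raise a (\<lambda>i. partial m (u i) x - con_lo m i (\<lambda>k. u k x) x) x - con_up m a (\<lambda>k. raise k (\<lambda>i. u i x) x) x"
proof -
  have du: "u i differentiable (at x)" for i by (rule smooth_on_differentiable[OF u x])
  have "partial m (\<lambda>y. raise a (\<lambda>i. u i y) y) x = (\<Sum>i\<in>UNIV. partial m (up a i) x * u i x + up a i x * partial m (u i) x)"
    unfolding raise_def using du diffble[OF x] by (subst partial_sum) (auto simp: partial_mult)
  also have "\<dots> = (\<Sum>i\<in>UNIV. up a i x * partial m (u i) x) - (\<Sum>i\<in>UNIV. \<Sum>k\<in>UNIV. \<Gamma> a m k x * up k i x * u i x)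
      - (\<Sum>i\<in>UNIV. \<Sum>k\<in>UNIV. \<Gamma> i m k x * up a k x * u i x)"
    unfolding partial_up[OF x] by (simp add: left_diff_distrib sum.distrib sum_subtractf sum_negf sum_distrib_right)
  also have "(\<Sum>i\<in>UNIV. \<Sum>k\<in>UNIV. \<Gamma> a m k x * up k i x * u i x) = con_up m a (\<lambda>k. raise k (\<lambda>i. u i x) x) x"
    unfolding con_up_def raise_def sum_distrib_left by (subst sum.swap) (simp only: mult.assoc)
  also have "(\<Sum>i\<in>UNIV. \<Sum>k\<in>UNIV. \<Gamma> i m k x * up a k x * u i x) = raise a (\<lambda>i. con_lo m i (\<lambda>k. u k x) x) x"
    unfolding con_lo_def raise_def sum_distrib_left by (subst sum.swap) (simp only: mult_ac)
  finally show ?thesis by (simp add: raise_diff) (simp add: raise_def)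
qed

lemma partial_raise3:
  assumes x: "x \<in> U" and f: "\<And>a b c. smooth_on U (f a b c)"
  shows "partial m (raise3 f a b c) x = raise3 (cov3 f m) a b c x - con_up m a (\<lambda>k. raise3 f k b c x) x
    - con_up m b (\<lambda>k. raise3 f a k c x) x - con_up m c (\<lambda>k. raise3 f a b k x) x"
proof -
  have r1: "smooth_on U (\<lambda>y. raise c (\<lambda>k. f i j k y) y)" for i j by (intro smooth_raise f)
  have r2: "smooth_on U (\<lambda>y. raise b (\<lambda>j. raise c (\<lambda>k. f i j k y) y) y)" for i by (intro smooth_raise f)
  show ?thesis
    unfolding raise3_def[abs_def] partial_raise[OF x r2] partial_raise[OF x r1] partial_raise[OF x f] cov3_eq
    by (simp only: raise_diff raise_add raise_con_lo raise_con_up diff_diff_eq add_ac)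
qed

end

text \<open>What the tensor calculus takes from the geometry, for any index type. In
  \<open>f_contract\<close> one index is up and one is down, so the right-hand side is constant and
  can be differentiated. \<open>V\<close> is a smooth square root of det g, of either sign.\<close>

locale closed_g2_chart = metric_chart U g for U :: "(real ^ 'n::finite) set" and g +
  fixes f :: "'n \<Rightarrow> 'n \<Rightarrow> 'n \<Rightarrow> real ^ 'n \<Rightarrow> real" and V :: "real ^ 'n \<Rightarrow> real"
  assumes smooth_f: "\<And>a b c. smooth_on U (f a b c)"
    and f_swap: "\<And>a b c x. f b a c x = - f a b c x" "\<And>a b c x. f a c b x = - f a b c x"
    and f_contract: "\<And>x i j. x \<in> U \<Longrightarrow> (\<Sum>a\<in>UNIV. \<Sum>b\<in>UNIV. f i a b x * raise3 f j a b x) = (if i = j then 6 else 0)"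
    and f_closed: "\<And>x m a b c. x \<in> U \<Longrightarrow>
      partial m (f a b c) x - partial a (f m b c) x + partial b (f m a c) x - partial c (f m a b) x = 0"
    and V_smooth: "smooth_on U V"
    and V_nz: "\<And>x. x \<in> U \<Longrightarrow> V x \<noteq> 0"
    and V_det: "\<And>x. x \<in> U \<Longrightarrow> (V x)\<^sup>2 = det (gram (g x))"
begin

abbreviation "F \<equiv> raise3 f"
abbreviation "P \<equiv> cov3 f"
abbreviation "PF m \<equiv> raise3 (cov3 f m)"

section \<open>First-order identities for the covariant derivative of the 3-form\<close>

lemma f_swap_fun: "f b a c = (\<lambda>x. - f a b c x)" "f a c b = (\<lambda>x. - f a b c x)"
  by (rule ext, rule f_swap)+

lemma diffble_f: "x \<in> U \<Longrightarrow> f a b c differentiable (at x)"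
  by (rule smooth_on_differentiable[OF smooth_f])

lemma P_swap: assumes x: "x \<in> U" shows "P m b a c x = - P m a b c x" "P m a c b x = - P m a b c x"
proof -
  have n: "con_lo m d (\<lambda>k. - u k) x = - con_lo m d u x" for d u by (simp add: con_lo_def sum_negf)
  show "P m b a c x = - P m a b c x"
    unfolding cov3_eq f_swap_fun(1)[of b a c] f_swap(1)[of b _ c] f_swap(1)[of _ a c] f_swap(1)[of b a]
    by (simp add: n partial_minus diffble_f[OF x])
  show "P m a c b x = - P m a b c x"
    unfolding cov3_eq f_swap_fun(2)[of a c b] f_swap(2)[of a c] f_swap(2)[of a _ b] f_swap(2)[of _ c b]
    by (simp add: n partial_minus diffble_f[OF x])
qed

lemma raise3_swap:
  assumes "\<And>a b c. h b a c x = - h a b c x" "\<And>a b c. h a c b x = - h a b c x"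
  shows "raise3 h b a c x = - raise3 h a b c x" "raise3 h a c b x = - raise3 h a b c x"
proof -
  show "raise3 h b a c x = - raise3 h a b c x"
    unfolding raise3_def by (subst raise_raise) (subst assms(1), simp only: raise_minus)
  show "raise3 h a c b x = - raise3 h a b c x"
    unfolding raise3_def by (subst (2) raise_raise) (subst assms(2), simp only: raise_minus)
qed

lemmas F_swap = raise3_swap[of f, OF f_swap]
lemmas PF_swap = raise3_swap[of "P m" for m, OF P_swap]

lemma smooth_P: "smooth_on U (P m a b c)"
  by (rule smooth_cov3[OF smooth_f])

lemma smooth_F: "smooth_on U (F a b c)"
  by (rule smooth_raise3[OF smooth_f])

lemma diffble_F: "x \<in> U \<Longrightarrow> F a b c differentiable (at x)"
  by (rule smooth_on_differentiable[OF smooth_F])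

lemma diffble_P: "x \<in> U \<Longrightarrow> P m a b c differentiable (at x)"
  by (rule smooth_on_differentiable[OF smooth_P])

text \<open>The connection is torsion-free: connection terms cancel in the alternating sum, and
  partial derivatives may be replaced by covariant ones.\<close>

lemma P_closed: assumes x: "x \<in> U" shows "P m a b c x - P a m b c x + P b m a c x - P c m a b x = 0"
proof -
  have s: "con_lo i j u x = con_lo j i u x" for i j u
    by (simp add: con_lo_def christoffel_sym[of _ i j])
  have n: "con_lo i j (\<lambda>k. - u k) x = - con_lo i j u x" for i j u by (simp add: con_lo_def sum_negf)
  have e1: "con_lo i j (\<lambda>k. f c k d x) x = - con_lo i j (\<lambda>k. f k c d x) x" for i j c d
    by (subst f_swap(1)) (simp add: n)
  have e2: "con_lo i j (\<lambda>k. f c d k x) x = con_lo i j (\<lambda>k. f k c d x) x" for i j c d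
  proof -
    have "f c d k x = f k c d x" for k using f_swap(2)[of c k d x] f_swap(1)[of c k d x] by simp
    then show ?thesis by simp
  qed
  have e3: "con_lo i j (\<lambda>k. f k d c x) x = - con_lo i j (\<lambda>k. f k c d x) x" for i j c d
    by (subst f_swap(2)) (simp add: n)
  show ?thesis
    using f_closed[OF x, of m a b c] unfolding cov3_eq e1 e2 
    unfolding s[of a m] s[of b m] s[of c m] s[of b a] s[of c a] s[of c b]
    using e3[of m a c b] e3[of m b c a] e3[of m c b a] e3[of a b c m] e3[of a c b m] e3[of b c a m]
      e3[of b a c m] e3[of c a b m] e3[of c b a m] by linarith
qed

lemma raise3_adjoint:
  assumes x: "x \<in> U"
  shows "(\<Sum>i\<in>UNIV. \<Sum>a\<in>UNIV. \<Sum>b\<in>UNIV. h i a b x * raise3 k i a b x)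
       = (\<Sum>i\<in>UNIV. \<Sum>a\<in>UNIV. \<Sum>b\<in>UNIV. raise3 h i a b x * k i a b x)"
proof -
  note adj = raise_adjoint[OF x]
  have "(\<Sum>i\<in>UNIV. \<Sum>a\<in>UNIV. \<Sum>b\<in>UNIV. h i a b x * raise3 k i a b x)
    = (\<Sum>a\<in>UNIV. \<Sum>b\<in>UNIV. \<Sum>i\<in>UNIV. h i a b x * raise3 k i a b x)"
    by (rule sum3_rot)
  also have "\<dots> = (\<Sum>a\<in>UNIV. \<Sum>b\<in>UNIV. \<Sum>i\<in>UNIV. raise i (\<lambda>i. h i a b x) x * raise a (\<lambda>j. raise b (\<lambda>l. k i j l x) x) x)"
    unfolding raise3_def adj ..
  also have "\<dots> = (\<Sum>i\<in>UNIV. \<Sum>b\<in>UNIV. \<Sum>a\<in>UNIV. raise i (\<lambda>i. h i a b x) x * raise a (\<lambda>j. raise b (\<lambda>l. k i j l x) x) x)"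
    by (subst sum3_rot[symmetric], rule sum.cong[OF refl], rule sum.swap)
  also have "\<dots> = (\<Sum>i\<in>UNIV. \<Sum>b\<in>UNIV. \<Sum>a\<in>UNIV. raise a (\<lambda>a. raise i (\<lambda>i. h i a b x) x) x * raise b (\<lambda>l. k i a l x) x)"
    unfolding adj ..
  also have "\<dots> = (\<Sum>i\<in>UNIV. \<Sum>a\<in>UNIV. \<Sum>b\<in>UNIV. raise a (\<lambda>a. raise i (\<lambda>i. h i a b x) x) x * raise b (\<lambda>l. k i a l x) x)"
    by (rule sum.cong[OF refl], rule sum.swap)
  also have "\<dots> = (\<Sum>i\<in>UNIV. \<Sum>a\<in>UNIV. \<Sum>b\<in>UNIV. raise b (\<lambda>b. raise a (\<lambda>a. raise i (\<lambda>i. h i a b x) x) x) x * k i a b x)"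
    unfolding adj ..
  also have "\<dots> = (\<Sum>i\<in>UNIV. \<Sum>a\<in>UNIV. \<Sum>b\<in>UNIV. raise3 h i a b x * k i a b x)"
    unfolding raise3_def by (intro sum.cong refl arg_cong2[where f = "(*)"] raise_rev)
  finally show ?thesis .
qed

text \<open>The derivative of a full contraction of the last two slots: the connection terms of these slots
  cancel.\<close>

lemma contract2_con:
  "(\<Sum>a\<in>UNIV. \<Sum>b\<in>UNIV. con_lo m a (\<lambda>k. u k b) x * w a b) = (\<Sum>a\<in>UNIV. \<Sum>b\<in>UNIV. u a b * con_up m a (\<lambda>k. w k b) x)"
  "(\<Sum>a\<in>UNIV. \<Sum>b\<in>UNIV. con_lo m b (\<lambda>k. u a k) x * w a b) = (\<Sum>a\<in>UNIV. \<Sum>b\<in>UNIV. u a b * con_up m b (\<lambda>k. w a k) x)"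
proof -
  show "(\<Sum>a\<in>UNIV. \<Sum>b\<in>UNIV. con_lo m a (\<lambda>k. u k b) x * w a b) = (\<Sum>a\<in>UNIV. \<Sum>b\<in>UNIV. u a b * con_up m a (\<lambda>k. w k b) x)"
    by (subst (1 2) sum.swap) (simp only: contract_con[of m "\<lambda>k. u k _" x "\<lambda>a. w a _"])
  show "(\<Sum>a\<in>UNIV. \<Sum>b\<in>UNIV. con_lo m b (\<lambda>k. u a k) x * w a b) = (\<Sum>a\<in>UNIV. \<Sum>b\<in>UNIV. u a b * con_up m b (\<lambda>k. w a k) x)"
    by (simp only: contract_con)
qed

lemma partial_contract2:
  fixes u w :: "'n \<Rightarrow> 'n \<Rightarrow> real ^ 'n \<Rightarrow> real"
  assumes x: "x \<in> U" and "\<And>a b. u a b differentiable (at x)" "\<And>a b. w a b differentiable (at x)"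
  shows "partial m (\<lambda>y. \<Sum>a\<in>UNIV. \<Sum>b\<in>UNIV. u a b y * w a b y) x =
    (\<Sum>a\<in>UNIV. \<Sum>b\<in>UNIV. partial m (u a b) x * w a b x) + (\<Sum>a\<in>UNIV. \<Sum>b\<in>UNIV. u a b x * partial m (w a b) x)"
proof -
  have "(\<lambda>y. \<Sum>b\<in>UNIV. u a b y * w a b y) differentiable (at x)" for a
    using assms(2,3) by (intro differentiable_sum differentiable_mult) auto
  then show ?thesis using assms(2,3) by (simp add: partial_sum partial_mult sum.distrib)
qed

lemma f_contract_derivative:
  assumes x: "x \<in> U"
  shows "(\<Sum>a\<in>UNIV. \<Sum>b\<in>UNIV. P m i a b x * F j a b x) + (\<Sum>a\<in>UNIV. \<Sum>b\<in>UNIV. f i a b x * PF m j a b x) = 0"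
proof -
  have 0: "partial m (\<lambda>y. \<Sum>a\<in>UNIV. \<Sum>b\<in>UNIV. f i a b y * F j a b y) x = 0"
    by (rule partial_eq_0[OF open_U x f_contract])
  have pf: "partial m (f i a b) x = P m i a b x + con_lo m i (\<lambda>k. f k a b x) x
     + con_lo m a (\<lambda>k. f i k b x) x + con_lo m b (\<lambda>k. f i a k x) x" for a b
    by (simp add: cov3_eq)
  have 1: "(\<Sum>a\<in>UNIV. \<Sum>b\<in>UNIV. partial m (f i a b) x * F j a b x) = (\<Sum>a\<in>UNIV. \<Sum>b\<in>UNIV. P m i a b x * F j a b x)
     + (\<Sum>a\<in>UNIV. \<Sum>b\<in>UNIV. con_lo m i (\<lambda>k. f k a b x) x * F j a b x)
     + (\<Sum>a\<in>UNIV. \<Sum>b\<in>UNIV. f i a b x * con_up m a (\<lambda>k. F j k b x) x)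
     + (\<Sum>a\<in>UNIV. \<Sum>b\<in>UNIV. f i a b x * con_up m b (\<lambda>k. F j a k x) x)"
    unfolding pf distrib_right sum.distrib contract2_con ..
  have 2: "(\<Sum>a\<in>UNIV. \<Sum>b\<in>UNIV. f i a b x * partial m (F j a b) x) = (\<Sum>a\<in>UNIV. \<Sum>b\<in>UNIV. f i a b x * PF m j a b x)
     - (\<Sum>a\<in>UNIV. \<Sum>b\<in>UNIV. f i a b x * con_up m j (\<lambda>k. F k a b x) x)
     - (\<Sum>a\<in>UNIV. \<Sum>b\<in>UNIV. f i a b x * con_up m a (\<lambda>k. F j k b x) x)
     - (\<Sum>a\<in>UNIV. \<Sum>b\<in>UNIV. f i a b x * con_up m b (\<lambda>k. F j a k x) x)"
    unfolding partial_raise3[OF x smooth_f] right_diff_distrib sum_subtractf ..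
  \<comment> \<open>By the contraction identity itself, the connection terms of the free slots
    \<open>i\<close> and \<open>j\<close> both become 6 times the same Christoffel symbol; they
    cancel.\<close>
  have 3: "(\<Sum>a\<in>UNIV. \<Sum>b\<in>UNIV. con_lo m i (\<lambda>k. f k a b x) x * F j a b x) = 6 * \<Gamma> j m i x"
  proof -
    have "(\<Sum>a\<in>UNIV. \<Sum>b\<in>UNIV. con_lo m i (\<lambda>k. f k a b x) x * F j a b x)
      = (\<Sum>a\<in>UNIV. \<Sum>k\<in>UNIV. \<Sum>b\<in>UNIV. \<Gamma> k m i x * (f k a b x * F j a b x))"
      unfolding con_lo_def sum_distrib_right mult.assoc by (intro sum.cong refl sum.swap)
    also have "\<dots> = (\<Sum>k\<in>UNIV. \<Gamma> k m i x * (\<Sum>a\<in>UNIV. \<Sum>b\<in>UNIV. f k a b x * F j a b x))"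
      unfolding sum_distrib_left by (rule sum.swap)
    finally show ?thesis unfolding f_contract[OF x] by (simp add: if_distrib cong: if_cong)
  qed
  have 4: "(\<Sum>a\<in>UNIV. \<Sum>b\<in>UNIV. f i a b x * con_up m j (\<lambda>k. F k a b x) x) = 6 * \<Gamma> j m i x"
  proof -
    have "(\<Sum>a\<in>UNIV. \<Sum>b\<in>UNIV. f i a b x * con_up m j (\<lambda>k. F k a b x) x)
      = (\<Sum>a\<in>UNIV. \<Sum>k\<in>UNIV. \<Sum>b\<in>UNIV. \<Gamma> j m k x * (f i a b x * F k a b x))"
      unfolding con_up_def sum_distrib_left mult.left_commute[of "f i _ _ x"] by (intro sum.cong refl sum.swap)
    also have "\<dots> = (\<Sum>k\<in>UNIV. \<Gamma> j m k x * (\<Sum>a\<in>UNIV. \<Sum>b\<in>UNIV. f i a b x * F k a b x))"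
      unfolding sum_distrib_left by (rule sum.swap)
    finally show ?thesis unfolding f_contract[OF x] by (simp add: if_distrib cong: if_cong)
  qed
  show ?thesis
    using 0 unfolding partial_contract2[OF x diffble_f[OF x] diffble_F[OF x]] 1 2 3 4 by linarith
qed

text \<open>The trace of the preceding identity. Its two sums agree by moving indices, so each
  vanishes: the norm of the 3-form is constant.\<close>

lemma F_P_norm: assumes x: "x \<in> U" shows "(\<Sum>i\<in>UNIV. \<Sum>a\<in>UNIV. \<Sum>b\<in>UNIV. P m i a b x * F i a b x) = 0"
proof -
  have "(\<Sum>i\<in>UNIV. ((\<Sum>a\<in>UNIV. \<Sum>b\<in>UNIV. P m i a b x * F i a b x) + (\<Sum>a\<in>UNIV. \<Sum>b\<in>UNIV. f i a b x * PF m i a b x))) = 0"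
    by (simp only: f_contract_derivative[OF x] sum.neutral_const)
  moreover have "(\<Sum>i\<in>UNIV. \<Sum>a\<in>UNIV. \<Sum>b\<in>UNIV. f i a b x * PF m i a b x) = (\<Sum>i\<in>UNIV. \<Sum>a\<in>UNIV. \<Sum>b\<in>UNIV. P m i a b x * F i a b x)"
    using raise3_adjoint[OF x, of f "P m"] by (simp only: mult.commute)
  ultimately show ?thesis by (simp add: sum.distrib)
qed

text \<open>Contract closedness with \<open>F\<close>: one term vanishes by \<open>F_P_norm\<close>,
  and relabelling makes the other three equal with the same sign, so three times the sum is
  0.\<close>

lemma F_P_trace: assumes x: "x \<in> U" shows "(\<Sum>m\<in>UNIV. \<Sum>a\<in>UNIV. \<Sum>b\<in>UNIV. F m a b x * P m i a b x) = 0"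
proof -
  let ?X = "(\<Sum>m\<in>UNIV. \<Sum>a\<in>UNIV. \<Sum>b\<in>UNIV. F m a b x * P m i a b x)"
  have "(\<Sum>m\<in>UNIV. \<Sum>a\<in>UNIV. \<Sum>b\<in>UNIV. F m a b x * (P m i a b x - P i m a b x + P a m i b x - P b m i a x)) = 0"
    by (simp add: P_closed[OF x])
  then have e: "?X - (\<Sum>m\<in>UNIV. \<Sum>a\<in>UNIV. \<Sum>b\<in>UNIV. F m a b x * P i m a b x)
     + (\<Sum>m\<in>UNIV. \<Sum>a\<in>UNIV. \<Sum>b\<in>UNIV. F m a b x * P a m i b x) - (\<Sum>m\<in>UNIV. \<Sum>a\<in>UNIV. \<Sum>b\<in>UNIV. F m a b x * P b m i a x) = 0"
    by (simp only: right_diff_distrib distrib_left sum.distrib sum_subtractf)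
  have "(\<Sum>m\<in>UNIV. \<Sum>a\<in>UNIV. \<Sum>b\<in>UNIV. F m a b x * P i m a b x) = 0"
    using F_P_norm[OF x, of i] by (simp only: mult.commute)
  moreover have "(\<Sum>m\<in>UNIV. \<Sum>a\<in>UNIV. \<Sum>b\<in>UNIV. F m a b x * P a m i b x) = ?X"
  proof -
    have "F a m b x * P m a i b x = F m a b x * P m i a b x" for m a b
      using F_swap(1)[of m a b x] P_swap(1)[OF x, of m i a b] F_swap(1)[of a m b x] P_swap(1)[OF x, of m a i b] by simp
    then show ?thesis by (subst sum.swap) simp
  qed
  moreover have "(\<Sum>m\<in>UNIV. \<Sum>a\<in>UNIV. \<Sum>b\<in>UNIV. F m a b x * P b m i a x) = - ?X"
  proof -
    have "F a b m x * P m a i b x = - (F m a b x * P m i a b x)" for m a b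
      using F_swap(1)[of m a b x] F_swap(2)[of a m b x] P_swap(1)[OF x, of m i a b] by simp
    then have "(\<Sum>a\<in>UNIV. \<Sum>b\<in>UNIV. \<Sum>m\<in>UNIV. F a b m x * P m a i b x) = - (\<Sum>a\<in>UNIV. \<Sum>b\<in>UNIV. \<Sum>m\<in>UNIV. F m a b x * P m i a b x)"
      by (simp add: sum_negf)
    then show ?thesis unfolding sum3_rot[of "\<lambda>m a b. F m a b x * P m i a b x"] .
  qed
  ultimately show ?thesis using e by linarith
qed

section \<open>The divergence t of the 3-form and its norm\<close>

definition t_up :: "'n \<Rightarrow> 'n \<Rightarrow> real ^ 'n \<Rightarrow> real" where
  "t_up a b x = (\<Sum>m\<in>UNIV. PF m m a b x)"

definition t_lo :: "'n \<Rightarrow> 'n \<Rightarrow> real ^ 'n \<Rightarrow> real" where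
  "t_lo a b x = (\<Sum>m\<in>UNIV. raise m (\<lambda>i. P m i a b x) x)"

lemma t_up_eq: "t_up a b x = raise a (\<lambda>i. raise b (\<lambda>j. t_lo i j x) x) x"
proof -
  have "PF m m a b x = raise a (\<lambda>i. raise b (\<lambda>j. raise m (\<lambda>l. P m l i j x) x) x) x" for m
    unfolding raise3_def by (rule raise_rot[symmetric])
  then show ?thesis unfolding t_up_def t_lo_def raise_sum by simp
qed

text \<open>Take \<open>j = m\<close> in \<open>f_contract_derivative\<close> and sum over
  \<open>m\<close>; the first half is zero by \<open>F_P_trace\<close>.\<close>

lemma f_t_up: assumes x: "x \<in> U" shows "(\<Sum>a\<in>UNIV. \<Sum>b\<in>UNIV. f i a b x * t_up a b x) = 0"
proof -
  have "(\<Sum>m\<in>UNIV. ((\<Sum>a\<in>UNIV. \<Sum>b\<in>UNIV. P m i a b x * F m a b x) + (\<Sum>a\<in>UNIV. \<Sum>b\<in>UNIV. f i a b x * PF m m a b x))) = 0"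
    by (simp only: f_contract_derivative[OF x] sum.neutral_const)
  then have "(\<Sum>m\<in>UNIV. \<Sum>a\<in>UNIV. \<Sum>b\<in>UNIV. f i a b x * PF m m a b x) = 0"
    using F_P_trace[OF x, of i] by (simp add: sum.distrib mult.commute)
  then show ?thesis unfolding t_up_def sum_distrib_left sum3_rot[of "\<lambda>m a b. f i a b x * PF m m a b x"] .
qed

lemma F_t_lo: assumes x: "x \<in> U" shows "(\<Sum>a\<in>UNIV. \<Sum>b\<in>UNIV. F i a b x * t_lo a b x) = 0"
proof -
  have "(\<Sum>a\<in>UNIV. \<Sum>b\<in>UNIV. F i a b x * t_lo a b x)
     = (\<Sum>a\<in>UNIV. \<Sum>b\<in>UNIV. raise b (\<lambda>l. raise i (\<lambda>k. raise a (\<lambda>j. f k j l x) x) x) x * t_lo a b x)"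
    unfolding raise3_def by (intro sum.cong refl arg_cong2[where f = "(*)"] raise_rot)
  also have "\<dots> = (\<Sum>a\<in>UNIV. \<Sum>b\<in>UNIV. raise i (\<lambda>k. raise a (\<lambda>j. f k j b x) x) x * raise b (\<lambda>b. t_lo a b x) x)"
    unfolding raise_adjoint[OF x, symmetric] ..
  also have "\<dots> = (\<Sum>b\<in>UNIV. \<Sum>a\<in>UNIV. raise a (\<lambda>j. raise i (\<lambda>k. f k j b x) x) x * raise b (\<lambda>b. t_lo a b x) x)"
    by (subst sum.swap) (simp only: raise_raise[of i])
  also have "\<dots> = (\<Sum>b\<in>UNIV. \<Sum>a\<in>UNIV. raise i (\<lambda>k. f k a b x) x * t_up a b x)"
    unfolding raise_adjoint[OF x, symmetric] t_up_eq ..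
  also have "\<dots> = raise i (\<lambda>k. \<Sum>a\<in>UNIV. \<Sum>b\<in>UNIV. f k a b x * t_up a b x) x"
    unfolding raise_def sum_distrib_left sum_distrib_right
    by (subst sum.swap, subst sum3_rot[symmetric]) (simp only: mult.assoc)
  also have "\<dots> = 0" unfolding f_t_up[OF x] by (simp add: raise_def)
  finally show ?thesis .
qed

text \<open>Jacobi's formula applied to V^2 = det g. Cancelling a factor \<open>V\<close> gives the
  result for either sign of \<open>V\<close>.\<close>

lemma partial_V: assumes x: "x \<in> U" shows "partial k V x = V x * (\<Sum>m\<in>UNIV. \<Gamma> m m k x)"
proof -
  have dV: "V differentiable (at x)" by (rule smooth_on_differentiable[OF V_smooth x])
  have "partial k (\<lambda>y. V y * V y) x = partial k (\<lambda>y. det (gram (g y))) x"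
    by (rule partial_cong[OF open_U x]) (use dV V_det in \<open>auto simp: power2_eq_square\<close>)
  then have "2 * (V x * partial k V x) = (V x)\<^sup>2 * (2 * (\<Sum>m\<in>UNIV. \<Gamma> m m k x))"
    unfolding partial_det_gram[OF x] V_det[OF x] christoffel_trace[OF x] using dV by (simp add: partial_mult)
  then show ?thesis using V_nz[OF x] by (simp add: power2_eq_square)
qed

text \<open>The divergence formula for skew tensors. Symmetric Christoffel symbols against the skew
  \<open>F\<close> kill the connection terms of \<open>p\<close> and \<open>q\<close>; the
  derivative of \<open>V\<close> cancels the remaining one.\<close>

lemma divergence_F:
  assumes x: "x \<in> U"
  shows "(\<Sum>m\<in>UNIV. partial m (\<lambda>y. V y * F m p q y) x) = V x * t_up p q x"
proof -
  have dV: "V differentiable (at x)" by (rule smooth_on_differentiable[OF V_smooth x])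
  have z: "(\<Sum>m\<in>UNIV. \<Sum>k\<in>UNIV. \<Gamma> r m k x * h m k) = 0" if "\<And>m k. h k m = - h m k" for h r
  proof -
    have "(\<Sum>m\<in>UNIV. \<Sum>k\<in>UNIV. \<Gamma> r m k x * h m k) = (\<Sum>m\<in>UNIV. \<Sum>k\<in>UNIV. \<Gamma> r k m x * h k m)"
      by (rule sum.swap)
    also have "\<dots> = (\<Sum>m\<in>UNIV. \<Sum>k\<in>UNIV. - (\<Gamma> r m k x * h m k))"
      by (intro sum.cong refl) (subst that, subst christoffel_sym, rule mult_minus_right)
    finally have "(\<Sum>m\<in>UNIV. \<Sum>k\<in>UNIV. \<Gamma> r m k x * h m k) = (\<Sum>m\<in>UNIV. \<Sum>k\<in>UNIV. - (\<Gamma> r m k x * h m k))" .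
    then show ?thesis by (simp add: sum_negf)
  qed
  have z1: "(\<Sum>m\<in>UNIV. con_up m p (\<lambda>k. F m k q x) x) = 0"
    unfolding con_up_def by (rule z) (rule F_swap)
  have z2: "(\<Sum>m\<in>UNIV. con_up m q (\<lambda>k. F m p k x) x) = 0"
    unfolding con_up_def
  proof (rule z)
    show "F k p m x = - F m p k x" for m k
      using F_swap(1)[of p k m x] F_swap(2)[of p m k x] F_swap(1)[of m p k x] by simp
  qed
  have z3: "(\<Sum>m\<in>UNIV. con_up m m (\<lambda>k. F k p q x) x) = (\<Sum>k\<in>UNIV. (\<Sum>m\<in>UNIV. \<Gamma> m m k x) * F k p q x)"
    unfolding con_up_def sum_distrib_right by (rule sum.swap)
  have "(\<Sum>m\<in>UNIV. partial m (\<lambda>y. V y * F m p q y) x) =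
     (\<Sum>k\<in>UNIV. V x * ((\<Sum>m\<in>UNIV. \<Gamma> m m k x) * F k p q x)) + (\<Sum>m\<in>UNIV. V x * partial m (F m p q) x)"
    by (simp add: partial_mult[OF dV diffble_F[OF x]] partial_V[OF x] sum.distrib mult.assoc)
  also have "(\<Sum>m\<in>UNIV. V x * partial m (F m p q) x) = V x * (t_up p q x - (\<Sum>k\<in>UNIV. (\<Sum>m\<in>UNIV. \<Gamma> m m k x) * F k p q x))"
    unfolding partial_raise3[OF x smooth_f] sum_distrib_left[symmetric] sum_subtractf z1 z2 z3 t_up_def by simp
  finally show ?thesis unfolding sum_distrib_left[symmetric] by (simp add: algebra_simps)
qed

lemma smooth_t_lo: "smooth_on U (t_lo a b)"
  unfolding t_lo_def[abs_def] by (intro smooth_on_sum smooth_raise smooth_P open_U)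

lemma diffble_t_lo: "x \<in> U \<Longrightarrow> t_lo a b differentiable (at x)"
  by (rule smooth_on_differentiable[OF smooth_t_lo])

text \<open>The divergence of the vanishing vector field \<open>V F\<^sup>n\<^sup>a\<^sup>b t\<^sub>a\<^sub>b\<close> is \<open>V |t|\<^sup>2\<close> plus a multiple of \<open>dt \<and> *\<phi>\<close>.\<close>

lemma t_null:
  assumes x: "x \<in> U" and h: "(\<Sum>n\<in>UNIV. \<Sum>a\<in>UNIV. \<Sum>b\<in>UNIV. F n a b x * partial n (t_lo a b) x) = 0"
  shows "(\<Sum>a\<in>UNIV. \<Sum>b\<in>UNIV. t_up a b x * t_lo a b x) = 0"
proof -
  have dVF: "(\<lambda>y. V y * F n a b y) differentiable (at x)" for n a b
    by (rule smooth_on_differentiable[OF smooth_on_mult[OF open_U V_smooth smooth_F] x])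
  have "partial n (\<lambda>y. \<Sum>a\<in>UNIV. \<Sum>b\<in>UNIV. (V y * F n a b y) * t_lo a b y) x = 0" for n
  proof (rule partial_eq_0[OF open_U x])
    fix y assume y: "y \<in> U"
    have "(\<Sum>a\<in>UNIV. \<Sum>b\<in>UNIV. (V y * F n a b y) * t_lo a b y) = V y * (\<Sum>a\<in>UNIV. \<Sum>b\<in>UNIV. F n a b y * t_lo a b y)"
      by (simp only: sum_distrib_left mult.assoc)
    then show "(\<Sum>a\<in>UNIV. \<Sum>b\<in>UNIV. (V y * F n a b y) * t_lo a b y) = 0" using F_t_lo[OF y] by simp
  qed
  then have "(\<Sum>n\<in>UNIV. (\<Sum>a\<in>UNIV. \<Sum>b\<in>UNIV. partial n (\<lambda>y. V y * F n a b y) x * t_lo a b x)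
     + (\<Sum>a\<in>UNIV. \<Sum>b\<in>UNIV. (V x * F n a b x) * partial n (t_lo a b) x)) = 0"
    unfolding partial_contract2[OF x dVF diffble_t_lo[OF x]] by simp
  then have "(\<Sum>n\<in>UNIV. \<Sum>a\<in>UNIV. \<Sum>b\<in>UNIV. partial n (\<lambda>y. V y * F n a b y) x * t_lo a b x)
     + V x * (\<Sum>n\<in>UNIV. \<Sum>a\<in>UNIV. \<Sum>b\<in>UNIV. F n a b x * partial n (t_lo a b) x) = 0"
    unfolding sum.distrib sum_distrib_left mult.assoc .
  moreover have "(\<Sum>n\<in>UNIV. \<Sum>a\<in>UNIV. \<Sum>b\<in>UNIV. partial n (\<lambda>y. V y * F n a b y) x * t_lo a b x)
     = V x * (\<Sum>a\<in>UNIV. \<Sum>b\<in>UNIV. t_up a b x * t_lo a b x)"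
    by (subst sum3_rot) (simp only: sum_distrib_right[symmetric] divergence_F[OF x], simp only: sum_distrib_left mult.assoc)
  ultimately show ?thesis using h V_nz[OF x] by simp
qed

text \<open>Differentiating \<open>F_P_trace\<close> covariantly trades a second derivative of the
  3-form for a product of two first derivatives.\<close>

lemma F_cov_P: assumes x: "x \<in> U"
  shows "(\<Sum>m\<in>UNIV. \<Sum>a\<in>UNIV. \<Sum>b\<in>UNIV. F m a b x * cov4 P n m i a b x)
       = - (\<Sum>m\<in>UNIV. \<Sum>a\<in>UNIV. \<Sum>b\<in>UNIV. PF n m a b x * P m i a b x)"
proof -
  have 0: "partial n (\<lambda>y. \<Sum>m\<in>UNIV. \<Sum>a\<in>UNIV. \<Sum>b\<in>UNIV. F m a b y * P m i a b y) x = 0"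
    by (rule partial_eq_0[OF open_U x F_P_trace])
  have e: "partial n (\<lambda>y. \<Sum>m\<in>UNIV. \<Sum>a\<in>UNIV. \<Sum>b\<in>UNIV. F m a b y * P m i a b y) x
    = (\<Sum>m\<in>UNIV. \<Sum>a\<in>UNIV. \<Sum>b\<in>UNIV. partial n (F m a b) x * P m i a b x)
    + (\<Sum>m\<in>UNIV. \<Sum>a\<in>UNIV. \<Sum>b\<in>UNIV. F m a b x * partial n (P m i a b) x)"
  proof -
    have "(\<lambda>y. \<Sum>a\<in>UNIV. \<Sum>b\<in>UNIV. F m a b y * P m i a b y) differentiable (at x)" for m
      by (rule smooth_on_differentiable[OF _ x]) (intro smooth_intros smooth_F smooth_P open_U)
    then show ?thesis
      by (simp add: partial_sum partial_contract2[OF x diffble_F[OF x] diffble_P[OF x]] sum.distrib)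
  qed
  have cc: "(\<Sum>m\<in>UNIV. con_up n m w x * u m) = (\<Sum>m\<in>UNIV. w m * con_lo n m u x)" for w u
    using contract_con[of n u x w] by (simp only: mult.commute)
  have cc2: "(\<Sum>a\<in>UNIV. \<Sum>b\<in>UNIV. con_up n a (\<lambda>k. w k b) x * u a b) = (\<Sum>a\<in>UNIV. \<Sum>b\<in>UNIV. w a b * con_lo n a (\<lambda>k. u k b) x)"
    "(\<Sum>a\<in>UNIV. \<Sum>b\<in>UNIV. con_up n b (\<lambda>k. w a k) x * u a b) = (\<Sum>a\<in>UNIV. \<Sum>b\<in>UNIV. w a b * con_lo n b (\<lambda>k. u a k) x)" for w u
    using contract2_con(1)[of n u x w] contract2_con(2)[of n u x w] by (simp_all only: mult.commute)
  have c1: "(\<Sum>m\<in>UNIV. \<Sum>a\<in>UNIV. \<Sum>b\<in>UNIV. con_up n m (\<lambda>k. F k a b x) x * P m i a b x)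
      = (\<Sum>m\<in>UNIV. \<Sum>a\<in>UNIV. \<Sum>b\<in>UNIV. F m a b x * con_lo n m (\<lambda>k. P k i a b x) x)"
    unfolding sum3_rot[of "\<lambda>m a b. con_up n m (\<lambda>k. F k a b x) x * P m i a b x"]
      sum3_rot[of "\<lambda>m a b. F m a b x * con_lo n m (\<lambda>k. P k i a b x) x"]
    by (simp only: cc)
  have c2: "(\<Sum>m\<in>UNIV. \<Sum>a\<in>UNIV. \<Sum>b\<in>UNIV. con_up n a (\<lambda>k. F m k b x) x * P m i a b x)
      = (\<Sum>m\<in>UNIV. \<Sum>a\<in>UNIV. \<Sum>b\<in>UNIV. F m a b x * con_lo n a (\<lambda>k. P m i k b x) x)"
    by (simp only: cc2)
  have c3: "(\<Sum>m\<in>UNIV. \<Sum>a\<in>UNIV. \<Sum>b\<in>UNIV. con_up n b (\<lambda>k. F m a k x) x * P m i a b x)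
      = (\<Sum>m\<in>UNIV. \<Sum>a\<in>UNIV. \<Sum>b\<in>UNIV. F m a b x * con_lo n b (\<lambda>k. P m i a k x) x)"
    by (simp only: cc2)
  \<comment> \<open>The connection term of the free slot \<open>i\<close> is a combination of sums
    that vanish by \<open>F_P_trace\<close>.\<close>
  have c4: "(\<Sum>m\<in>UNIV. \<Sum>a\<in>UNIV. \<Sum>b\<in>UNIV. F m a b x * con_lo n i (\<lambda>k. P m k a b x) x) = 0"
  proof -
    have "(\<Sum>m\<in>UNIV. \<Sum>a\<in>UNIV. \<Sum>b\<in>UNIV. F m a b x * con_lo n i (\<lambda>k. P m k a b x) x)
       = (\<Sum>k\<in>UNIV. \<Gamma> k n i x * (\<Sum>m\<in>UNIV. \<Sum>a\<in>UNIV. \<Sum>b\<in>UNIV. F m a b x * P m k a b x))"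
      unfolding con_lo_def sum_distrib_left
      by (subst sum4_out) (simp only: mult.left_commute)
    then show ?thesis unfolding F_P_trace[OF x] by simp
  qed
  have "(\<Sum>m\<in>UNIV. \<Sum>a\<in>UNIV. \<Sum>b\<in>UNIV. F m a b x * cov4 P n m i a b x)
    = (\<Sum>m\<in>UNIV. \<Sum>a\<in>UNIV. \<Sum>b\<in>UNIV. F m a b x * partial n (P m i a b) x)
    - (\<Sum>m\<in>UNIV. \<Sum>a\<in>UNIV. \<Sum>b\<in>UNIV. F m a b x * con_lo n m (\<lambda>k. P k i a b x) x) - 0
    - (\<Sum>m\<in>UNIV. \<Sum>a\<in>UNIV. \<Sum>b\<in>UNIV. F m a b x * con_lo n a (\<lambda>k. P m i k b x) x)
    - (\<Sum>m\<in>UNIV. \<Sum>a\<in>UNIV. \<Sum>b\<in>UNIV. F m a b x * con_lo n b (\<lambda>k. P m i a k x) x)"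
    unfolding cov4_eq right_diff_distrib sum_subtractf c4 ..
  moreover have "(\<Sum>m\<in>UNIV. \<Sum>a\<in>UNIV. \<Sum>b\<in>UNIV. partial n (F m a b) x * P m i a b x)
    = (\<Sum>m\<in>UNIV. \<Sum>a\<in>UNIV. \<Sum>b\<in>UNIV. PF n m a b x * P m i a b x)
    - (\<Sum>m\<in>UNIV. \<Sum>a\<in>UNIV. \<Sum>b\<in>UNIV. con_up n m (\<lambda>k. F k a b x) x * P m i a b x)
    - (\<Sum>m\<in>UNIV. \<Sum>a\<in>UNIV. \<Sum>b\<in>UNIV. con_up n a (\<lambda>k. F m k b x) x * P m i a b x)
    - (\<Sum>m\<in>UNIV. \<Sum>a\<in>UNIV. \<Sum>b\<in>UNIV. con_up n b (\<lambda>k. F m a k x) x * P m i a b x)"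
    unfolding partial_raise3[OF x smooth_f] left_diff_distrib sum_subtractf ..
  ultimately show ?thesis using 0 unfolding e c1 c2 c3 by linarith
qed

text \<open>Covariant differentiation commutes with the metric trace over the first two slots, so
  the covariant derivative of t appears.\<close>

lemma trace_cov_P: assumes x: "x \<in> U"
  shows "(\<Sum>n\<in>UNIV. raise n (\<lambda>i. cov4 P m n i a b x) x)
    = partial m (t_lo a b) x - con_lo m a (\<lambda>k. t_lo k b x) x - con_lo m b (\<lambda>k. t_lo a k x) x"
proof -
  have dr: "(\<lambda>y. raise n (\<lambda>i. P n i a b y) y) differentiable (at x)" for n
    by (rule smooth_on_differentiable[OF smooth_raise[OF smooth_P] x])
  have "partial m (t_lo a b) x = (\<Sum>n\<in>UNIV. raise n (\<lambda>i. partial m (P n i a b) x - con_lo m i (\<lambda>k. P n k a b x) x) x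
      - con_up m n (\<lambda>k. raise k (\<lambda>i. P n i a b x) x) x)"
    unfolding t_lo_def[abs_def] by (simp add: partial_sum dr partial_raise[OF x smooth_P])
  moreover have "(\<Sum>n\<in>UNIV. con_up m n (\<lambda>k. raise k (\<lambda>i. P n i a b x) x) x) = (\<Sum>n\<in>UNIV. raise n (\<lambda>i. con_lo m n (\<lambda>k. P k i a b x) x) x)"
    unfolding raise_con_lo unfolding con_up_def con_lo_def by (rule sum.swap)
  moreover have "con_lo m a (\<lambda>k. t_lo k b x) x = (\<Sum>n\<in>UNIV. raise n (\<lambda>i. con_lo m a (\<lambda>k. P n i k b x) x) x)"
    unfolding raise_con_lo t_lo_def unfolding con_lo_def sum_distrib_left by (rule sum.swap)
  moreover have "con_lo m b (\<lambda>k. t_lo a k x) x = (\<Sum>n\<in>UNIV. raise n (\<lambda>i. con_lo m b (\<lambda>k. P n i a k x) x) x)"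
    unfolding raise_con_lo t_lo_def unfolding con_lo_def sum_distrib_left by (rule sum.swap)
  ultimately show ?thesis unfolding cov4_eq by (simp add: raise_diff sum_subtractf)
qed

text \<open>Christoffel symbols are symmetric and \<open>F\<close> is skew; contracted with
  \<open>F\<close>, the covariant derivative of t equals its partial derivative.\<close>

lemma F_con_lo: "(\<Sum>m\<in>UNIV. \<Sum>a\<in>UNIV. \<Sum>b\<in>UNIV. F m a b x * con_lo m a (\<lambda>k. u k b) x) = 0"
  "(\<Sum>m\<in>UNIV. \<Sum>a\<in>UNIV. \<Sum>b\<in>UNIV. F m a b x * con_lo m b (\<lambda>k. u a k) x) = 0"
proof -
  have s: "con_lo i j v x = con_lo j i v x" for i j v
    by (simp add: con_lo_def christoffel_sym[of _ i j])
  have "(\<Sum>m\<in>UNIV. \<Sum>a\<in>UNIV. \<Sum>b\<in>UNIV. F m a b x * con_lo m a (\<lambda>k. u k b) x)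
     = (\<Sum>m\<in>UNIV. \<Sum>a\<in>UNIV. \<Sum>b\<in>UNIV. F a m b x * con_lo a m (\<lambda>k. u k b) x)" by (rule sum.swap)
  also have "\<dots> = - (\<Sum>m\<in>UNIV. \<Sum>a\<in>UNIV. \<Sum>b\<in>UNIV. F m a b x * con_lo m a (\<lambda>k. u k b) x)"
    unfolding sum_negf[symmetric] by (intro sum.cong refl) (subst F_swap(1), subst s, simp)
  finally show "(\<Sum>m\<in>UNIV. \<Sum>a\<in>UNIV. \<Sum>b\<in>UNIV. F m a b x * con_lo m a (\<lambda>k. u k b) x) = 0" by simp
  have "(\<Sum>m\<in>UNIV. \<Sum>a\<in>UNIV. \<Sum>b\<in>UNIV. F m a b x * con_lo m b (\<lambda>k. u a k) x)
     = (\<Sum>a\<in>UNIV. \<Sum>b\<in>UNIV. \<Sum>m\<in>UNIV. F m a b x * con_lo m b (\<lambda>k. u a k) x)" by (rule sum3_rot)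
  also have "\<dots> = (\<Sum>a\<in>UNIV. \<Sum>m\<in>UNIV. \<Sum>b\<in>UNIV. F m a b x * con_lo m b (\<lambda>k. u a k) x)"
    by (rule sum.cong[OF refl], rule sum.swap)
  also have "\<dots> = (\<Sum>a\<in>UNIV. \<Sum>b\<in>UNIV. \<Sum>m\<in>UNIV. - (F m a b x * con_lo m b (\<lambda>k. u a k) x))"
  proof (intro sum.cong refl)
    fix a b m
    have "F b a m x = - F m a b x" using F_swap(1)[of a b m x] F_swap(2)[of a m b x] F_swap(1)[of m a b x] by simp
    then show "F b a m x * con_lo b m (\<lambda>k. u a k) x = - (F m a b x * con_lo m b (\<lambda>k. u a k) x)"
      by (subst s) simp
  qed
  also have "\<dots> = - (\<Sum>a\<in>UNIV. \<Sum>b\<in>UNIV. \<Sum>m\<in>UNIV. F m a b x * con_lo m b (\<lambda>k. u a k) x)" by (simp only: sum_negf)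
  finally show "(\<Sum>m\<in>UNIV. \<Sum>a\<in>UNIV. \<Sum>b\<in>UNIV. F m a b x * con_lo m b (\<lambda>k. u a k) x) = 0"
    unfolding sum3_rot[of "\<lambda>m a b. F m a b x * con_lo m b (\<lambda>k. u a k) x"] by simp
qed

end

section \<open>Scalar curvature from the Ricci identity\<close>

context metric_chart
begin

lemma raise_scale: "raise a (\<lambda>i. c * u i) x = c * raise a u x"
  by (simp add: raise_def sum_distrib_left mult.left_commute)

lemma scalar_curvature_eq: "scalar_curvature g x = (\<Sum>n\<in>UNIV. raise n (\<lambda>i. \<Sum>m\<in>UNIV. riemann g m i m n x) x)"
  by (simp add: scalar_curvature_def ricci_def raise_def up_def)

end

context closed_g2_chart
begin

text \<open>The components of \<open>phi4\<close> with the first three slots raised, as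
  \<open>coordinate_psi\<close> confirms in an adapted frame.\<close>

definition psi :: "'n \<Rightarrow> 'n \<Rightarrow> 'n \<Rightarrow> 'n \<Rightarrow> real ^ 'n \<Rightarrow> real" where
  "psi m a n p x = raise n (\<lambda>i. \<Sum>b\<in>UNIV. F m a b x * f i p b x) x
     - up n m x * (if a = p then 1 else 0) + up n a x * (if m = p then 1 else 0)"

lemma psi_skew: "psi a m n p x = - psi m a n p x"
proof -
  have "F a m b x = - F m a b x" for b by (rule F_swap)
  then have "raise n (\<lambda>i. \<Sum>b\<in>UNIV. F a m b x * f i p b x) x = - raise n (\<lambda>i. \<Sum>b\<in>UNIV. F m a b x * f i p b x) x"
    by (simp add: sum_negf raise_minus)
  then show ?thesis by (simp add: psi_def)
qed

text \<open>Cyclic rotation of the first three slots leaves \<open>psi\<close> unchanged, so the sum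
  equals its two rotated versions. Adding the three produces the cyclic curvature sum, which is
  zero.\<close>

lemma psi_riemann:
  assumes psi: "\<And>m a n p. psi m n a p x = - psi m a n p x"
  shows "(\<Sum>m\<in>UNIV. \<Sum>a\<in>UNIV. \<Sum>n\<in>UNIV. riemann g p a n m x * psi m a n p x) = 0"
proof -
  let ?Z = "\<Sum>m\<in>UNIV. \<Sum>a\<in>UNIV. \<Sum>n\<in>UNIV. riemann g p a n m x * psi m a n p x"
  have cyc: "psi a n m p x = psi m a n p x" for m a n
    using psi[of a m n p] psi_skew[of a m n p x] by simp
  have cyc': "psi n m a p x = psi m a n p x" for m a n
    using cyc[of n m a] cyc[of m a n] by simp
  have 1: "?Z = (\<Sum>m\<in>UNIV. \<Sum>a\<in>UNIV. \<Sum>n\<in>UNIV. riemann g p n m a x * psi m a n p x)"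
  proof -
    have "?Z = (\<Sum>m\<in>UNIV. \<Sum>a\<in>UNIV. \<Sum>n\<in>UNIV. riemann g p n m a x * psi a n m p x)"
      by (rule sum3_rot[symmetric])
    also have "\<dots> = (\<Sum>m\<in>UNIV. \<Sum>a\<in>UNIV. \<Sum>n\<in>UNIV. riemann g p n m a x * psi m a n p x)"
      by (intro sum.cong refl arg_cong2[where f = "(*)"] cyc)
    finally show ?thesis .
  qed
  have 2: "?Z = (\<Sum>m\<in>UNIV. \<Sum>a\<in>UNIV. \<Sum>n\<in>UNIV. riemann g p m a n x * psi m a n p x)"
  proof -
    have "?Z = (\<Sum>m\<in>UNIV. \<Sum>a\<in>UNIV. \<Sum>n\<in>UNIV. riemann g p m a n x * psi n m a p x)"
      by (rule sum3_rot)
    also have "\<dots> = (\<Sum>m\<in>UNIV. \<Sum>a\<in>UNIV. \<Sum>n\<in>UNIV. riemann g p m a n x * psi m a n p x)"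
      by (intro sum.cong refl arg_cong2[where f = "(*)"] cyc')
    finally show ?thesis .
  qed
  have "?Z + ?Z + ?Z = (\<Sum>m\<in>UNIV. \<Sum>a\<in>UNIV. \<Sum>n\<in>UNIV.
      (riemann g p a n m x + riemann g p n m a x + riemann g p m a n x) * psi m a n p x)"
    unfolding distrib_right sum.distrib 1[symmetric] 2[symmetric] ..
  then show ?thesis unfolding first_bianchi by simp
qed

text \<open>The Ricci identity has three curvature terms, all with a minus sign. Their contractions
  are -6, 1 and 1 times the scalar curvature, which makes 6 - 1 - 1 = 4.\<close>

lemma commutator_scalar_curvature:
  assumes x: "x \<in> U" and psi: "\<And>m a n p. psi m n a p x = - psi m a n p x"
  shows "(\<Sum>n\<in>UNIV. raise n (\<lambda>i. \<Sum>m\<in>UNIV. \<Sum>a\<in>UNIV. \<Sum>b\<in>UNIV. F m a b x * (cov4 P n m i a b x - cov4 P m n i a b x)) x)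
    = 4 * scalar_curvature g x"
proof -
  let ?R = "\<lambda>p a n m. riemann g p a n m x" and ?S = "scalar_curvature g x"
  have sk: "?R p a n m = - ?R p a m n" for p a n m by (rule riemann_skew)
  have T1: "(\<Sum>n\<in>UNIV. raise n (\<lambda>i. \<Sum>m\<in>UNIV. \<Sum>a\<in>UNIV. \<Sum>b\<in>UNIV. F m a b x * (\<Sum>p\<in>UNIV. ?R p i n m * f p a b x)) x) = - 6 * ?S"
  proof -
    have "(\<Sum>a\<in>UNIV. \<Sum>b\<in>UNIV. F m a b x * (\<Sum>p\<in>UNIV. ?R p i n m * f p a b x)) = 6 * ?R m i n m" for m i n
    proof -
      have "(\<Sum>a\<in>UNIV. \<Sum>b\<in>UNIV. F m a b x * (\<Sum>p\<in>UNIV. ?R p i n m * f p a b x))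
        = (\<Sum>p\<in>UNIV. \<Sum>a\<in>UNIV. \<Sum>b\<in>UNIV. ?R p i n m * (f p a b x * F m a b x))"
        unfolding sum_distrib_left by (subst sum3_rot) (simp only: mult_ac)
      also have "\<dots> = (\<Sum>p\<in>UNIV. ?R p i n m * (if p = m then 6 else 0))"
        unfolding sum_distrib_left[symmetric] f_contract[OF x] ..
      also have "\<dots> = 6 * ?R m i n m" by (simp add: if_distrib cong: if_cong)
      finally show ?thesis .
    qed
    moreover have "6 * ?R m i n m = - 6 * ?R m i m n" for m i n using sk[of m i n m] by simp
    ultimately show ?thesis
      unfolding scalar_curvature_eq by (simp only: sum_distrib_left[symmetric] raise_scale)
  qed
  have pull: "(\<Sum>n\<in>UNIV. raise n (\<lambda>i. \<Sum>m\<in>UNIV. \<Sum>a\<in>UNIV. \<Sum>b\<in>UNIV. F m a b x * (\<Sum>p\<in>UNIV. ?R p a n m * f i p b x)) x)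
    = (\<Sum>n\<in>UNIV. \<Sum>m\<in>UNIV. \<Sum>a\<in>UNIV. \<Sum>p\<in>UNIV. ?R p a n m * raise n (\<lambda>i. \<Sum>b\<in>UNIV. F m a b x * f i p b x) x)"
  proof -
    have "(\<Sum>b\<in>UNIV. F m a b x * (\<Sum>p\<in>UNIV. ?R p a n m * f i p b x))
      = (\<Sum>p\<in>UNIV. ?R p a n m * (\<Sum>b\<in>UNIV. F m a b x * f i p b x))" for m a n i
      unfolding sum_distrib_left by (subst sum.swap) (simp only: mult.left_commute)
    then show ?thesis by (simp only: raise_sum raise_scale)
  qed
  \<comment> \<open>The contraction of two copies of the 3-form splits into \<open>psi\<close>,
    which the Bianchi identity kills, and two metric terms.\<close>
  have ps: "raise n (\<lambda>i. \<Sum>b\<in>UNIV. F m a b x * f i p b x) x = psi m a n p x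
      + up n m x * (if a = p then 1 else 0) - up n a x * (if m = p then 1 else 0)" for m a n p
    by (simp add: psi_def)
  have T2: "(\<Sum>n\<in>UNIV. raise n (\<lambda>i. \<Sum>m\<in>UNIV. \<Sum>a\<in>UNIV. \<Sum>b\<in>UNIV. F m a b x * (\<Sum>p\<in>UNIV. ?R p a n m * f i p b x)) x) = ?S"
  proof -
    have "(\<Sum>n\<in>UNIV. \<Sum>m\<in>UNIV. \<Sum>a\<in>UNIV. \<Sum>p\<in>UNIV. ?R p a n m * psi m a n p x)
      = (\<Sum>p\<in>UNIV. \<Sum>m\<in>UNIV. \<Sum>a\<in>UNIV. \<Sum>n\<in>UNIV. ?R p a n m * psi m a n p x)"
      by (subst sum4_out, rule sum.cong[OF refl], rule sum3_rot)
    then have A: "(\<Sum>n\<in>UNIV. \<Sum>m\<in>UNIV. \<Sum>a\<in>UNIV. \<Sum>p\<in>UNIV. ?R p a n m * psi m a n p x) = 0"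
      by (simp only: psi_riemann[OF psi] sum.neutral_const)
    \<comment> \<open>The trace of the curvature endomorphism is skew in \<open>n\<close> and
      \<open>m\<close> and meets the symmetric inverse metric.\<close>
    have B: "(\<Sum>n\<in>UNIV. \<Sum>m\<in>UNIV. \<Sum>a\<in>UNIV. ?R a a n m * up n m x) = 0"
    proof -
      have "(\<Sum>n\<in>UNIV. \<Sum>m\<in>UNIV. \<Sum>a\<in>UNIV. ?R a a n m * up n m x) = (\<Sum>n\<in>UNIV. \<Sum>m\<in>UNIV. \<Sum>a\<in>UNIV. ?R a a m n * up m n x)"
        by (rule sum.swap)
      also have "\<dots> = (\<Sum>n\<in>UNIV. \<Sum>m\<in>UNIV. \<Sum>a\<in>UNIV. - (?R a a n m * up n m x))"
        by (intro sum.cong refl) (subst sk, subst up_sym[OF x], simp)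
      also have "\<dots> = - (\<Sum>n\<in>UNIV. \<Sum>m\<in>UNIV. \<Sum>a\<in>UNIV. ?R a a n m * up n m x)" by (simp only: sum_negf)
      finally show ?thesis by simp
    qed
    \<comment> \<open>Here the upper index is traced with the second direction instead of the first,
      which gives minus the Ricci tensor.\<close>
    have C: "(\<Sum>n\<in>UNIV. \<Sum>m\<in>UNIV. \<Sum>a\<in>UNIV. ?R m a n m * up n a x) = - ?S"
    proof -
      have "?S = (\<Sum>n\<in>UNIV. \<Sum>a\<in>UNIV. \<Sum>m\<in>UNIV. up n a x * ?R m a m n)"
        unfolding scalar_curvature_eq raise_def sum_distrib_left ..
      also have "\<dots> = (\<Sum>n\<in>UNIV. \<Sum>m\<in>UNIV. \<Sum>a\<in>UNIV. - (?R m a n m * up n a x))"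
        by (rule sum.cong[OF refl], subst sum.swap, intro sum.cong refl) (subst sk, simp)
      finally show ?thesis by (simp only: sum_negf)
    qed
    have "(\<Sum>p\<in>UNIV. ?R p a n m * (psi m a n p x + up n m x * (if a = p then 1 else 0) - up n a x * (if m = p then 1 else 0)))
      = (\<Sum>p\<in>UNIV. ?R p a n m * psi m a n p x) + ?R a a n m * up n m x - ?R m a n m * up n a x" for a n m
      by (simp add: right_diff_distrib distrib_left sum_subtractf sum.distrib mult.assoc[symmetric])
    then show ?thesis
      unfolding pull ps using A B C by (simp only: sum_subtractf sum.distrib)
  qed
  have T3: "(\<Sum>n\<in>UNIV. raise n (\<lambda>i. \<Sum>m\<in>UNIV. \<Sum>a\<in>UNIV. \<Sum>b\<in>UNIV. F m a b x * (\<Sum>p\<in>UNIV. ?R p b n m * f i a p x)) x) = ?S"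
  proof -
    have "(\<Sum>a\<in>UNIV. \<Sum>b\<in>UNIV. F m a b x * (\<Sum>p\<in>UNIV. ?R p b n m * f i a p x))
      = (\<Sum>a\<in>UNIV. \<Sum>b\<in>UNIV. F m a b x * (\<Sum>p\<in>UNIV. ?R p a n m * f i p b x))" for m n i
    proof -
      have "(\<Sum>a\<in>UNIV. \<Sum>b\<in>UNIV. F m a b x * (\<Sum>p\<in>UNIV. ?R p b n m * f i a p x))
         = (\<Sum>a\<in>UNIV. \<Sum>b\<in>UNIV. F m b a x * (\<Sum>p\<in>UNIV. ?R p a n m * f i b p x))" by (rule sum.swap)
      also have "\<dots> = (\<Sum>a\<in>UNIV. \<Sum>b\<in>UNIV. F m a b x * (\<Sum>p\<in>UNIV. ?R p a n m * f i p b x))"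
      proof (intro sum.cong refl)
        fix a b
        have "(\<Sum>p\<in>UNIV. ?R p a n m * f i b p x) = - (\<Sum>p\<in>UNIV. ?R p a n m * f i p b x)"
          unfolding sum_negf[symmetric] by (intro sum.cong refl) (subst f_swap(2), simp)
        then show "F m b a x * (\<Sum>p\<in>UNIV. ?R p a n m * f i b p x) = F m a b x * (\<Sum>p\<in>UNIV. ?R p a n m * f i p b x)"
          using F_swap(2)[of m b a x] by simp
      qed
      finally show ?thesis .
    qed
    then show ?thesis using T2 by simp
  qed
  have "(\<Sum>n\<in>UNIV. raise n (\<lambda>i. \<Sum>m\<in>UNIV. \<Sum>a\<in>UNIV. \<Sum>b\<in>UNIV. F m a b x * (cov4 P n m i a b x - cov4 P m n i a b x)) x)
    = - (\<Sum>n\<in>UNIV. raise n (\<lambda>i. \<Sum>m\<in>UNIV. \<Sum>a\<in>UNIV. \<Sum>b\<in>UNIV. F m a b x * (\<Sum>p\<in>UNIV. ?R p i n m * f p a b x)) x)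
      - (\<Sum>n\<in>UNIV. raise n (\<lambda>i. \<Sum>m\<in>UNIV. \<Sum>a\<in>UNIV. \<Sum>b\<in>UNIV. F m a b x * (\<Sum>p\<in>UNIV. ?R p a n m * f i p b x)) x)
      - (\<Sum>n\<in>UNIV. raise n (\<lambda>i. \<Sum>m\<in>UNIV. \<Sum>a\<in>UNIV. \<Sum>b\<in>UNIV. F m a b x * (\<Sum>p\<in>UNIV. ?R p b n m * f i a p x)) x)"
    unfolding ricci_identity[OF x smooth_f]
    by (simp only: right_diff_distrib mult_minus_right sum_subtractf sum_negf raise_diff raise_minus)
  then show ?thesis unfolding T1 T2 T3 by simp
qed

lemma scalar_curvature_norm:
  assumes x: "x \<in> U" and psi: "\<And>m a n p. psi m n a p x = - psi m a n p x"
    and h: "(\<Sum>n\<in>UNIV. \<Sum>a\<in>UNIV. \<Sum>b\<in>UNIV. F n a b x * partial n (t_lo a b) x) = 0"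
  shows "4 * scalar_curvature g x = - (\<Sum>n\<in>UNIV. raise n (\<lambda>i. \<Sum>m\<in>UNIV. \<Sum>a\<in>UNIV. \<Sum>b\<in>UNIV. PF n m a b x * P m i a b x) x)"
proof -
  \<comment> \<open>In this order of the derivatives the trace over \<open>n\<close> yields the
    derivative of t; \<open>F_con_lo\<close> removes the connection terms, and \<open>h\<close>
    removes the rest.\<close>
  have 1: "(\<Sum>n\<in>UNIV. raise n (\<lambda>i. \<Sum>m\<in>UNIV. \<Sum>a\<in>UNIV. \<Sum>b\<in>UNIV. F m a b x * cov4 P m n i a b x) x) = 0"
  proof -
    have "(\<Sum>n\<in>UNIV. raise n (\<lambda>i. \<Sum>m\<in>UNIV. \<Sum>a\<in>UNIV. \<Sum>b\<in>UNIV. F m a b x * cov4 P m n i a b x) x)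
      = (\<Sum>m\<in>UNIV. \<Sum>a\<in>UNIV. \<Sum>b\<in>UNIV. F m a b x * (\<Sum>n\<in>UNIV. raise n (\<lambda>i. cov4 P m n i a b x) x))"
      unfolding raise_sum raise_scale sum_distrib_left by (rule sum4_out[symmetric])
    also have "\<dots> = 0"
      unfolding trace_cov_P[OF x] right_diff_distrib sum_subtractf F_con_lo h by simp
    finally show ?thesis .
  qed
  have "4 * scalar_curvature g x = (\<Sum>n\<in>UNIV. raise n (\<lambda>i. \<Sum>m\<in>UNIV. \<Sum>a\<in>UNIV. \<Sum>b\<in>UNIV. F m a b x * cov4 P n m i a b x) x)
     - (\<Sum>n\<in>UNIV. raise n (\<lambda>i. \<Sum>m\<in>UNIV. \<Sum>a\<in>UNIV. \<Sum>b\<in>UNIV. F m a b x * cov4 P m n i a b x) x)"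
    unfolding commutator_scalar_curvature[OF x psi, symmetric]
    by (simp only: right_diff_distrib sum_subtractf raise_diff)
  then show ?thesis unfolding 1 F_cov_P[OF x] by (simp only: raise_minus sum_negf diff_0_right)
qed

end

section \<open>Contractions in an adapted frame\<close>

lemma forms_3_linear:
  assumes "\<alpha> \<in> forms 3"
  shows "linear (\<lambda>x. \<alpha> [x, y, z])" "linear (\<lambda>y. \<alpha> [x, y, z])" "linear (\<lambda>z. \<alpha> [x, y, z])"
  using forms_linear[OF assms, of "[0, y, z]" 0] forms_linear[OF assms, of "[x, 0, z]" 1]
    forms_linear[OF assms, of "[x, y, 0]" 2] by (simp_all add: numeral_2_eq_2)

lemma forms_3_swap:
  assumes "\<alpha> \<in> forms 3"
  shows "\<alpha> [y, x, z] = - \<alpha> [x, y, z]" "\<alpha> [x, z, y] = - \<alpha> [x, y, z]"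
  using forms_swap[OF assms, of "[x, y, z]" 0 1] forms_swap[OF assms, of "[x, y, z]" 1 2]
  by (simp_all add: numeral_2_eq_2)

text \<open>Iterating this turns an array of components into a multilinear map, which can then be
  evaluated on a frame.\<close>

definition lin_ext :: "('n::finite \<Rightarrow> real) \<Rightarrow> real ^ 'n \<Rightarrow> real" where
  "lin_ext h u = (\<Sum>k\<in>UNIV. u $ k * h k)"

lemma lin_ext_axis [simp]: "lin_ext h (axis m 1) = h m"
  by (simp add: lin_ext_def axis_def)

lemma linear_lin_ext: "linear (lin_ext h)"
  by (rule linearI) (simp_all add: lin_ext_def distrib_right sum.distrib sum_distrib_left mult.assoc)

lemma linear_lin_ext_param: "(\<And>k. linear (\<lambda>w. H k w)) \<Longrightarrow> linear (\<lambda>w. lin_ext (\<lambda>k. H k w) u)"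
  unfolding lin_ext_def by (intro linear_compose_sum ballI linear_scaled)

lemma linear_eq_0_on_axis:
  assumes "linear (h :: real ^ 'n::finite \<Rightarrow> real)" "\<And>i. h (axis i 1) = 0" shows "h u = 0"
proof -
  have "h u = h (\<Sum>j\<in>UNIV. u $ j *\<^sub>R axis j 1)"
    using basis_expansion[of u] by (simp add: scalar_mult_eq_scaleR)
  also have "\<dots> = 0" using assms by (simp add: linear_sum linear_cmul)
  finally show ?thesis .
qed

lemma sum_inner_out:
  "(\<Sum>k\<in>A. \<Sum>l\<in>B. \<Sum>r\<in>C. h k l r) = (\<Sum>r\<in>C. \<Sum>k\<in>A. \<Sum>l\<in>B. h k l r :: real)"
proof -
  have "(\<Sum>k\<in>A. \<Sum>l\<in>B. \<Sum>r\<in>C. h k l r) = (\<Sum>k\<in>A. \<Sum>r\<in>C. \<Sum>l\<in>B. h k l r)"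
    by (intro sum.cong refl sum.swap)
  also have "\<dots> = (\<Sum>r\<in>C. \<Sum>k\<in>A. \<Sum>l\<in>B. h k l r)" by (rule sum.swap)
  finally show ?thesis .
qed

context adapted_frame
begin

text \<open>The pointwise counterpart of \<open>raise\<close>; \<open>ra_eq_raise\<close> identifies
  the two.\<close>

definition ra :: "7 \<Rightarrow> (7 \<Rightarrow> real) \<Rightarrow> real" where
  "ra a u = (\<Sum>i\<in>UNIV. cogram g $ a $ i * u i)"

lemma ra_ra: "ra a (\<lambda>i. ra b (\<lambda>j. h i j)) = ra b (\<lambda>j. ra a (\<lambda>i. h i j))"
  unfolding ra_def sum_distrib_left by (subst sum.swap) (simp add: mult.left_commute)

lemma ra_sum: "ra a (\<lambda>i. \<Sum>k\<in>K. h k i) = (\<Sum>k\<in>K. ra a (h k))"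
  unfolding ra_def sum_distrib_left by (rule sum.swap)

lemma ra_scale: "ra a (\<lambda>i. c * u i) = c * ra a u"
  by (simp add: ra_def sum_distrib_left mult.left_commute)

lemma ra_scale_right: "ra a (\<lambda>i. u i * c) = ra a u * c"
  by (simp add: ra_def sum_distrib_right mult.assoc)

lemma ra_add: "ra a (\<lambda>i. u i + w i) = ra a u + ra a w"
  by (simp add: ra_def distrib_left sum.distrib)

lemma ra_diff: "ra a (\<lambda>i. u i - w i) = ra a u - ra a w"
  by (simp add: ra_def right_diff_distrib sum_subtractf)

lemma ra_minus: "ra a (\<lambda>i. - u i) = - ra a u"
  by (simp add: ra_def sum_negf)

lemma linear_ra: "(\<And>i. linear (\<lambda>w. h i w)) \<Longrightarrow> linear (\<lambda>w. ra a (\<lambda>i. h i w))"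
  unfolding ra_def by (intro linear_compose_sum ballI linear_scaled)

lemma ra_contract:
  assumes "linear A" "linear B"
  shows "(\<Sum>a\<in>UNIV. A (axis a 1) * ra a (\<lambda>i. B (axis i 1))) = (\<Sum>k\<in>{1..7}. sgn7 k * (A (E k) * B (E k)))"
proof -
  have "(\<Sum>a\<in>UNIV. A (axis a 1) * ra a (\<lambda>i. B (axis i 1)))
    = (\<Sum>i\<in>UNIV. \<Sum>j\<in>UNIV. cogram g $ i $ j * (A (axis i 1) * B (axis j 1)))"
    by (simp add: ra_def sum_distrib_left mult.left_commute)
  also have "\<dots> = (\<Sum>k\<in>{1..7}. sgn7 k * (A (E k) * B (E k)))"
  proof (rule bilinear_contraction)
    show "linear (\<lambda>y. A x * B y)" for x using assms(2) by (rule linear_scaled)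
    show "linear (\<lambda>x. A x * B y)" for y using linear_scaled[OF assms(1), of "B y"] by (simp add: mult.commute)
  qed
  finally show ?thesis .
qed

lemma ra_contract2:
  assumes "\<And>w. linear (\<lambda>u. A u w)" "\<And>u. linear (\<lambda>w. A u w)" "\<And>w. linear (\<lambda>u. B u w)" "\<And>u. linear (\<lambda>w. B u w)"
  shows "(\<Sum>a\<in>UNIV. \<Sum>b\<in>UNIV. A (axis a 1) (axis b 1) * ra a (\<lambda>i. ra b (\<lambda>j. B (axis i 1) (axis j 1))))
    = (\<Sum>k\<in>{1..7}. \<Sum>l\<in>{1..7}. sgn7 k * sgn7 l * (A (E k) (E l) * B (E k) (E l)))"
proof -
  have "(\<Sum>b\<in>UNIV. A (axis a 1) (axis b 1) * ra a (\<lambda>i. ra b (\<lambda>j. B (axis i 1) (axis j 1))))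
    = (\<Sum>l\<in>{1..7}. sgn7 l * (A (axis a 1) (E l) * ra a (\<lambda>i. B (axis i 1) (E l))))" for a
    by (subst ra_ra) (rule ra_contract[where A = "\<lambda>w. A (axis a 1) w" and B = "\<lambda>w. ra a (\<lambda>i. B (axis i 1) w)", OF assms(2) linear_ra[OF assms(4)]])
  then have "(\<Sum>a\<in>UNIV. \<Sum>b\<in>UNIV. A (axis a 1) (axis b 1) * ra a (\<lambda>i. ra b (\<lambda>j. B (axis i 1) (axis j 1))))
    = (\<Sum>l\<in>{1..7}. sgn7 l * (\<Sum>a\<in>UNIV. A (axis a 1) (E l) * ra a (\<lambda>i. B (axis i 1) (E l))))"
    by (simp only:) (subst sum.swap, simp only: sum_distrib_left)
  also have "\<dots> = (\<Sum>l\<in>{1..7}. sgn7 l * (\<Sum>k\<in>{1..7}. sgn7 k * (A (E k) (E l) * B (E k) (E l))))"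
    by (simp only: ra_contract[where A = "\<lambda>u. A u (E _)" and B = "\<lambda>u. B u (E _)", OF assms(1) assms(3)])
  also have "\<dots> = (\<Sum>k\<in>{1..7}. \<Sum>l\<in>{1..7}. sgn7 k * sgn7 l * (A (E k) (E l) * B (E k) (E l)))"
    unfolding sum_distrib_left by (subst sum.swap) (simp only: mult_ac)
  finally show ?thesis .
qed

lemma ra_rot: "ra a (\<lambda>i. ra b (\<lambda>j. ra c (\<lambda>k. h i j k))) = ra b (\<lambda>j. ra c (\<lambda>k. ra a (\<lambda>i. h i j k)))"
  by (subst ra_ra, subst ra_ra[where a = a and b = c], rule refl)

lemma gram_sym_g: "g x y = g y x"
  by (simp add: metric_eq mult.commute)

lemma ra_metric: "ra a (\<lambda>i. g (axis i 1) (axis j 1)) = (if a = j then 1 else 0)"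
proof -
  have lin: "linear (\<lambda>x. x $ a)" by (rule linearI) simp_all
  have ling: "linear (\<lambda>x. g x (axis j 1))"
    by (rule linearI) (simp_all add: metric_eq blinfun.add_right blinfun.scaleR_right distrib_left distrib_right sum.distrib sum_distrib_left mult_ac)
  have "ra a (\<lambda>i. g (axis i 1) (axis j 1)) = (\<Sum>b\<in>UNIV. (axis b 1 :: real ^ 7) $ a * ra b (\<lambda>i. g (axis i 1) (axis j 1)))"
    by (simp add: axis_def)
  also have "\<dots> = (\<Sum>k\<in>{1..7}. sgn7 k * (E k $ a * g (E k) (axis j 1)))"
    by (rule ra_contract[OF lin ling])
  also have "\<dots> = (\<Sum>k\<in>{1..7}. blinfun_apply (v k) (axis j 1) * E k $ a)"
  proof (rule sum.cong[OF refl])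
    fix k assume k: "k \<in> {1..7::nat}"
    have "g (E k) (axis j 1) = (\<Sum>i\<in>{1..7}. if i = k then sgn7 k * blinfun_apply (v k) (axis j 1) else 0)"
      unfolding metric_eq using k by (intro sum.cong refl) (simp add: dual del: atLeastAtMost_iff One_nat_def)
    then have "g (E k) (axis j 1) = sgn7 k * blinfun_apply (v k) (axis j 1)" using k by simp
    moreover have "sgn7 k * sgn7 k = 1" by (simp add: sgn7_def)
    ultimately show "sgn7 k * (E k $ a * g (E k) (axis j 1)) = blinfun_apply (v k) (axis j 1) * E k $ a"
      by (simp add: mult.left_commute[of _ "sgn7 k"] mult.assoc[symmetric])
  qed
  also have "\<dots> = axis j 1 $ a" by (rule expand_component)
  finally show ?thesis by (simp add: axis_def)
qed

section \<open>Transfer of the frame identities to coordinates\<close>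

context
  assumes phi_form: "\<phi> \<in> forms 3"
begin

abbreviation ph :: "7 \<Rightarrow> 7 \<Rightarrow> 7 \<Rightarrow> real" where
  "ph a b c \<equiv> \<phi> [axis a 1, axis b 1, axis c 1]"

lemmas phi_linear = forms_3_linear[OF phi_form]

lemma coordinate_contract:
  "(\<Sum>a\<in>UNIV. \<Sum>b\<in>UNIV. ph i a b * ra j (\<lambda>k. ra a (\<lambda>l. ra b (\<lambda>m. ph k l m)))) = (if i = j then 6 else 0)"
proof -
  have "(\<Sum>a\<in>UNIV. \<Sum>b\<in>UNIV. ph i a b * ra j (\<lambda>k. ra a (\<lambda>l. ra b (\<lambda>m. ph k l m))))
    = (\<Sum>a\<in>UNIV. \<Sum>b\<in>UNIV. ph i a b * ra a (\<lambda>l. ra b (\<lambda>m. ra j (\<lambda>k. ph k l m))))"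
    by (subst ra_rot) (rule refl)
  also have "\<dots> = (\<Sum>k\<in>{1..7}. \<Sum>l\<in>{1..7}. sgn7 k * sgn7 l * (\<phi> [axis i 1, E k, E l] * ra j (\<lambda>m. \<phi> [axis m 1, E k, E l])))"
    by (rule ra_contract2[where A = "\<lambda>u w. \<phi> [axis i 1, u, w]" and B = "\<lambda>u w. ra j (\<lambda>k. \<phi> [axis k 1, u, w])"])
      (intro phi_linear linear_ra)+
  also have "\<dots> = ra j (\<lambda>m. \<Sum>k\<in>{1..7}. \<Sum>l\<in>{1..7}. sgn7 k * sgn7 l * (\<phi> [axis m 1, E k, E l] * \<phi> [axis i 1, E k, E l]))"
    by (simp only: ra_sum ra_scale ra_scale_right mult.commute[of "\<phi> [axis i 1, _, _]"])
  also have "\<dots> = 6 * (if j = i then 1 else 0)"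
    unfolding phi_contract2 ra_scale ra_metric ..
  finally show ?thesis by simp
qed

lemma coordinate_psi:
  "ra n (\<lambda>i. \<Sum>b\<in>UNIV. ra m (\<lambda>j. ra a (\<lambda>k. ra b (\<lambda>l. ph j k l))) * ph i p b)
     - cogram g $ n $ m * (if a = p then 1 else 0) + cogram g $ n $ a * (if m = p then 1 else 0)
   = ra m (\<lambda>j. ra a (\<lambda>k. ra n (\<lambda>i. phi4 (axis j 1) (axis k 1) (axis i 1) (axis p 1))))"
proof -
  have "(\<Sum>b\<in>UNIV. ra m (\<lambda>j. ra a (\<lambda>k. ra b (\<lambda>l. ph j k l))) * ph i p b)
     = ra m (\<lambda>j. ra a (\<lambda>k. \<Sum>r\<in>{1..7}. sgn7 r * (\<phi> [axis j 1, axis k 1, E r] * \<phi> [axis i 1, axis p 1, E r])))" for i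
  proof -
    have "(\<Sum>b\<in>UNIV. ra m (\<lambda>j. ra a (\<lambda>k. ra b (\<lambda>l. ph j k l))) * ph i p b)
      = ra m (\<lambda>j. ra a (\<lambda>k. \<Sum>b\<in>UNIV. ph i p b * ra b (\<lambda>l. ph j k l)))"
      by (simp only: ra_sum ra_scale mult.commute)
    then show ?thesis
      by (simp only: ra_contract[where A = "\<lambda>w. \<phi> [axis i 1, axis p 1, w]" and B = "\<lambda>w. \<phi> [axis _ 1, axis _ 1, w]", OF phi_linear(3) phi_linear(3)] mult.commute)
  qed
  then have 1: "ra n (\<lambda>i. \<Sum>b\<in>UNIV. ra m (\<lambda>j. ra a (\<lambda>k. ra b (\<lambda>l. ph j k l))) * ph i p b)
     = ra m (\<lambda>j. ra a (\<lambda>k. ra n (\<lambda>i. \<Sum>r\<in>{1..7}. sgn7 r * (\<phi> [axis j 1, axis k 1, E r] * \<phi> [axis i 1, axis p 1, E r]))))"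
    by (simp only: ra_rot[of n])
  have 2: "ra m (\<lambda>j. ra a (\<lambda>k. ra n (\<lambda>i. g (axis j 1) (axis i 1) * g (axis k 1) (axis p 1)))) = cogram g $ n $ m * (if a = p then 1 else 0)"
  proof -
    have "ra n (\<lambda>i. g (axis j 1) (axis i 1)) = (if n = j then 1 else 0)" for j
      by (subst gram_sym_g) (rule ra_metric)
    then have "ra m (\<lambda>j. ra a (\<lambda>k. ra n (\<lambda>i. g (axis j 1) (axis i 1) * g (axis k 1) (axis p 1))))
      = ra m (\<lambda>j. if n = j then 1 else 0) * (if a = p then 1 else 0)"
      by (simp only: ra_scale_right ra_scale ra_metric)
    moreover have "ra m (\<lambda>j. if n = j then 1 else 0) = cogram g $ m $ n"
      by (simp add: ra_def)
    moreover have "cogram g $ m $ n = cogram g $ n $ m" by (simp add: cogram_eq mult.commute)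
    ultimately show ?thesis by simp
  qed
  have 3: "ra m (\<lambda>j. ra a (\<lambda>k. ra n (\<lambda>i. g (axis j 1) (axis p 1) * g (axis k 1) (axis i 1)))) = cogram g $ n $ a * (if m = p then 1 else 0)"
  proof -
    have "ra n (\<lambda>i. g (axis j 1) (axis i 1)) = (if n = j then 1 else 0)" for j
      by (subst gram_sym_g) (rule ra_metric)
    then have "ra m (\<lambda>j. ra a (\<lambda>k. ra n (\<lambda>i. g (axis j 1) (axis p 1) * g (axis k 1) (axis i 1))))
      = (if m = p then 1 else 0) * ra a (\<lambda>k. if n = k then 1 else 0)"
      by (simp only: ra_scale_right ra_scale ra_metric)
    moreover have "ra a (\<lambda>k. if n = k then 1 else 0) = cogram g $ a $ n"
      by (simp add: ra_def)
    moreover have "cogram g $ a $ n = cogram g $ n $ a" by (simp add: cogram_eq mult.commute)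
    ultimately show ?thesis by simp
  qed
  show ?thesis unfolding 1 phi4_def ra_add ra_diff 2 3 by simp
qed

lemma coordinate_psi_swap:
  "ra m (\<lambda>j. ra n (\<lambda>k. ra a (\<lambda>i. phi4 (axis j 1) (axis k 1) (axis i 1) (axis p 1))))
   = - ra m (\<lambda>j. ra a (\<lambda>k. ra n (\<lambda>i. phi4 (axis j 1) (axis k 1) (axis i 1) (axis p 1))))"
proof -
  have "ra n (\<lambda>k. ra a (\<lambda>i. phi4 j (axis k 1) (axis i 1) p)) = - ra a (\<lambda>k. ra n (\<lambda>i. phi4 j (axis k 1) (axis i 1) p))" for j p
    by (subst ra_ra, subst phi4_swap) (simp only: ra_minus)
  then show ?thesis by (simp only: ra_minus)
qed

text \<open>The array \<open>P\<close> is extended to a multilinear map \<open>Q\<close>, so that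
  \<open>closed_torsion\<close> applies to the components of \<open>Q\<close> in the frame. The
  contraction lemmas carry both sides back to coordinates.\<close>

lemma coordinate_torsion:
  fixes P :: "7 \<Rightarrow> 7 \<Rightarrow> 7 \<Rightarrow> 7 \<Rightarrow> real"
  assumes swap: "\<And>m a b c. P m b a c = - P m a b c" "\<And>m a b c. P m a c b = - P m a b c"
    and metric: "\<And>m i j. (\<Sum>a\<in>UNIV. \<Sum>b\<in>UNIV. P m i a b * ra j (\<lambda>k. ra a (\<lambda>l. ra b (\<lambda>r. ph k l r))))
      + (\<Sum>a\<in>UNIV. \<Sum>b\<in>UNIV. ph i a b * ra j (\<lambda>k. ra a (\<lambda>l. ra b (\<lambda>r. P m k l r)))) = 0"
    and closed: "\<And>m a b c. P m a b c - P a m b c + P b m a c - P c m a b = 0"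
  shows "(\<Sum>n\<in>UNIV. ra n (\<lambda>i. \<Sum>m\<in>UNIV. \<Sum>a\<in>UNIV. \<Sum>b\<in>UNIV. ra m (\<lambda>j. ra a (\<lambda>k. ra b (\<lambda>l. P n j k l))) * P m i a b))
    = 2 * (\<Sum>a\<in>UNIV. \<Sum>b\<in>UNIV. ra a (\<lambda>j. ra b (\<lambda>k. \<Sum>m\<in>UNIV. ra m (\<lambda>i. P m i j k))) * (\<Sum>m\<in>UNIV. ra m (\<lambda>i. P m i a b)))"
proof -
  define Q where "Q u w y z = lin_ext (\<lambda>m. lin_ext (\<lambda>a. lin_ext (\<lambda>b. lin_ext (\<lambda>c. P m a b c) z) y) w) u" for u w y z
  have Qe: "P m a b c = Q (axis m 1) (axis a 1) (axis b 1) (axis c 1)" for m a b c by (simp add: Q_def)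
  have Ql: "linear (\<lambda>u. Q u w y z)" "linear (\<lambda>w. Q u w y z)" "linear (\<lambda>y. Q u w y z)" "linear (\<lambda>z. Q u w y z)" for u w y z
    unfolding Q_def by (intro linear_lin_ext linear_lin_ext_param)+
  \<comment> \<open>A multilinear expression that vanishes on the standard basis vanishes
    everywhere; this moves the hypotheses from coordinates to the frame.\<close>
  have ext4: "h u w y z = 0" if "\<And>w y z. linear (\<lambda>u. h u w y z)" "\<And>u y z. linear (\<lambda>w. h u w y z)" "\<And>u w z. linear (\<lambda>y. h u w y z)"
     "\<And>u w y. linear (\<lambda>z. h u w y z)" "\<And>m a b c. h (axis m 1) (axis a 1) (axis b 1) (axis c 1) = 0" for h :: "real ^ 7 \<Rightarrow> real ^ 7 \<Rightarrow> real ^ 7 \<Rightarrow> real ^ 7 \<Rightarrow> real" and u w y z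
  proof -
    have 1: "h (axis m 1) (axis a 1) (axis b 1) z = 0" for m a b by (rule linear_eq_0_on_axis[OF that(4,5)])
    have 2: "h (axis m 1) (axis a 1) y z = 0" for m a by (rule linear_eq_0_on_axis[OF that(3) 1])
    have 3: "h (axis m 1) w y z = 0" for m by (rule linear_eq_0_on_axis[OF that(2) 2])
    show ?thesis by (rule linear_eq_0_on_axis[OF that(1) 3])
  qed
  have Qs1: "Q u y w z = - Q u w y z" for u w y z
  proof -
    have "Q u y w z + Q u w y z = 0"
      by (rule ext4[where h = "\<lambda>u w y z. Q u y w z + Q u w y z"])
        (intro linear_compose_add Ql | (simp only: Qe[symmetric], subst swap(1), simp))+
    then show ?thesis by simp
  qed
  have Qs2: "Q u w z y = - Q u w y z" for u w y z
  proof -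
    have "Q u w z y + Q u w y z = 0"
      by (rule ext4[where h = "\<lambda>u w y z. Q u w z y + Q u w y z"])
        (intro linear_compose_add Ql | (simp only: Qe[symmetric], subst swap(2), simp))+
    then show ?thesis by simp
  qed
  have Qc: "Q u w y z - Q w u y z + Q y u w z - Q z u w y = 0" for u w y z
    by (rule ext4[where h = "\<lambda>u w y z. Q u w y z - Q w u y z + Q y u w z - Q z u w y"])
      (intro linear_compose_add linear_compose_sub Ql | (simp only: Qe[symmetric], rule closed))+
  \<comment> \<open>The metric condition as a trilinear map: once zero on the standard basis, it is
    zero on the frame.\<close>
  define Z where "Z u w y = (\<Sum>k\<in>{1..7}. \<Sum>l\<in>{1..7}. sgn7 k * sgn7 l * (Q u w (E k) (E l) * \<phi> [y, E k, E l] + \<phi> [w, E k, E l] * Q u y (E k) (E l)))" for u w y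
  have Zl: "linear (\<lambda>u. Z u w y)" "linear (\<lambda>w. Z u w y)" "linear (\<lambda>y. Z u w y)" for u w y
  proof -
    have r: "linear (\<lambda>x. f x * c)" if "linear f" for f :: "real ^ 7 \<Rightarrow> real" and c
      using linear_scaled[OF that, of c] by (simp add: mult.commute)
    show "linear (\<lambda>u. Z u w y)" "linear (\<lambda>w. Z u w y)" "linear (\<lambda>y. Z u w y)"
      unfolding Z_def
      by (intro linear_compose_sum ballI linear_scaled[of _ "sgn7 _ * sgn7 _"] linear_compose_add Ql r phi_linear linear_scaled)+
  qed
  have Z0: "Z (axis m 1) (axis i 1) (axis j 1) = 0" for m i j
  proof -
    have e: "ra j (\<lambda>k. Z (axis m 1) (axis i 1) (axis k 1)) = 0" for j
    proof -
      have "(\<Sum>a\<in>UNIV. \<Sum>b\<in>UNIV. P m i a b * ra j (\<lambda>k. ra a (\<lambda>l. ra b (\<lambda>r. ph k l r))))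
        = (\<Sum>k\<in>{1..7}. \<Sum>l\<in>{1..7}. sgn7 k * sgn7 l * (Q (axis m 1) (axis i 1) (E k) (E l) * ra j (\<lambda>r. \<phi> [axis r 1, E k, E l])))"
        unfolding Qe by (subst ra_rot, rule ra_contract2[where A = "\<lambda>u w. Q (axis m 1) (axis i 1) u w" and B = "\<lambda>u w. ra j (\<lambda>k. \<phi> [axis k 1, u, w])"])
          (intro Ql phi_linear linear_ra)+
      moreover have "(\<Sum>a\<in>UNIV. \<Sum>b\<in>UNIV. ph i a b * ra j (\<lambda>k. ra a (\<lambda>l. ra b (\<lambda>r. P m k l r))))
        = (\<Sum>k\<in>{1..7}. \<Sum>l\<in>{1..7}. sgn7 k * sgn7 l * (\<phi> [axis i 1, E k, E l] * ra j (\<lambda>r. Q (axis m 1) (axis r 1) (E k) (E l))))"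
        unfolding Qe by (subst ra_rot, rule ra_contract2[where A = "\<lambda>u w. \<phi> [axis i 1, u, w]" and B = "\<lambda>u w. ra j (\<lambda>k. Q (axis m 1) (axis k 1) u w)"])
          (intro Ql phi_linear linear_ra)+
      ultimately show ?thesis
        using metric[of m i j] unfolding Z_def by (simp only: ra_sum ra_scale ra_add distrib_left sum.distrib)
    qed
    \<comment> \<open>\<open>metric\<close> gives the condition with \<open>j\<close> raised;
      contraction with the metric lowers it again.\<close>
    have "Z (axis m 1) (axis i 1) (axis j 1) = (\<Sum>a\<in>UNIV. g (axis a 1) (axis j 1) * ra a (\<lambda>k. Z (axis m 1) (axis i 1) (axis k 1)))"
    proof -
      have "(\<Sum>a\<in>UNIV. g (axis a 1) (axis j 1) * ra a (\<lambda>k. Z (axis m 1) (axis i 1) (axis k 1)))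
        = (\<Sum>a\<in>UNIV. Z (axis m 1) (axis i 1) (axis a 1) * ra a (\<lambda>k. g (axis k 1) (axis j 1)))"
        unfolding ra_def sum_distrib_left
        by (subst sum.swap) (simp add: mult_ac cogram_eq)
      also have "\<dots> = Z (axis m 1) (axis i 1) (axis j 1)" unfolding ra_metric by simp
      finally show ?thesis by simp
    qed
    then show ?thesis unfolding e by simp
  qed
  have Z: "Z u w y = 0" for u w y
  proof -
    have 1: "Z (axis m 1) (axis i 1) y = 0" for m i by (rule linear_eq_0_on_axis[OF Zl(3) Z0])
    have 2: "Z (axis m 1) w y = 0" for m by (rule linear_eq_0_on_axis[OF Zl(2) 1])
    show ?thesis by (rule linear_eq_0_on_axis[OF Zl(1) 2])
  qed
  have main: "(\<Sum>n\<in>{1..7}. \<Sum>m\<in>{1..7}. sgn7 n * sgn7 m *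
      (\<Sum>a\<in>{1..7}. \<Sum>b\<in>{1..7}. sgn7 a * sgn7 b * (Q (E n) (E m) (E a) (E b) * Q (E m) (E n) (E a) (E b))))
    = 2 * (\<Sum>a\<in>{1..7}. \<Sum>b\<in>{1..7}. sgn7 a * sgn7 b *
        ((\<Sum>m\<in>{1..7}. sgn7 m * Q (E m) (E m) (E a) (E b)) * (\<Sum>m\<in>{1..7}. sgn7 m * Q (E m) (E m) (E a) (E b))))"
    by (rule closed_torsion[where P = "\<lambda>m a b c. Q (E m) (E a) (E b) (E c)"])
      (rule Qs1 Qs2 Qc Z[unfolded Z_def])+
  define tt where "tt y z = (\<Sum>m\<in>{1..7}. sgn7 m * Q (E m) (E m) y z)" for y z
  have tl: "linear (\<lambda>y. tt y z)" "linear (\<lambda>z. tt y z)" for y z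
    unfolding tt_def by (intro linear_compose_sum ballI linear_scaled Ql)+
  have t: "(\<Sum>m\<in>UNIV. ra m (\<lambda>i. P m i a b)) = tt (axis a 1) (axis b 1)" for a b
  proof -
    have "(\<Sum>m\<in>UNIV. ra m (\<lambda>i. P m i a b)) = (\<Sum>m\<in>UNIV. \<Sum>i\<in>UNIV. cogram g $ m $ i * Q (axis m 1) (axis i 1) (axis a 1) (axis b 1))"
      by (simp only: ra_def Qe)
    then show ?thesis unfolding tt_def by (simp only: bilinear_contraction[where \<beta> = "\<lambda>u w. Q u w (axis a 1) (axis b 1)", OF Ql(2) Ql(1)])
  qed
  have R: "(\<Sum>a\<in>UNIV. \<Sum>b\<in>UNIV. ra a (\<lambda>j. ra b (\<lambda>k. \<Sum>m\<in>UNIV. ra m (\<lambda>i. P m i j k))) * (\<Sum>m\<in>UNIV. ra m (\<lambda>i. P m i a b)))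
    = (\<Sum>a\<in>{1..7}. \<Sum>b\<in>{1..7}. sgn7 a * sgn7 b * (tt (E a) (E b) * tt (E a) (E b)))"
    unfolding t by (subst mult.commute, rule ra_contract2) (rule tl)+
  have L1: "(\<Sum>m\<in>UNIV. \<Sum>a\<in>UNIV. \<Sum>b\<in>UNIV. ra m (\<lambda>j. ra a (\<lambda>k. ra b (\<lambda>l. P n j k l))) * P m i a b)
    = (\<Sum>r\<in>{1..7}. sgn7 r * (\<Sum>k\<in>{1..7}. \<Sum>l\<in>{1..7}. sgn7 k * sgn7 l * (Q (E r) (axis i 1) (E k) (E l) * Q (axis n 1) (E r) (E k) (E l))))" for n i
  proof -
    have "(\<Sum>m\<in>UNIV. \<Sum>a\<in>UNIV. \<Sum>b\<in>UNIV. ra m (\<lambda>j. ra a (\<lambda>k. ra b (\<lambda>l. P n j k l))) * P m i a b)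
      = (\<Sum>m\<in>UNIV. \<Sum>a\<in>UNIV. \<Sum>b\<in>UNIV. Q (axis m 1) (axis i 1) (axis a 1) (axis b 1) *
          ra a (\<lambda>k. ra b (\<lambda>l. ra m (\<lambda>j. Q (axis n 1) (axis j 1) (axis k 1) (axis l 1)))))"
      unfolding Qe by (subst ra_rot, subst mult.commute) (rule refl)
    also have "\<dots> = (\<Sum>m\<in>UNIV. \<Sum>k\<in>{1..7}. \<Sum>l\<in>{1..7}. sgn7 k * sgn7 l * (Q (axis m 1) (axis i 1) (E k) (E l) *
          ra m (\<lambda>j. Q (axis n 1) (axis j 1) (E k) (E l))))"
      by (rule sum.cong[OF refl], rule ra_contract2[where B = "\<lambda>y z. ra _ (\<lambda>j. Q (axis n 1) (axis j 1) y z)"]) (intro Ql linear_ra)+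
    also have "\<dots> = (\<Sum>k\<in>{1..7}. \<Sum>l\<in>{1..7}. sgn7 k * sgn7 l * (\<Sum>m\<in>UNIV. Q (axis m 1) (axis i 1) (E k) (E l) *
          ra m (\<lambda>j. Q (axis n 1) (axis j 1) (E k) (E l))))"
      unfolding sum_distrib_left by (subst sum.swap, rule sum.cong[OF refl], rule sum.swap)
    also have "\<dots> = (\<Sum>k\<in>{1..7}. \<Sum>l\<in>{1..7}. sgn7 k * sgn7 l * (\<Sum>r\<in>{1..7}. sgn7 r * (Q (E r) (axis i 1) (E k) (E l) *
          Q (axis n 1) (E r) (E k) (E l))))"
      by (intro sum.cong refl arg_cong2[where f = "(*)"]
          ra_contract[where A = "\<lambda>u. Q u (axis i 1) (E _) (E _)" and B = "\<lambda>u. Q (axis n 1) u (E _) (E _)", OF Ql(1) Ql(2)])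
    also have "\<dots> = (\<Sum>r\<in>{1..7}. sgn7 r * (\<Sum>k\<in>{1..7}. \<Sum>l\<in>{1..7}. sgn7 k * sgn7 l * (Q (E r) (axis i 1) (E k) (E l) * Q (axis n 1) (E r) (E k) (E l))))"
      unfolding sum_distrib_left
      by (subst sum_inner_out) (simp only: mult_ac)
    finally show ?thesis .
  qed
  have L: "(\<Sum>n\<in>UNIV. ra n (\<lambda>i. \<Sum>m\<in>UNIV. \<Sum>a\<in>UNIV. \<Sum>b\<in>UNIV. ra m (\<lambda>j. ra a (\<lambda>k. ra b (\<lambda>l. P n j k l))) * P m i a b))
    = (\<Sum>n\<in>{1..7}. sgn7 n * (\<Sum>r\<in>{1..7}. sgn7 r * (\<Sum>k\<in>{1..7}. \<Sum>l\<in>{1..7}. sgn7 k * sgn7 l * (Q (E r) (E n) (E k) (E l) * Q (E n) (E r) (E k) (E l)))))"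
    unfolding L1 unfolding ra_def
  proof (rule bilinear_contraction[where \<beta> = "\<lambda>u w. \<Sum>r\<in>{1..7}. sgn7 r * (\<Sum>k\<in>{1..7}. \<Sum>l\<in>{1..7}. sgn7 k * sgn7 l * (Q (E r) w (E k) (E l) * Q u (E r) (E k) (E l)))"])
    have r: "linear (\<lambda>x. f x * c)" if "linear f" for f :: "real ^ 7 \<Rightarrow> real" and c
      using linear_scaled[OF that, of c] by (simp add: mult.commute)
    show "linear (\<lambda>w. \<Sum>r\<in>{1..7}. sgn7 r * (\<Sum>k\<in>{1..7}. \<Sum>l\<in>{1..7}. sgn7 k * sgn7 l * (Q (E r) w (E k) (E l) * Q u (E r) (E k) (E l))))" for u
      by (intro linear_compose_sum ballI linear_scaled r Ql)
    show "linear (\<lambda>u. \<Sum>r\<in>{1..7}. sgn7 r * (\<Sum>k\<in>{1..7}. \<Sum>l\<in>{1..7}. sgn7 k * sgn7 l * (Q (E r) w (E k) (E l) * Q u (E r) (E k) (E l))))" for w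
      by (intro linear_compose_sum ballI linear_scaled Ql)
  qed
  have "(\<Sum>n\<in>{1..7}. sgn7 n * (\<Sum>r\<in>{1..7}. sgn7 r * (\<Sum>k\<in>{1..7}. \<Sum>l\<in>{1..7}. sgn7 k * sgn7 l * (Q (E r) (E n) (E k) (E l) * Q (E n) (E r) (E k) (E l)))))
    = (\<Sum>n\<in>{1..7}. \<Sum>m\<in>{1..7}. sgn7 n * sgn7 m *
      (\<Sum>a\<in>{1..7}. \<Sum>b\<in>{1..7}. sgn7 a * sgn7 b * (Q (E n) (E m) (E a) (E b) * Q (E m) (E n) (E a) (E b))))"
    by (simp only: sum_distrib_left mult_ac)
  then show ?thesis unfolding L R main tt_def by simp
qed

end

end

section \<open>The codifferential of a closed \<open>G\<^sub>2\<^sup>*\<close>-structure\<close>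

lemma forms_move:
  assumes a: "\<alpha> \<in> forms n" shows "\<alpha> (us @ x # ws) = (- 1) ^ length us * \<alpha> (x # us @ ws)"
proof (cases "length (us @ x # ws) = n")
  case True
  then show ?thesis
  proof (induction us arbitrary: ws rule: rev_induct)
    case (snoc u us)
    let ?L = "us @ x # u # ws"
    have "\<alpha> ((us @ [u]) @ x # ws) = \<alpha> (?L[length us := ?L ! Suc (length us), Suc (length us) := ?L ! length us])"
      by (simp add: list_update_append nth_append)
    also have "\<dots> = - \<alpha> ?L" by (rule forms_swap[OF a]) (use snoc.prems in auto)
    also have "\<alpha> ?L = (- 1) ^ length us * \<alpha> (x # us @ u # ws)" by (rule snoc.IH) (use snoc.prems in simp)
    finally show ?case by simp
  qed simp
qed (use forms_length[OF a] in simp)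

text \<open>Separates the index at position \<open>i\<close>, which is the differentiated one in the
  i-th term of an exterior derivative.\<close>

lemma sum_lists_insert:
  fixes h :: "'n::finite list \<Rightarrow> real"
  assumes "i \<le> k"
  shows "(\<Sum>J | length J = Suc k. h J) = (\<Sum>m\<in>UNIV. \<Sum>K | length K = k. h (take i K @ m # drop i K))"
proof -
  have "(\<Sum>m\<in>UNIV. \<Sum>K | length K = k. h (take i K @ m # drop i K)) = (\<Sum>(m, K)\<in>UNIV \<times> {K. length K = k}. h (take i K @ m # drop i K))"
    by (simp add: sum.cartesian_product)
  also have "\<dots> = (\<Sum>J | length J = Suc k. h J)"
    by (rule sum.reindex_bij_witness[where i = "\<lambda>J. (J ! i, take i J @ drop (Suc i) J)" and j = "\<lambda>(m, K). take i K @ m # drop i K"])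
      (use assms in \<open>auto simp: nth_append min_def id_take_nth_drop[symmetric]\<close>)
  finally show ?thesis by simp
qed

text \<open>Applied to the index-raising map on basis vectors, it expresses a determinant as an
  iterated contraction.\<close>

lemma multilinear_expand:
  fixes M :: "(real ^ 'n::finite) form"
  assumes "multilinear (length J) M"
  shows "M (map (\<lambda>j. \<Sum>i\<in>UNIV. c i j *\<^sub>R axis i 1) J) = (\<Sum>I | length I = length J. (\<Prod>l<length J. c (I ! l) (J ! l)) * M (ebasis I))"
  using assms
proof (induction J arbitrary: M)
  case Nil
  then show ?case by simp
next
  case (Cons j J)
  let ?S = "\<lambda>j. \<Sum>i\<in>UNIV. c i j *\<^sub>R axis i (1::real) :: real ^ 'n"
  have M: "linear (\<lambda>v. M (vs[l := v]))" if "length vs = Suc (length J)" "l < Suc (length J)" for vs l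
    using Cons.prems that by (simp add: multilinear_def)
  have lin: "linear (\<lambda>v. M (v # map ?S J))"
    using M[of "0 # map ?S J" 0] by simp
  have ml: "multilinear (length J) (\<lambda>ws. M (axis i 1 # ws))" for i
    unfolding multilinear_def
  proof (intro allI impI, elim conjE)
    fix vs :: "(real ^ 'n) list" and l assume "length vs = length J" "l < length J"
    then have "linear (\<lambda>v. M ((axis i 1 # vs)[Suc l := v]))" by (intro M) auto
    then show "linear (\<lambda>v. M (axis i 1 # vs[l := v]))" by simp
  qed
  have "M (map ?S (j # J)) = (\<Sum>i\<in>UNIV. c i j * M (axis i 1 # map ?S J))"
    using linear_sum[OF lin, of "\<lambda>i. c i j *\<^sub>R axis i 1" UNIV] linear_cmul[OF lin] by simp
  also have "\<dots> = (\<Sum>i\<in>UNIV. \<Sum>I | length I = length J. c i j * ((\<Prod>l<length J. c (I ! l) (J ! l)) * M (ebasis (i # I))))"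
    by (simp add: Cons.IH[OF ml] sum_distrib_left)
  also have "\<dots> = (\<Sum>I | length I = Suc (length J). (\<Prod>l<Suc (length J). c (I ! l) ((j # J) ! l)) * M (ebasis I))"
    unfolding sum_lists_Suc prod.lessThan_Suc_shift by (simp add: mult.assoc)
  finally show ?case by simp
qed

text \<open>Lets \<open>det_form_contraction\<close>, which speaks of forms, be applied to a skew
  array of derivatives.\<close>

lemma array_form:
  fixes h :: "'n::finite \<Rightarrow> 'n \<Rightarrow> 'n \<Rightarrow> real"
  assumes swap: "\<And>a b c. h b a c = - h a b c" "\<And>a b c. h a c b = - h a b c"
  obtains \<alpha> :: "(real ^ 'n) form" where "\<alpha> \<in> forms 3" "\<And>a b c. \<alpha> [axis a 1, axis b 1, axis c 1] = h a b c"
proof -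
  define Q where "Q x y z = lin_ext (\<lambda>a. lin_ext (\<lambda>b. lin_ext (\<lambda>c. h a b c) z) y) x" for x y z
  have Ql: "linear (\<lambda>x. Q x y z)" "linear (\<lambda>y. Q x y z)" "linear (\<lambda>z. Q x y z)" for x y z
    unfolding Q_def by (intro linear_lin_ext linear_lin_ext_param)+
  have Qe: "Q (axis a 1) (axis b 1) (axis c 1) = h a b c" for a b c by (simp add: Q_def)
  have ext3: "H x y z = 0" if "\<And>y z. linear (\<lambda>x. H x y z)" "\<And>x z. linear (\<lambda>y. H x y z)" "\<And>x y. linear (\<lambda>z. H x y z)"
     "\<And>a b c. H (axis a 1) (axis b 1) (axis c 1) = 0" for H :: "real ^ 'n \<Rightarrow> real ^ 'n \<Rightarrow> real ^ 'n \<Rightarrow> real" and x y z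
  proof -
    have 1: "H (axis a 1) (axis b 1) z = 0" for a b by (rule linear_eq_0_on_axis[OF that(3,4)])
    have 2: "H (axis a 1) y z = 0" for a by (rule linear_eq_0_on_axis[OF that(2) 1])
    show ?thesis by (rule linear_eq_0_on_axis[OF that(1) 2])
  qed
  have "Q y x z + Q x y z = 0" for x y z
    by (rule ext3[where H = "\<lambda>x y z. Q y x z + Q x y z"]) (intro linear_compose_add Ql | (simp only: Qe, subst swap(1), simp))+
  then have s1: "Q x x z = 0" and s1': "Q y x z = - Q x y z" for x y z by (metis add_eq_0_iff double_zero, metis add_eq_0_iff)
  have "Q x z y + Q x y z = 0" for x y z
    by (rule ext3[where H = "\<lambda>x y z. Q x z y + Q x y z"]) (intro linear_compose_add Ql | (simp only: Qe, subst swap(2), simp))+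
  then have s2: "Q x y y = 0" for x y by (metis double_zero)
  have s3: "Q x y x = 0" for x y using s1'[of x y x] s2[of y x] s1'[of y x x] by simp
  define \<alpha> where "\<alpha> vs = (if length vs = 3 then Q (vs ! 0) (vs ! 1) (vs ! 2) else 0)" for vs :: "(real ^ 'n) list"
  have "\<alpha> \<in> forms 3"
  proof (rule formsI)
    fix vs :: "(real ^ 'n) list" and i :: nat assume l: "length vs = 3" "i < 3"
    then consider "i = 0" | "i = 1" | "i = 2" by linarith
    then show "linear (\<lambda>v. \<alpha> (vs[i := v]))"
      by cases (use l Ql in \<open>simp_all add: \<alpha>_def\<close>)
  next
    fix vs :: "(real ^ 'n) list" and i j :: nat assume l: "length vs = 3" "i < 3" "j < 3" "i \<noteq> j" "vs ! i = vs ! j"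
    have "i = 0 \<or> i = 1 \<or> i = 2" "j = 0 \<or> j = 1 \<or> j = 2" using l by auto
    then show "\<alpha> vs = 0"
      using l(1,4,5) s1 s2 s3 by (elim disjE) (auto simp: \<alpha>_def)
  qed (simp add: \<alpha>_def)
  moreover have "\<alpha> [axis a 1, axis b 1, axis c 1] = h a b c" for a b c by (simp add: \<alpha>_def Qe)
  ultimately show ?thesis using that by blast
qed

lemma partial_cmult:
  "f differentiable (at x) \<Longrightarrow> partial i (\<lambda>y. c * f y) x = c * partial i f x"
  using partial_mult[of "\<lambda>_. c" x f i] by simp

lemma ext_deriv_ebasis:
  "ext_deriv \<omega> x (ebasis J) = (\<Sum>i<length J. (- 1) ^ i * partial (J ! i) (\<lambda>y. \<omega> y (ebasis (take i J @ drop (Suc i) J))) x)"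
  unfolding ext_deriv_def partial_def by (simp add: take_map drop_map)

lemma form_inner_0: "form_inner k g \<alpha> (\<lambda>_. 0) = 0"
  by (simp add: form_inner_def)

context metric_chart
begin

lemma lower_raise:
  assumes "x \<in> U" shows "(\<Sum>p\<in>UNIV. lo i p x * raise p u x) = u i"
proof -
  have "(\<Sum>p\<in>UNIV. lo i p x * raise p u x) = (\<Sum>k\<in>UNIV. (\<Sum>p\<in>UNIV. lo i p x * up p k x) * u k)"
    unfolding raise_def sum_distrib_left sum_distrib_right by (subst sum.swap) (simp only: mult.assoc)
  then show ?thesis unfolding lo_up[OF assms] by simp
qed

lemma raise2_inject:
  assumes x: "x \<in> U" and e: "\<And>p q. raise p (\<lambda>i. raise q (\<lambda>j. u i j) x) x = raise p (\<lambda>i. raise q (\<lambda>j. w i j) x) x"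
  shows "u i j = w i j"
proof -
  have "raise q (\<lambda>j. u i j) x = raise q (\<lambda>j. w i j) x" for i q
    using lower_raise[OF x, of i "\<lambda>i. raise q (\<lambda>j. u i j) x"] lower_raise[OF x, of i "\<lambda>i. raise q (\<lambda>j. w i j) x"] e by simp
  then show ?thesis using lower_raise[OF x, of j "u i"] lower_raise[OF x, of j "w i"] by simp
qed

end

section \<open>One chart of a closed structure: smoothness of volume and metric\<close>

locale g2s_chart =
  fixes U :: "(real ^ 7) set" and \<phi> :: "real ^ 7 \<Rightarrow> (real ^ 7) form"
  assumes open_chart: "open U"
    and phi_forms: "\<And>x. x \<in> U \<Longrightarrow> \<phi> x \<in> forms 3"
    and phi_smooth: "\<And>vs. smooth_on U (\<lambda>x. \<phi> x vs)"
    and phi_g2s: "\<And>x. x \<in> U \<Longrightarrow> g2s_structure (\<phi> x)"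
    and phi_closed: "\<And>x. x \<in> U \<Longrightarrow> ext_deriv \<phi> x = (\<lambda>_. 0)"
begin

definition vol_density :: "real ^ 7 \<Rightarrow> real" where
  "vol_density x = g2s_vol (\<phi> x) (ebasis indices)"

lemma frame: assumes "x \<in> U" obtains E where "adapted_frame (\<phi> x) (g2s_coframe (\<phi> x)) E"
  using g2s_structure_adapted_frame[OF phi_g2s[OF assms]] by blast

lemma vol_density_nz: assumes x: "x \<in> U" shows "vol_density x \<noteq> 0"
proof -
  obtain E where "adapted_frame (\<phi> x) (g2s_coframe (\<phi> x)) E" using frame[OF x] .
  from adapted_frame.vol_ebasis[OF this] show ?thesis unfolding vol_density_def by (metis mult_zero_left zero_neq_one)
qed

lemma vol_density_det: assumes x: "x \<in> U" shows "(vol_density x)\<^sup>2 = det (gram (g2s_metric (\<phi> x)))"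
proof -
  obtain E where "adapted_frame (\<phi> x) (g2s_coframe (\<phi> x)) E" using frame[OF x] .
  from adapted_frame.det_gram[OF this] show ?thesis unfolding vol_density_def by simp
qed

lemma vol_forms: assumes x: "x \<in> U" shows "g2s_vol (\<phi> x) \<in> forms 7"
proof -
  obtain E where "adapted_frame (\<phi> x) (g2s_coframe (\<phi> x)) E" using frame[OF x] .
  from adapted_frame.vol_in_forms[OF this] show ?thesis .
qed

lemma vol_eq: assumes x: "x \<in> U" shows "g2s_vol (\<phi> x) vs = vol_density x * det_form vs"
  unfolding vol_density_def by (rule top_form_eq_det_form) (use vol_forms[OF x] in simp)

definition bry :: "7 \<Rightarrow> 7 \<Rightarrow> real ^ 7 \<Rightarrow> real" where
  "bry i j x = bryant_form (\<phi> x) (axis i 1) (axis j 1)"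

lemma smooth_bry: "smooth_on U (bry i j)"
  unfolding bry_def[abs_def] bryant_form_eq by (intro smooth_intros phi_smooth open_chart)

lemma bry_eq: assumes x: "x \<in> U" shows "bry i j x = 144 * vol_density x * gram (g2s_metric (\<phi> x)) $ i $ j"
proof -
  obtain E where "adapted_frame (\<phi> x) (g2s_coframe (\<phi> x)) E" using frame[OF x] .
  from adapted_frame.bryant_form_metric[OF this phi_forms[OF x]] show ?thesis
    by (simp add: bry_def vol_density_def gram_def)
qed

text \<open>The exponent 9 is 7 + 2: seven rows carry the factor \<open>144 * vol_density x\<close>,
  and the Gram determinant adds a square. As 9 is odd, the real root recovers the density with its
  sign.\<close>

lemma det_bry: assumes x: "x \<in> U" shows "det (\<chi> i j. bry i j x) = 144 ^ 7 * vol_density x ^ 9"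
proof -
  have "(\<chi> i j. bry i j x) = (\<chi> i. (144 * vol_density x) *s gram (g2s_metric (\<phi> x)) $ i)"
    by (simp add: bry_eq[OF x] vec_eq_iff)
  then have "det (\<chi> i j. bry i j x) = (144 * vol_density x) ^ 7 * det (gram (g2s_metric (\<phi> x)))"
    by (simp add: det_rows_mul)
  also have "\<dots> = 144 ^ 7 * (vol_density x ^ 7 * vol_density x ^ 2)"
    unfolding vol_density_det[OF x, symmetric] power_mult_distrib by (simp only: mult.assoc)
  finally show ?thesis by (simp only: power_add[symmetric]) simp
qed

text \<open>The Bryant form and the volume density determine each other algebraically, so both the volume and the
  metric depend smoothly on the point although the adapted coframes are chosen pointwise.\<close>

lemma smooth_vol_density: "smooth_on U vol_density"
proof (rule smooth_on_cong[OF open_chart])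
  show "smooth_on U (\<lambda>x. root 9 (inverse (144 ^ 7) * det (\<chi> i j. bry i j x)))"
  proof (rule smooth_on_root[OF open_chart])
    show "smooth_on U (\<lambda>x. inverse (144 ^ 7) * det (\<chi> i j. bry i j x))"
      by (intro smooth_on_mult smooth_on_const open_chart smooth_on_det) (simp add: smooth_bry)
    show "inverse (144 ^ 7) * det (\<chi> i j. bry i j x) \<noteq> 0" if "x \<in> U" for x
      unfolding det_bry[OF that] using vol_density_nz[OF that] by simp
  qed simp
  fix x assume x: "x \<in> U"
  have "inverse (144 ^ 7) * (144 ^ 7 * vol_density x ^ 9) = vol_density x ^ 9" by simp
  then show "root 9 (inverse (144 ^ 7) * det (\<chi> i j. bry i j x)) = vol_density x"
    unfolding det_bry[OF x] by (simp only: odd_real_root_power_cancel odd_numeral) (simp add: odd_real_root_power_cancel)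
qed

lemma smooth_metric: "smooth_on U (\<lambda>x. gram (g2s_metric (\<phi> x)) $ i $ j)"
proof (rule smooth_on_cong[OF open_chart])
  show "smooth_on U (\<lambda>x. bry i j x / (144 * vol_density x))"
    by (intro smooth_on_divide smooth_on_mult smooth_on_const smooth_bry smooth_vol_density open_chart)
      (simp add: vol_density_nz)
  show "bry i j x / (144 * vol_density x) = gram (g2s_metric (\<phi> x)) $ i $ j" if "x \<in> U" for x
    using vol_density_nz[OF that] by (simp add: bry_eq[OF that])
qed

sublocale metric_chart U "\<lambda>x. g2s_metric (\<phi> x)"
proof
  show "gram (g2s_metric (\<phi> x)) $ i $ j = gram (g2s_metric (\<phi> x)) $ j $ i" for x i j
    by (simp add: gram_def g2s_metric_def Let_def mult.commute)
  show "det (gram (g2s_metric (\<phi> x))) \<noteq> 0" if "x \<in> U" for x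
    using vol_density_det[OF that] vol_density_nz[OF that] by (metis power_not_zero)
qed (rule open_chart smooth_metric)+

text \<open>Extended by 0 outside the chart image, so that skewness holds at all points, as
  \<open>closed_g2_chart\<close> demands.\<close>

definition phc :: "7 \<Rightarrow> 7 \<Rightarrow> 7 \<Rightarrow> real ^ 7 \<Rightarrow> real" where
  "phc a b c x = (if x \<in> U then \<phi> x [axis a 1, axis b 1, axis c 1] else 0)"

lemma smooth_phc: "smooth_on U (phc a b c)"
  by (rule smooth_on_cong[OF open_chart phi_smooth[of "[axis a 1, axis b 1, axis c 1]"]]) (simp add: phc_def)

lemma partial_phc: "x \<in> U \<Longrightarrow> partial m (phc a b c) x = partial m (\<lambda>y. \<phi> y [axis a 1, axis b 1, axis c 1]) x"
  by (rule partial_cong[OF open_chart]) (auto simp: phc_def intro: smooth_on_differentiable[OF smooth_phc])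

lemma ra_eq_raise:
  assumes "adapted_frame (\<phi> x) v E" shows "adapted_frame.ra (\<phi> x) a u = raise a u x"
  unfolding adapted_frame.ra_def[OF assms] raise_def up_def ..

sublocale closed_g2_chart U "\<lambda>x. g2s_metric (\<phi> x)" phc vol_density
proof
  show "phc b a c x = - phc a b c x" "phc a c b x = - phc a b c x" for a b c x
    using forms_3_swap(1)[OF phi_forms, of x "axis b 1" "axis a 1" "axis c 1"]
      forms_3_swap(2)[OF phi_forms, of x "axis a 1" "axis c 1" "axis b 1"]
    by (cases "x \<in> U", simp_all add: phc_def)+
next
  fix x and i j :: 7 assume x: "x \<in> U"
  obtain E where fr: "adapted_frame (\<phi> x) (g2s_coframe (\<phi> x)) E" using frame[OF x] .
  from adapted_frame.coordinate_contract[OF this phi_forms[OF x], of i j]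
  show "(\<Sum>a\<in>UNIV. \<Sum>b\<in>UNIV. phc i a b x * raise3 phc j a b x) = (if i = j then 6 else 0)"
    unfolding ra_eq_raise[OF fr] raise3_def using x by (simp add: phc_def)
next
  fix x and m a b c :: 7 assume x: "x \<in> U"
  have "ext_deriv \<phi> x (ebasis [m, a, b, c]) = 0" unfolding phi_closed[OF x] ..
  then show "partial m (phc a b c) x - partial a (phc m b c) x + partial b (phc m a c) x - partial c (phc m a b) x = 0"
    unfolding ext_deriv_ebasis partial_phc[OF x]
    by (simp add: eval_nat_numeral)
qed (rule smooth_phc smooth_vol_density vol_density_nz vol_density_det | assumption)+

section \<open>Computation of the codifferential\<close>

lemma star_phi:
  assumes x: "x \<in> U" and K: "length K = 4"
  shows "g2s_star 3 (\<phi> x) (\<phi> x) (ebasis K) =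
    (\<Sum>I | length I = 3. 1 / 6 * det_form (ebasis (I @ K)) * (vol_density x * F (I ! 0) (I ! 1) (I ! 2) x))"
proof -
  let ?g = "g2s_metric (\<phi> x)"
  have "g2s_star 3 (\<phi> x) (\<phi> x) (ebasis K) = form_inner 3 ?g (\<lambda>ws. g2s_vol (\<phi> x) (ws @ ebasis K)) (\<phi> x)"
    unfolding g2s_star_def by (subst hodge_star_eq(1)) (simp_all add: vol_forms[OF x])
  also have "\<dots> = (\<Sum>I | length I = 3. 1 / 6 * det_form (ebasis (I @ K)) * (vol_density x *
      (\<Sum>J | length J = 3. (\<Prod>l<3. cogram ?g $ (I ! l) $ (J ! l)) * \<phi> x (ebasis J))))"
    unfolding form_inner_def vol_eq[OF x]
    by (simp add: sum_divide_distrib sum_distrib_left fact_numeral mult_ac)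
  also have "\<dots> = (\<Sum>I | length I = 3. 1 / 6 * det_form (ebasis (I @ K)) * (vol_density x * F (I ! 0) (I ! 1) (I ! 2) x))"
  proof -
    have "(\<Sum>J | length J = 3. (\<Prod>l<3. cogram ?g $ (I ! l) $ (J ! l)) * \<phi> x (ebasis J)) = F (I ! 0) (I ! 1) (I ! 2) x" for I
      unfolding raise3_def raise_def numeral_3_eq_3 sum_lists_Suc sum_lists_0 sum_distrib_left
      using x by (simp add: up_def phc_def mult.assoc numeral_2_eq_2 lessThan_Suc mult_ac)
    then show ?thesis by simp
  qed
  finally show ?thesis .
qed

lemma d_star_phi:
  assumes x: "x \<in> U" and J: "length J = 5"
  shows "ext_deriv (\<lambda>y. g2s_star 3 (\<phi> y) (\<phi> y)) x (ebasis J) =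
    (\<Sum>i<5. (- 1) ^ i * (\<Sum>I | length I = 3. 1 / 6 * det_form (ebasis (I @ (take i J @ drop (Suc i) J)))
       * partial (J ! i) (\<lambda>y. vol_density y * F (I ! 0) (I ! 1) (I ! 2) y) x))"
  unfolding ext_deriv_ebasis J
proof (intro sum.cong refl arg_cong2[where f = "(*)"])
  fix i :: nat assume i: "i \<in> {..<5}"
  let ?K = "take i J @ drop (Suc i) J"
  have K: "length ?K = 4" using J i by auto
  have d: "(\<lambda>y. vol_density y * F a b c y) differentiable (at x)" for a b c
    by (rule smooth_on_differentiable[OF smooth_on_mult[OF open_chart smooth_vol_density smooth_F] x])
  have "partial (J ! i) (\<lambda>y. \<Sum>I | length I = 3. 1 / 6 * det_form (ebasis (I @ ?K)) * (vol_density y * F (I ! 0) (I ! 1) (I ! 2) y)) x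
    = partial (J ! i) (\<lambda>y. g2s_star 3 (\<phi> y) (\<phi> y) (ebasis ?K)) x"
    by (rule partial_cong[OF open_chart x])
      (use star_phi[OF _ K] d in \<open>auto intro!: differentiable_sum differentiable_mult simp del: map_append\<close>)
  moreover have "partial (J ! i) (\<lambda>y. \<Sum>I | length I = 3. 1 / 6 * det_form (ebasis (I @ ?K)) * (vol_density y * F (I ! 0) (I ! 1) (I ! 2) y)) x
    = (\<Sum>I | length I = 3. 1 / 6 * det_form (ebasis (I @ ?K)) * partial (J ! i) (\<lambda>y. vol_density y * F (I ! 0) (I ! 1) (I ! 2) y) x)"
  proof -
    have ps: "partial (J ! i) (\<lambda>y. \<Sum>I | length I = 3. c I * h I y) x = (\<Sum>I | length I = 3. c I * partial (J ! i) (h I) x)"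
      if "\<And>I. h I differentiable (at x)" for c :: "7 list \<Rightarrow> real" and h
      using that by (subst partial_sum) (auto simp: partial_cmult)
    show ?thesis by (rule ps[OF d])
  qed
  ultimately show "partial (J ! i) (\<lambda>y. g2s_star 3 (\<phi> y) (\<phi> y) (ebasis ?K)) x
    = (\<Sum>I | length I = 3. 1 / 6 * det_form (ebasis (I @ ?K)) * partial (J ! i) (\<lambda>y. vol_density y * F (I ! 0) (I ! 1) (I ! 2) y) x)"
    by simp
qed

text \<open>Raising all seven indices multiplies the symbol by the determinant of the inverse
  metric, which is 1/V^2.\<close>

lemma det_form_raised:
  assumes x: "x \<in> U" and L: "length L = 7"
  shows "(\<Sum>I | length I = 7. (\<Prod>l<7. up (I ! l) (L ! l) x) * det_form (ebasis I)) = det_form (ebasis L) / (vol_density x)\<^sup>2"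
proof -
  define S where "S u = (\<chi> i. \<Sum>j\<in>UNIV. up i j x * u $ j)" for u :: "real ^ 7"
  have S: "linear S"
    by (rule linearI) (simp_all add: S_def vec_eq_iff distrib_left sum.distrib sum_distrib_left mult.left_commute)
  have Sc: "S (axis j 1) $ i = up i j x" for i j
    by (simp add: S_def axis_def)
  have Se: "S (axis j 1) = (\<Sum>i\<in>UNIV. up i j x *\<^sub>R axis i 1)" for j
    unfolding vec_eq_iff Sc by (simp add: axis_def if_distrib cong: if_cong)
  let ?A = "\<lambda>vs. det_form (map S vs)"
  have "?A \<in> forms 7"
  proof (rule formsI)
    fix vs :: "(real ^ 7) list" and i :: nat assume l: "length vs = 7" "i < 7"
    have "linear (\<lambda>v. det_form ((map S vs)[i := v]))"
      by (rule forms_linear[OF det_form_in_forms]) (use l in auto)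
    from linear_compose[OF S this] show "linear (\<lambda>v. ?A (vs[i := v]))" by (simp add: o_def map_update)
  next
    fix vs :: "(real ^ 7) list" and i j :: nat assume l: "length vs = 7" "i < 7" "j < 7" "i \<noteq> j" "vs ! i = vs ! j"
    then show "?A vs = 0" by (intro forms_repeat[OF det_form_in_forms, of i _ j]) auto
  qed (simp add: det_form_def)
  then have "?A (ebasis L) = ?A (ebasis indices) * det_form (ebasis L)"
    by (intro top_form_eq_det_form) simp
  moreover have "?A (ebasis indices) = 1 / (vol_density x)\<^sup>2"
  proof -
    have "(\<chi> i::7. map S (ebasis indices) ! index_pos i) = transpose (cogram (g2s_metric (\<phi> x)))"
      using index_pos(1)[where 'n=7] by (simp add: vec_eq_iff index_pos Sc transpose_def up_def del: map_map)
    then have "?A (ebasis indices) = det (cogram (g2s_metric (\<phi> x)))"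
      by (simp add: det_form_def det_transpose)
    moreover have "det (gram (g2s_metric (\<phi> x))) * det (cogram (g2s_metric (\<phi> x))) = 1"
      using lo_up_matrix(1)[OF x] by (metis det_I det_mul)
    ultimately show ?thesis using det_gram_nz[OF x]
      unfolding vol_density_det[OF x] by (simp add: eq_divide_eq mult.commute)
  qed
  moreover have "?A (ebasis L) = (\<Sum>I | length I = 7. (\<Prod>l<7. up (I ! l) (L ! l) x) * det_form (ebasis I))"
  proof -
    have "map S (ebasis L) = map (\<lambda>j. \<Sum>i\<in>UNIV. up i j x *\<^sub>R axis i 1) L" by (simp add: Se)
    then show ?thesis
      using multilinear_expand[of L det_form "\<lambda>i j. up i j x"] forms_multilinear[OF det_form_in_forms[where 'n=7]] L
      by (simp del: map_map)
  qed
  ultimately show ?thesis by simp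
qed

text \<open>With the two free indices raised as well, all seven indices of the symbol in the outer
  star are up, and \<open>det_form_raised\<close> applies. Contraction with the symbol of the inner
  star leaves the derivatives of V F over V, which \<open>divergence_F\<close> identifies.\<close>

lemma codifferential_phi_raised:
  assumes x: "x \<in> U"
  shows "raise p (\<lambda>i. raise q (\<lambda>j. codifferential 3 \<phi> \<phi> x [axis i 1, axis j 1]) x) x = - t_up p q x"
proof -
  let ?xi = "ext_deriv (\<lambda>y. g2s_star 3 (\<phi> y) (\<phi> y)) x"
  let ?V = "vol_density x" and ?D = "\<lambda>L. det_form (ebasis (L :: 7 list))"
  let ?dF = "\<lambda>m I. partial m (\<lambda>y. vol_density y * F (I ! 0) (I ! 1) (I ! 2) y) x"
  have cd: "codifferential 3 \<phi> \<phi> x [axis i 1, axis j 1] =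
    - (\<Sum>J | length J = 5. ?xi (ebasis J) / 120 * (\<Sum>I | length I = 5. (\<Prod>l<5. up (I ! l) (J ! l) x) * (?V * ?D (I @ [i, j]))))" for i j
  proof -
    \<comment> \<open>The sign is (-1)^(7 * (3 + 1) + 1) = -1, and the outer star acts on forms of
      degree 8 - 3 = 5.\<close>
    have "codifferential 3 \<phi> \<phi> x [axis i 1, axis j 1] = - g2s_star 5 (\<phi> x) ?xi (ebasis [i, j])"
      by (simp add: codifferential_def)
    also have "g2s_star 5 (\<phi> x) ?xi (ebasis [i, j]) = form_inner 5 (g2s_metric (\<phi> x)) (\<lambda>ws. g2s_vol (\<phi> x) (ws @ ebasis [i, j])) ?xi"
      unfolding g2s_star_def by (subst hodge_star_eq(1)) (simp_all add: vol_forms[OF x])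
    also have "\<dots> = (\<Sum>J | length J = 5. ?xi (ebasis J) / 120 * (\<Sum>I | length I = 5. (\<Prod>l<5. up (I ! l) (J ! l) x) * (?V * ?D (I @ [i, j]))))"
      unfolding form_inner_def vol_eq[OF x]
      by (subst sum.swap) (simp add: sum_divide_distrib sum_distrib_left fact_numeral up_def mult_ac)
    finally show ?thesis .
  qed
  have 1: "raise p (\<lambda>i. raise q (\<lambda>j. \<Sum>I | length I = 5. (\<Prod>l<5. up (I ! l) (J ! l) x) * (?V * ?D (I @ [i, j]))) x) x
     = ?D (J @ [p, q]) / ?V" if J: "length J = 5" for J
  proof -
    have "raise p (\<lambda>i. raise q (\<lambda>j. \<Sum>I | length I = 5. (\<Prod>l<5. up (I ! l) (J ! l) x) * (?V * ?D (I @ [i, j]))) x) x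
      = ?V * (\<Sum>I | length I = 5. \<Sum>K | length K = 2. (\<Prod>l<7. up ((I @ K) ! l) ((J @ [p, q]) ! l) x) * ?D (I @ K))"
    proof -
      have pr: "(\<Prod>l<7. up ((I @ [i, j]) ! l) ((J @ [p, q]) ! l) x) = (\<Prod>l<5. up (I ! l) (J ! l) x) * (up p i x * up q j x)"
        if "length I = 5" for I i j
      proof -
        have "{..<7} = {..<5} \<union> {5, 6::nat}" by auto
        then have "(\<Prod>l<7. up ((I @ [i, j]) ! l) ((J @ [p, q]) ! l) x)
          = (\<Prod>l<5. up ((I @ [i, j]) ! l) ((J @ [p, q]) ! l) x) * (\<Prod>l\<in>{5, 6}. up ((I @ [i, j]) ! l) ((J @ [p, q]) ! l) x)"
          by (simp add: prod.union_disjoint)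
        also have "(\<Prod>l\<in>{5, 6}. up ((I @ [i, j]) ! l) ((J @ [p, q]) ! l) x) = up p i x * up q j x"
          using that J by (simp add: nth_append up_sym[OF x, of i p] up_sym[OF x, of j q])
        also have "(\<Prod>l<5. up ((I @ [i, j]) ! l) ((J @ [p, q]) ! l) x) = (\<Prod>l<5. up (I ! l) (J ! l) x)"
          using that J by (intro prod.cong refl) (simp add: nth_append)
        finally show ?thesis .
      qed
      have "raise p (\<lambda>i. raise q (\<lambda>j. \<Sum>I | length I = 5. (\<Prod>l<5. up (I ! l) (J ! l) x) * (?V * ?D (I @ [i, j]))) x) x
        = (\<Sum>I | length I = 5. \<Sum>i\<in>UNIV. \<Sum>j\<in>UNIV. ?V * ((\<Prod>l<7. up ((I @ [i, j]) ! l) ((J @ [p, q]) ! l) x) * ?D (I @ [i, j])))"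
        unfolding raise_sum unfolding raise_def sum_distrib_left
        by (intro sum.cong refl) (simp only: mem_Collect_eq pr mult_ac)
      then show ?thesis
        unfolding numeral_2_eq_2 sum_lists_Suc sum_lists_0 by (simp only: sum_distrib_left)
    qed
    also have "\<dots> = ?V * (\<Sum>L | length L = 7. (\<Prod>l<7. up (L ! l) ((J @ [p, q]) ! l) x) * ?D L)"
      using sum_lists_append[where p = 5 and q = 2 and h = "\<lambda>L. (\<Prod>l<7. up (L ! l) ((J @ [p, q]) ! l) x) * ?D L"] by simp
    also have "\<dots> = ?D (J @ [p, q]) / ?V"
      using det_form_raised[OF x, of "J @ [p, q]"] J vol_density_nz[OF x] by (simp add: power2_eq_square)
    finally show ?thesis .
  qed
  have 2: "raise p (\<lambda>i. raise q (\<lambda>j. codifferential 3 \<phi> \<phi> x [axis i 1, axis j 1]) x) x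
     = - (\<Sum>J | length J = 5. ?xi (ebasis J) / 120 * (?D (J @ [p, q]) / ?V))"
  proof -
    have pull: "raise p (\<lambda>i. raise q (\<lambda>j. - (\<Sum>J\<in>S. c J * W J i j)) x) x = - (\<Sum>J\<in>S. c J * raise p (\<lambda>i. raise q (\<lambda>j. W J i j) x) x)"
      for S and c :: "7 list \<Rightarrow> real" and W
      by (simp only: raise_minus raise_sum raise_scale)
    show ?thesis unfolding cd pull by (intro arg_cong[where f = uminus] sum.cong refl arg_cong2[where f = "(*)"] 1) simp
  qed
  \<comment> \<open>120 = 5 * 24: the five positions of the differentiated index contribute equally,
    and the two symbols contract to 24. It cancels the 5! of \<open>form_inner\<close>.\<close>
  have 3: "(\<Sum>J | length J = 5. ?xi (ebasis J) * ?D (J @ [p, q])) = 120 * (\<Sum>m\<in>UNIV. ?dF m [m, p, q])"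
  proof -
    define H where "H m K = (\<Sum>I | length I = 3. 1 / 6 * ?D (I @ K) * ?dF m I)" for m K
    have "(\<Sum>J | length J = 5. ?xi (ebasis J) * ?D (J @ [p, q]))
      = (\<Sum>J | length J = 5. \<Sum>i<5. (- 1) ^ i * H (J ! i) (take i J @ drop (Suc i) J) * ?D (J @ [p, q]))"
      by (intro sum.cong refl) (simp add: d_star_phi[OF x] H_def sum_distrib_right del: map_append)
    also have "\<dots> = (\<Sum>i<5. \<Sum>J | length J = Suc 4. (- 1) ^ i * H (J ! i) (take i J @ drop (Suc i) J) * ?D (J @ [p, q]))"
      by (subst sum.swap) simp
    also have "\<dots> = (\<Sum>i<5::nat. \<Sum>m\<in>UNIV. \<Sum>K | length K = 4. H m K * ?D (m # K @ [p, q]))"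
    proof (rule sum.cong[OF refl])
      fix i :: nat assume "i \<in> {..<5}"
      then have i: "i \<le> 4" by simp
      have "(- 1) ^ i * H ((take i K @ m # drop i K) ! i) (take i (take i K @ m # drop i K) @ drop (Suc i) (take i K @ m # drop i K)) * ?D ((take i K @ m # drop i K) @ [p, q])
        = H m K * ?D (m # K @ [p, q])" if K: "length K = 4" for m K
      proof -
        \<comment> \<open>Moving the differentiated index to the front costs the sign (-1)^i, which
          cancels the sign in the exterior derivative.\<close>
        have "?D ((take i K @ m # drop i K) @ [p, q]) = (- 1) ^ i * ?D (m # K @ [p, q])"
        proof -
          have "det_form (ebasis (take i K) @ axis m 1 # ebasis (drop i K @ [p, q])) = (- 1) ^ length (ebasis (take i K)) * det_form (axis m 1 # ebasis (take i K) @ ebasis (drop i K @ [p, q]))"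
            by (rule forms_move[OF det_form_in_forms])
          moreover have "ebasis (take i K) @ ebasis (drop i K) @ [axis p 1, axis q 1] = ebasis K @ [axis p 1, axis q (1::real)]"
            by (metis append_assoc append_take_drop_id map_append)
          ultimately show ?thesis using K i by simp
        qed
        moreover have "(- 1) ^ i * (- 1) ^ i = (1::real)" by (simp add: power_mult_distrib[symmetric])
        moreover have "(take i K @ m # drop i K) ! i = m" "take i (take i K @ m # drop i K) @ drop (Suc i) (take i K @ m # drop i K) = K"
          using K i by (simp_all add: nth_append)
        ultimately show ?thesis by (simp add: mult.left_commute[of _ "(- 1) ^ i"] mult.assoc[symmetric])
      qed
      then show "(\<Sum>J | length J = Suc 4. (- 1) ^ i * H (J ! i) (take i J @ drop (Suc i) J) * ?D (J @ [p, q]))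
        = (\<Sum>m\<in>UNIV. \<Sum>K | length K = 4. H m K * ?D (m # K @ [p, q]))"
        unfolding sum_lists_insert[OF i] by (intro sum.cong refl) simp
    qed
    also have "\<dots> = 5 * (\<Sum>m\<in>UNIV. \<Sum>K | length K = 4. H m K * ?D (m # K @ [p, q]))" by simp
    also have "(\<Sum>m\<in>UNIV. \<Sum>K | length K = 4. H m K * ?D (m # K @ [p, q])) = (\<Sum>m\<in>UNIV. 24 * ?dF m [m, p, q])"
    proof (rule sum.cong[OF refl])
      fix m
      \<comment> \<open>Moving \<open>p\<close> and then \<open>q\<close> to the front and
        exchanging \<open>q\<close> with \<open>m\<close> gives the signs (-1)^5, (-1)^6 and -1,
        whose product is 1.\<close>
      have mv: "?D (m # K @ [p, q]) = ?D ([m, p, q] @ K)" if K: "length K = 4" for K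
      proof -
        have "det_form ((axis m 1 # ebasis K) @ axis p 1 # [axis q 1]) = (- 1) ^ length (axis m 1 # ebasis K) * det_form (axis p 1 # (axis m 1 # ebasis K) @ [axis q (1::real)])"
          by (rule forms_move[OF det_form_in_forms])
        moreover have "det_form ((axis p 1 # axis m 1 # ebasis K) @ axis q 1 # []) = (- 1) ^ length (axis p 1 # axis m 1 # ebasis K) * det_form (axis q 1 # (axis p 1 # axis m 1 # ebasis K) @ [])"
          by (rule forms_move[OF det_form_in_forms])
        moreover have "det_form ((axis m 1 # axis p 1 # axis q 1 # ebasis K)[0 := axis q 1, 2 := axis m 1]) = - det_form (axis m 1 # axis p 1 # axis q 1 # ebasis K)"
          using forms_swap[OF det_form_in_forms[where 'n=7], of "axis m 1 # axis p 1 # axis q 1 # ebasis K" 0 2] K by (simp add: numeral_2_eq_2)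
        moreover have "(- 1) ^ 11 = (- 1 :: real)" "(- 1) ^ 6 = (1 :: real)" "(- 1) ^ 5 = (- 1 :: real)" by simp_all
        ultimately show ?thesis using K by (simp add: numeral_2_eq_2)
      qed
      have sw: "partial m (\<lambda>y. vol_density y * F b a c y) x = - partial m (\<lambda>y. vol_density y * F a b c y) x"
        "partial m (\<lambda>y. vol_density y * F a c b y) x = - partial m (\<lambda>y. vol_density y * F a b c y) x" for a b c
      proof -
        have d: "(\<lambda>y. vol_density y * F a b c y) differentiable (at x)"
          by (rule smooth_on_differentiable[OF smooth_on_mult[OF open_chart smooth_vol_density smooth_F] x])
        have "F b a c y = - F a b c y" "F a c b y = - F a b c y" for y by (rule F_swap)+
        then show "partial m (\<lambda>y. vol_density y * F b a c y) x = - partial m (\<lambda>y. vol_density y * F a b c y) x"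
          "partial m (\<lambda>y. vol_density y * F a c b y) x = - partial m (\<lambda>y. vol_density y * F a b c y) x"
          by (simp_all add: partial_minus[OF d])
      qed
      \<comment> \<open>The array is made into a 3-form for the contraction of the symbols. The
        resulting 3! 4! = 144, divided by the 6 in \<open>H\<close>, leaves 24.\<close>
      obtain \<alpha> :: "(real ^ 7) form" where al: "\<alpha> \<in> forms 3"
        "\<And>a b c. \<alpha> [axis a 1, axis b 1, axis c 1] = partial m (\<lambda>y. vol_density y * F a b c y) x"
        using array_form[of "\<lambda>a b c. partial m (\<lambda>y. vol_density y * F a b c y) x"] sw by blast
      have ale: "\<alpha> (ebasis I) = ?dF m I" if "length I = 3" for I
      proof -
        obtain a b c where "I = [a, b, c]" using \<open>length I = 3\<close> by (auto simp: numeral_3_eq_3 length_Suc_conv)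
        then show ?thesis using al(2) by (simp add: numeral_2_eq_2)
      qed
      have "(\<Sum>K | length K = 4. H m K * ?D (m # K @ [p, q]))
        = (\<Sum>K | length K = 4. \<Sum>I | length I = 3. 1 / 6 * (?D (I @ K) * ?D ([m, p, q] @ K) * \<alpha> (ebasis I)))"
        by (intro sum.cong refl) (simp add: H_def mv ale sum_distrib_left sum_distrib_right mult_ac del: map_append append_Cons append_Nil list.map)
      also have "\<dots> = 1 / 6 * (\<Sum>I | length I = 3. \<Sum>K | length K = 4. ?D (I @ K) * ?D ([m, p, q] @ K) * \<alpha> (ebasis I))"
        unfolding sum_distrib_left by (rule sum.swap)
      also have "\<dots> = 1 / 6 * (fact 3 * fact 4 * \<alpha> (ebasis [m, p, q]))"
        by (subst det_form_contraction[OF al(1)]) simp_all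
      also have "\<dots> = 24 * ?dF m [m, p, q]"
        by (simp add: ale fact_numeral del: list.map)
      finally show "(\<Sum>K | length K = 4. H m K * ?D (m # K @ [p, q])) = 24 * ?dF m [m, p, q]" .
    qed
    finally show ?thesis by (simp add: sum_distrib_left)
  qed
  have "(\<Sum>J | length J = 5. ?xi (ebasis J) / 120 * (?D (J @ [p, q]) / ?V)) = (\<Sum>J | length J = 5. ?xi (ebasis J) * ?D (J @ [p, q])) / (120 * ?V)"
    by (simp add: sum_divide_distrib)
  also have "\<dots> = t_up p q x"
    unfolding 3 using divergence_F[OF x, of p q] vol_density_nz[OF x] by (simp add: numeral_2_eq_2)
  finally show ?thesis unfolding 2 by simp
qed

lemma codifferential_phi:
  assumes x: "x \<in> U" shows "codifferential 3 \<phi> \<phi> x [axis i 1, axis j 1] = - t_lo i j x"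
  by (rule raise2_inject[OF x]) (simp only: codifferential_phi_raised[OF x] raise_minus t_up_eq)

text \<open>\<open>ext_deriv \<phi>\<close> is zero throughout the open set \<open>U\<close>, so its
  star is zero near \<open>x\<close> and has zero derivative there.\<close>

lemma codifferential_d_phi:
  assumes x: "x \<in> U" shows "codifferential 4 \<phi> (ext_deriv \<phi>) x vs = 0"
proof -
  have s: "g2s_star 4 (\<phi> y) (\<lambda>_. 0) = (\<lambda>_. 0)" if "y \<in> U" for y
    unfolding g2s_star_def by (subst hodge_star_eq(1)) (simp_all add: vol_forms[OF that] form_inner_0)
  have "frechet_derivative (\<lambda>y. g2s_star 4 (\<phi> y) (ext_deriv \<phi> y) us) (at x) = (\<lambda>_. 0)" for us
  proof -
    have "frechet_derivative (\<lambda>y. 0 :: real) (at x) = frechet_derivative (\<lambda>y. g2s_star 4 (\<phi> y) (ext_deriv \<phi> y) us) (at x)"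
      by (rule frechet_derivative_transform_within_open[OF _ open_chart x]) (simp_all add: phi_closed s)
    then show ?thesis by simp
  qed
  then have "ext_deriv (\<lambda>y. g2s_star 4 (\<phi> y) (ext_deriv \<phi> y)) x = (\<lambda>_. 0)"
    by (simp add: ext_deriv_def)
  then show ?thesis by (simp add: codifferential_def s[OF x])
qed

text \<open>Harmonicity gives dt = 0. Contracted with the skew \<open>F\<close>, the three terms of
  dt are equal, so three times the sum vanishes.\<close>

lemma harmonic_contraction:
  assumes x: "x \<in> U" and h: "laplacian 3 \<phi> \<phi> x = (\<lambda>_. 0)"
  shows "(\<Sum>n\<in>UNIV. \<Sum>a\<in>UNIV. \<Sum>b\<in>UNIV. F n a b x * partial n (t_lo a b) x) = 0"
proof -
  have pt: "partial m (\<lambda>y. codifferential 3 \<phi> \<phi> y [axis a 1, axis b 1]) x = - partial m (t_lo a b) x" for m a b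
  proof -
    have "partial m (\<lambda>y. - t_lo a b y) x = partial m (\<lambda>y. codifferential 3 \<phi> \<phi> y [axis a 1, axis b 1]) x"
      by (rule partial_cong[OF open_chart x]) (use diffble_t_lo[OF x] codifferential_phi in auto)
    then show ?thesis using partial_minus[OF diffble_t_lo[OF x]] by simp
  qed
  have e: "partial n (t_lo a b) x - partial a (t_lo n b) x + partial b (t_lo n a) x = 0" for n a b
  proof -
    have "laplacian 3 \<phi> \<phi> x (ebasis [n, a, b]) = 0" unfolding h ..
    then have "ext_deriv (codifferential 3 \<phi> \<phi>) x (ebasis [n, a, b]) = 0"
      by (simp add: laplacian_def codifferential_d_phi[OF x])
    then show ?thesis unfolding ext_deriv_ebasis by (simp add: lessThan_Suc pt)
  qed
  let ?S = "\<Sum>n\<in>UNIV. \<Sum>a\<in>UNIV. \<Sum>b\<in>UNIV. F n a b x * partial n (t_lo a b) x"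
  have "(\<Sum>n\<in>UNIV. \<Sum>a\<in>UNIV. \<Sum>b\<in>UNIV. F n a b x * (partial n (t_lo a b) x - partial a (t_lo n b) x + partial b (t_lo n a) x)) = 0"
    unfolding e by simp
  then have "?S - (\<Sum>n\<in>UNIV. \<Sum>a\<in>UNIV. \<Sum>b\<in>UNIV. F n a b x * partial a (t_lo n b) x)
    + (\<Sum>n\<in>UNIV. \<Sum>a\<in>UNIV. \<Sum>b\<in>UNIV. F n a b x * partial b (t_lo n a) x) = 0"
    by (simp only: right_diff_distrib distrib_left sum.distrib sum_subtractf)
  moreover have "(\<Sum>n\<in>UNIV. \<Sum>a\<in>UNIV. \<Sum>b\<in>UNIV. F n a b x * partial a (t_lo n b) x) = - ?S"
  proof -
    have "(\<Sum>n\<in>UNIV. \<Sum>a\<in>UNIV. \<Sum>b\<in>UNIV. F n a b x * partial a (t_lo n b) x)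
      = (\<Sum>n\<in>UNIV. \<Sum>a\<in>UNIV. \<Sum>b\<in>UNIV. F a n b x * partial n (t_lo a b) x)" by (rule sum.swap)
    also have "\<dots> = (\<Sum>n\<in>UNIV. \<Sum>a\<in>UNIV. \<Sum>b\<in>UNIV. - (F n a b x * partial n (t_lo a b) x))"
      by (intro sum.cong refl) (subst F_swap(1), simp)
    finally show ?thesis by (simp only: sum_negf)
  qed
  moreover have "(\<Sum>n\<in>UNIV. \<Sum>a\<in>UNIV. \<Sum>b\<in>UNIV. F n a b x * partial b (t_lo n a) x) = ?S"
  proof -
    have "(\<Sum>n\<in>UNIV. \<Sum>a\<in>UNIV. \<Sum>b\<in>UNIV. F n a b x * partial b (t_lo n a) x)
      = (\<Sum>n\<in>UNIV. \<Sum>a\<in>UNIV. \<Sum>b\<in>UNIV. F a b n x * partial n (t_lo a b) x)" by (rule sum3_rot[symmetric])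
    also have "\<dots> = ?S"
    proof (intro sum.cong refl arg_cong2[where f = "(*)"])
      show "F a b n x = F n a b x" for n a b
        using F_swap(1)[of n a b x] F_swap(2)[of a n b x] by simp
    qed
    finally show ?thesis .
  qed
  ultimately show ?thesis by linarith
qed

lemma scalar_curvature_zero:
  assumes x: "x \<in> U" and h: "laplacian 3 \<phi> \<phi> x = (\<lambda>_. 0)"
  shows "scalar_curvature (\<lambda>y. g2s_metric (\<phi> y)) x = 0"
proof -
  obtain E where fr: "adapted_frame (\<phi> x) (g2s_coframe (\<phi> x)) E" using frame[OF x] .
  note ra = ra_eq_raise[OF fr] and hc = harmonic_contraction[OF x h]
  have phx: "phc a b c x = \<phi> x [axis a 1, axis b 1, axis c 1]" for a b c using x by (simp add: phc_def)
  have psi_eq: "psi m a n p x = adapted_frame.ra (\<phi> x) m (\<lambda>j. adapted_frame.ra (\<phi> x) a (\<lambda>k. adapted_frame.ra (\<phi> x) n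
     (\<lambda>i. adapted_frame.phi4 (\<phi> x) E (axis j 1) (axis k 1) (axis i 1) (axis p 1))))" for m a n p
    unfolding adapted_frame.coordinate_psi[OF fr phi_forms[OF x], symmetric] unfolding ra psi_def raise3_def phx up_def ..
  have psi: "psi m n a p x = - psi m a n p x" for m a n p
    unfolding psi_eq by (rule adapted_frame.coordinate_psi_swap[OF fr phi_forms[OF x]])
  have "(\<Sum>n\<in>UNIV. raise n (\<lambda>i. \<Sum>m\<in>UNIV. \<Sum>a\<in>UNIV. \<Sum>b\<in>UNIV. PF n m a b x * P m i a b x) x)
    = 2 * (\<Sum>a\<in>UNIV. \<Sum>b\<in>UNIV. t_up a b x * t_lo a b x)"
    unfolding t_up_eq t_lo_def raise3_def
  proof (rule adapted_frame.coordinate_torsion[OF fr phi_forms[OF x], of "\<lambda>m a b c. P m a b c x", unfolded ra])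
    show "(\<Sum>a\<in>UNIV. \<Sum>b\<in>UNIV. P m i a b x * raise j (\<lambda>k. raise a (\<lambda>l. raise b (\<lambda>r. \<phi> x [axis k 1, axis l 1, axis r 1]) x) x) x)
      + (\<Sum>a\<in>UNIV. \<Sum>b\<in>UNIV. \<phi> x [axis i 1, axis a 1, axis b 1] * raise j (\<lambda>k. raise a (\<lambda>l. raise b (\<lambda>r. P m k l r x) x) x) x) = 0" for m i j
      using f_contract_derivative[OF x, of m i j] unfolding raise3_def phx .
  qed (rule P_swap[OF x] P_closed[OF x])+
  also have "\<dots> = 0" unfolding t_null[OF x hc] by simp
  finally show ?thesis using scalar_curvature_norm[OF x psi hc] by simp
qed

lemma einstein_scalar_curvature:
  assumes x: "x \<in> U" and e: "\<And>j k. ricci (\<lambda>y. g2s_metric (\<phi> y)) j k x = \<kappa> * gram (g2s_metric (\<phi> x)) $ j $ k"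
  shows "scalar_curvature (\<lambda>y. g2s_metric (\<phi> y)) x = 7 * \<kappa>"
proof -
  have "scalar_curvature (\<lambda>y. g2s_metric (\<phi> y)) x = (\<Sum>j\<in>UNIV. \<kappa> * (\<Sum>k\<in>UNIV. up j k x * lo k j x))"
    unfolding scalar_curvature_def e sum_distrib_left by (simp add: up_def lo_def gram_sym[of x] mult.left_commute)
  then show ?thesis unfolding up_lo[OF x] by simp
qed

end

section \<open>From charts to the manifold\<close>

lemma g2s_chart_of_structure:
  assumes "smooth_manifold M A" "g2s_structure_on A \<phi>" "closed_form A \<phi>" "c \<in> A"
  shows "g2s_chart (chart_image c) (\<phi> c)"
  using assms
  by unfold_locales (auto simp: smooth_manifold_def is_chart_def g2s_structure_on_def differential_form_def closed_form_def)

theorem theorem4p2: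
  fixes M :: "'a topology"
    and A :: "('a, 7) chart set"
    and \<phi> :: "('a, 7) chart \<Rightarrow> real ^ 7 \<Rightarrow> (real ^ 7) form"
  assumes "smooth_manifold M A"
    and "g2s_structure_on A \<phi>"
    and "closed_form A \<phi>"
    and "harmonic_form A \<phi> 3 \<phi>"
  shows "scalar_curvature_vanishes A (g2s_metric_field \<phi>) \<and>
         (einstein A (g2s_metric_field \<phi>) \<longrightarrow> ricci_flat A (g2s_metric_field \<phi>))"
proof -
  have chart: "g2s_chart (chart_image c) (\<phi> c)" if "c \<in> A" for c
    by (rule g2s_chart_of_structure[OF assms(1-3) that])
  have zero: "scalar_curvature (g2s_metric_field \<phi> c) x = 0" if "c \<in> A" "x \<in> chart_image c" for c x
    using g2s_chart.scalar_curvature_zero[OF chart[OF that(1)] that(2)] assms(4) that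
    by (simp add: harmonic_form_def g2s_metric_field_def[abs_def])
  have "ricci_flat A (g2s_metric_field \<phi>)" if ein: "einstein A (g2s_metric_field \<phi>)"
    unfolding ricci_flat_def
  proof (intro ballI allI)
    obtain \<kappa> where \<kappa>0: "\<forall>c\<in>A. \<forall>x\<in>chart_image c. \<forall>j k.
        ricci (g2s_metric_field \<phi> c) j k x = \<kappa> * gram (g2s_metric_field \<phi> c x) $ j $ k"
      using ein unfolding einstein_def by (elim exE)
    have \<kappa>: "ricci (g2s_metric_field \<phi> c) j k x = \<kappa> * gram (g2s_metric_field \<phi> c x) $ j $ k"
      if "c \<in> A" "x \<in> chart_image c" for c x j k
      using \<kappa>0 that by blast
    fix c x j k assume c: "c \<in> A" "x \<in> chart_image c"
    have "scalar_curvature (g2s_metric_field \<phi> c) x = 7 * \<kappa>"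
      using g2s_chart.einstein_scalar_curvature[OF chart[OF c(1)] c(2), of \<kappa>] \<kappa>[OF c]
      by (simp add: g2s_metric_field_def[abs_def])
    then show "ricci (g2s_metric_field \<phi> c) j k x = 0"
      using zero[OF c] \<kappa>[OF c] by simp
  qed
  then show ?thesis using zero by (simp add: scalar_curvature_vanishes_def)
qed

end
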